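(* Let $G$ be a metrizable precompact abelian group. Then $G$ is $ss$-characterized if and only if $G$ is countable. Moreover, for every sequence $\mathbf{u}=(u_n)$ in $G$ that characterizes the topology of $G$, the subgroup $\langle\mathbf{u}\rangle$ generated by $\mathbf{u}$ has finite index in $G$.
   Context: All topological groups are Hausdorff; groups are abelian and written additively. "Countable" means finite or countably infinite. A (Hausdorff) group topology on an abelian group $G$ is precompact if for every neighborhood $U$ of $0$ there is a finite set $F\subseteq G$ with $F+U=G$. A sequence $\mathbf{u}=(u_n)$ in an abelian group $G$ is a $TB$-sequence if there is a precompact group topology on $G$ in which $u_n\to 0$; in that case there is a finest precompact group topology on $G$ in which $u_n\to 0$, denoted $\tau_{\mathbf{u}}$. A sequence $\mathbf{u}$ in $G$ characterizes a precompact group topology $\tau$ on $G$ (and is called a characterizing sequence of $(G,\tau)$) if $\mathbf{u}$ is a $TB$-sequence and $\tau=\tau_{\mathbf{u}}$. A precompact group $(G,\tau)$ is called $ss$-characterized (single sequence characterized) if some sequence in $G$ characterizes $\tau$. *)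

theory Defs
  imports "HOL-Analysis.Analysis" "HOL-Computational_Algebra.Group_Closure"
begin

text \<open>
  The abstract group is a type of class \<open>ab_group_add\<close>. Topologies on it are values of
  type \<open>'a topology\<close>, because the notions below quantify over all group topologies on
  one fixed group. Being Hausdorff is part of being a group topology.
\<close>

definition group_topology :: "'a::ab_group_add topology \<Rightarrow> bool" where
  "group_topology \<tau> \<longleftrightarrow>
     topspace \<tau> = UNIV \<and>
     continuous_map (prod_topology \<tau> \<tau>) \<tau> (\<lambda>(x, y). x + y) \<and>
     continuous_map \<tau> \<tau> uminus \<and>
     Hausdorff_space \<tau>"

text \<open>In \<open>F + U\<close> the sum is the elementwise sum of sets from \<open>HOL-Library.Set_Algebras\<close>.\<close>

definition precompact_topology :: "'a::ab_group_add topology \<Rightarrow> bool" where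
  "precompact_topology \<tau> \<longleftrightarrow>
     group_topology \<tau> \<and>
     (\<forall>U. (\<exists>V. openin \<tau> V \<and> 0 \<in> V \<and> V \<subseteq> U) \<longrightarrow> (\<exists>F. finite F \<and> F + U = UNIV))"

definition TB_sequence :: "(nat \<Rightarrow> 'a::ab_group_add) \<Rightarrow> bool" where
  "TB_sequence u \<longleftrightarrow> (\<exists>\<tau>. precompact_topology \<tau> \<and> limitin \<tau> u 0 sequentially)"

text \<open>
  \<open>finest_precompact u \<tau>\<close> says that \<open>\<tau>\<close> is the finest precompact group topology in which
  \<open>u\<close> tends to 0; at most one \<open>\<tau>\<close> has this property.
\<close>

definition finest_precompact :: "(nat \<Rightarrow> 'a::ab_group_add) \<Rightarrow> 'a topology \<Rightarrow> bool" where
  "finest_precompact u \<tau> \<longleftrightarrow>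
     precompact_topology \<tau> \<and> limitin \<tau> u 0 sequentially \<and>
     (\<forall>\<sigma>. precompact_topology \<sigma> \<and> limitin \<sigma> u 0 sequentially \<longrightarrow>
          (\<forall>U. openin \<sigma> U \<longrightarrow> openin \<tau> U))"

lemma finest_precompact_unique:
  "finest_precompact u \<tau> \<Longrightarrow> finest_precompact u \<sigma> \<Longrightarrow> \<tau> = \<sigma>"
  unfolding finest_precompact_def topology_eq by blast

definition characterizes :: "(nat \<Rightarrow> 'a::ab_group_add) \<Rightarrow> 'a topology \<Rightarrow> bool" where
  "characterizes u \<tau> \<longleftrightarrow> TB_sequence u \<and> finest_precompact u \<tau>"

definition ss_characterized :: "'a::ab_group_add topology \<Rightarrow> bool" where
  "ss_characterized \<tau> \<longleftrightarrow> precompact_topology \<tau> \<and> (\<exists>u. characterizes u \<tau>)"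

definition finite_index :: "'a::ab_group_add set \<Rightarrow> bool" where
  "finite_index H \<longleftrightarrow> finite (range (\<lambda>x. x +o H))"

end

theory Submission
  imports Defs
begin

text \<open>
Homomorphisms from the group to the unit circle are called characters, whether continuous or not;
with the topology of pointwise convergence they form a compact group. If \<open>\<tau>\<close> is precompact and \<open>W\<close>
is a neighbourhood of 0, then only finitely many characters stay within \<open>1/4\<close> of 1 on \<open>W\<close>
(\<open>finite_almost_trivial_on\<close>), and all of these are continuous (\<open>continuous_characterI\<close>). Hence a
metrizable precompact group has only countably many continuous characters.

Let \<open>u\<close> characterize \<open>\<tau>\<close> and let \<open>H\<close> be the subgroup that it generates. Adjoining to \<open>\<tau>\<close> a character
that is trivial on \<open>H\<close> keeps the topology precompact and keeps \<open>u\<close> convergent to 0, so every such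
character is already continuous (\<open>annihilating_characters_continuous\<close>), and there are only countably
many of them. If \<open>H\<close> had infinite index there would be uncountably many (\<open>annihilator_uncountable\<close>),
since Haar measure on the annihilator of \<open>H\<close> would have no atoms. So \<open>H\<close> has finite index, and as \<open>H\<close>
is countable, so is the whole group.

Conversely let the group be countable and let \<open>W n\<close> be a decreasing base of neighbourhoods of 0. There
are finite sets \<open>A n \<subseteq> W n\<close> such that a character close to 1 on all but finitely many \<open>A n\<close> is continuous
(\<open>testing_sets_exist\<close>): each stage tests a character against the finite set of characters that are almost
trivial on \<open>W n\<close>, and the tests of neighbouring stages overlap so much that the approximating characters
eventually coincide. The sequence \<open>u\<close> enumerates the elements of all \<open>A n\<close>. If \<open>u\<close> tends to 0
in some precompact \<open>\<sigma>\<close>, then the \<open>\<sigma>\<close>-continuous characters tend to 1 along \<open>u\<close> and hence are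
\<open>\<tau>\<close>-continuous. That \<open>\<sigma>\<close> is coarser than \<open>\<tau>\<close> now follows because \<open>\<sigma>\<close> is generated by its continuous
characters (\<open>precompact_bohr_neighbourhood\<close>).

This last fact is the commutative Peter-Weyl theorem. The proof given here stays inside the group, using
neither a completion nor Haar measure. A neighbourhood of 0 contains the unit ball of a totally bounded
invariant seminorm \<open>p\<close>, and Lipschitz functions have means because averaging over a finite net contracts
their oscillation. For a point \<open>x\<close> outside the unit ball, the autocorrelation of the difference between
a bump function and its translate by \<open>x\<close> is a positive definite function whose value at 0 is bounded away from 0.
Every positive definite function is dominated by a character with respect to any given finitely supported
functional (\<open>state_dominated_by_character\<close>), because characters are the extreme points of the compact
convex set of normalised positive definite functions. Applied to the functionals that measure the Fourier
coefficients of that difference, this yields a character which is continuous, comes from a finite set that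
does not depend on \<open>x\<close>, and differs from 1 at \<open>x\<close> (\<open>unit_ball_contains_bohr_set\<close>).
\<close>

section \<open>Characters and the absence of small subgroups\<close>

definition character :: "('a::ab_group_add \<Rightarrow> complex) \<Rightarrow> bool" where
  "character \<xi> \<longleftrightarrow> (\<forall>x y. \<xi> (x + y) = \<xi> x * \<xi> y) \<and> (\<forall>x. cmod (\<xi> x) = 1)"

lemma character_add: "character \<xi> \<Longrightarrow> \<xi> (x + y) = \<xi> x * \<xi> y"
  and character_norm: "character \<xi> \<Longrightarrow> cmod (\<xi> x) = 1"
  by (auto simp: character_def)

lemma character_0:
  assumes "character \<xi>" shows "\<xi> 0 = 1"
proof -
  have "\<xi> 0 * \<xi> 0 = \<xi> 0 * 1" using character_add[OF assms, of 0 0] by simp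
  moreover have "\<xi> 0 \<noteq> 0" using character_norm[OF assms, of 0] by auto
  ultimately show ?thesis by simp
qed

lemma character_minus:
  assumes "character \<xi>" shows "\<xi> (- x) = cnj (\<xi> x)"
proof -
  have "\<xi> (-x) * \<xi> x = 1" using character_add[OF assms, of "-x" x] character_0[OF assms] by simp
  moreover have "cnj (\<xi> x) * \<xi> x = 1"
    using character_norm[OF assms, of x] complex_norm_square[of "\<xi> x"] by (simp add: mult.commute)
  moreover have "\<xi> x \<noteq> 0" using character_norm[OF assms, of x] by auto
  ultimately show ?thesis by (metis mult_right_cancel)
qed

lemma character_diff:
  assumes "character \<xi>" shows "\<xi> (x - y) = \<xi> x * cnj (\<xi> y)"
  using character_add[OF assms, of x "-y"] character_minus[OF assms] by simp

lemma character_times_cnj: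
  assumes "character \<xi>" "character \<eta>" shows "character (\<lambda>x. \<xi> x * cnj (\<eta> x))"
  using assms by (auto simp: character_def norm_mult)

lemma character_norm_diff:
  assumes "character \<xi>" shows "cmod (\<xi> (x + v) - \<xi> x) = cmod (\<xi> v - 1)"
proof -
  have "\<xi> (x + v) - \<xi> x = \<xi> x * (\<xi> v - 1)" by (simp add: character_add[OF assms] algebra_simps)
  then show ?thesis by (simp add: norm_mult character_norm[OF assms])
qed

lemma norm_square_minus_1:
  assumes "cmod w = 1" shows "(cmod (w + 1))\<^sup>2 = 4 - (cmod (w - 1))\<^sup>2"
proof -
  have "(Re w)\<^sup>2 + (Im w)\<^sup>2 = 1" using assms by (metis cmod_power2 one_power2)
  then show ?thesis unfolding cmod_power2 by (simp add: power2_eq_square algebra_simps)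
qed

text \<open>
On the circle \<open>\<bar>w + 1\<bar>\<^sup>2 + \<bar>w - 1\<bar>\<^sup>2 = 4\<close>, so \<open>\<bar>w + 1\<bar> \<ge> 3/2\<close> near 1 and squaring moves \<open>w\<close> away from 1.
\<close>

lemma norm_double_expands:
  assumes \<xi>: "character \<xi>" and b: "cmod (\<xi> y - 1) \<le> 1"
  shows "3 / 2 * cmod (\<xi> y - 1) \<le> cmod (\<xi> (y + y) - 1)"
proof -
  have "(cmod (\<xi> y - 1))\<^sup>2 \<le> 1" using b by (simp add: power_le_one)
  then have "(3/2)\<^sup>2 \<le> (cmod (\<xi> y + 1))\<^sup>2"
    unfolding norm_square_minus_1[OF character_norm[OF \<xi>]] by (simp add: power2_eq_square)
  then have "3/2 \<le> cmod (\<xi> y + 1)" by (rule power2_le_imp_le) simp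
  then have "3/2 * cmod (\<xi> y - 1) \<le> cmod (\<xi> y + 1) * cmod (\<xi> y - 1)"
    by (rule mult_right_mono) simp
  also have "\<dots> = cmod (\<xi> (y + y) - 1)"
    unfolding norm_mult[symmetric] by (simp add: character_add[OF \<xi>] algebra_simps)
  finally show ?thesis .
qed

text \<open>
The circle has no small subgroups: repeated doubling would carry a value different from 1 out of the
unit ball around 1.
\<close>

lemma character_trivial:
  assumes \<xi>: "character \<xi>" and b: "\<And>x. cmod (\<xi> x - 1) < 1"
  shows "\<xi> x = 1"
proof (rule ccontr)
  assume "\<xi> x \<noteq> 1"
  then have d: "cmod (\<xi> x - 1) > 0" by simp
  have "\<exists>y. (3/2) ^ k * cmod (\<xi> x - 1) \<le> cmod (\<xi> y - 1)" for k
  proof (induction k)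
    case (Suc k)
    then obtain y where y: "(3/2) ^ k * cmod (\<xi> x - 1) \<le> cmod (\<xi> y - 1)" by auto
    then have "(3/2) ^ Suc k * cmod (\<xi> x - 1) \<le> 3/2 * cmod (\<xi> y - 1)"
      unfolding power_Suc mult.assoc by (rule mult_left_mono) simp
    also have "\<dots> \<le> cmod (\<xi> (y + y) - 1)" using norm_double_expands[OF \<xi>] b by (meson less_imp_le)
    finally show ?case by blast
  qed auto
  then have "(3/2) ^ k * cmod (\<xi> x - 1) < 1" for k using b by (meson le_less_trans)
  moreover obtain k where "1 / cmod (\<xi> x - 1) < (3/2) ^ k" using real_arch_pow[of "3/2"] by auto
  ultimately show False using d by (metis divide_less_eq less_asym)
qed

text \<open>
Characters are rigid. This turns approximate statements about finitely many characters into
equalities.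
\<close>

lemma characters_eqI:
  assumes "character \<xi>" "character \<eta>" "\<And>x. cmod (\<xi> x - \<eta> x) < 1"
  shows "\<xi> = \<eta>"
proof
  fix x
  have u: "cnj (\<eta> x) * \<eta> x = 1" for x
    using character_norm[OF assms(2), of x] complex_norm_square[of "\<eta> x"] by (simp add: mult.commute)
  have "cmod (\<xi> x * cnj (\<eta> x) - 1) < 1" for x
  proof -
    have "\<xi> x * cnj (\<eta> x) - 1 = (\<xi> x - \<eta> x) * cnj (\<eta> x)"
      using u[of x] by (simp add: algebra_simps)
    then show ?thesis using assms(3)[of x] character_norm[OF assms(2), of x] by (simp add: norm_mult)
  qed
  then have "\<xi> x * cnj (\<eta> x) = 1" by (rule character_trivial[OF character_times_cnj[OF assms(1,2)]])
  then have "\<xi> x * (cnj (\<eta> x) * \<eta> x) = \<eta> x" by (simp add: mult.assoc[symmetric])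
  then show "\<xi> x = \<eta> x" using u[of x] by simp
qed

text \<open>
The polar of \<open>W\<close> among all characters. With the bound \<open>1/4\<close>, the errors of two such characters and a
further error below \<open>1/4\<close> add up to less than 1, the threshold of \<open>characters_eqI\<close>.
\<close>

definition almost_trivial_on :: "'a::ab_group_add set \<Rightarrow> ('a \<Rightarrow> complex) set" where
  "almost_trivial_on W = {\<xi>. character \<xi> \<and> (\<forall>w\<in>W. cmod (\<xi> w - 1) \<le> 1 / 4)}"

text \<open>
Every point differs from a point of \<open>F\<close> by an element of \<open>W\<close>, so a character in the polar is
determined by its values on \<open>F\<close>, even when these are rounded to a finite net of the disc.
\<close>

lemma finite_almost_trivial_on:
  assumes F: "finite F" "\<And>x. \<exists>y\<in>F. x - y \<in> W"
  shows "finite (almost_trivial_on W)"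
proof -
  have "\<exists>T. finite T \<and> cball (0::complex) 1 \<subseteq> (\<Union>x\<in>T. ball x (1/8))"
    using compact_cball[of "0::complex" 1] unfolding compact_eq_totally_bounded by simp
  then obtain T where T: "finite T" "cball (0::complex) 1 \<subseteq> (\<Union>x\<in>T. ball x (1/8))" by auto
  define r where "r z = (SOME t. t \<in> T \<and> dist t z < 1/8)" for z
  have r: "r z \<in> T" "dist (r z) z < 1/8" if "cmod z = 1" for z
  proof -
    have "\<exists>t. t \<in> T \<and> dist t z < 1/8" using T(2) that by (force simp: subset_iff)
    then have "r z \<in> T \<and> dist (r z) z < 1/8" unfolding r_def by (rule someI_ex)
    then show "r z \<in> T" "dist (r z) z < 1/8" by auto
  qed
  define R where "R \<xi> = restrict (\<lambda>x. r (\<xi> x)) F" for \<xi> :: "'a \<Rightarrow> complex"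
  have "inj_on R (almost_trivial_on W)"
  proof (rule inj_onI)
    fix \<xi> \<eta> assume A: "\<xi> \<in> almost_trivial_on W" "\<eta> \<in> almost_trivial_on W" and e: "R \<xi> = R \<eta>"
    then have ch: "character \<xi>" "character \<eta>" by (auto simp: almost_trivial_on_def)
    show "\<xi> = \<eta>"
    proof (rule characters_eqI[OF ch])
      fix x
      obtain y where y: "y \<in> F" "x - y \<in> W" using F(2) by auto
      have "r (\<xi> y) = r (\<eta> y)" using e y(1) unfolding R_def by (metis restrict_apply')
      then have 1: "cmod (\<xi> y - \<eta> y) < 1/4"
        using r(2)[OF character_norm[OF ch(1)], of y] r(2)[OF character_norm[OF ch(2)], of y]
          dist_triangle_half_r[of "r (\<xi> y)" "\<xi> y" "1/4" "\<eta> y"] by (auto simp: dist_norm)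
      have 2: "cmod (\<xi> (x - y) - 1) \<le> 1/4" "cmod (\<eta> (x - y) - 1) \<le> 1/4"
        using A y by (auto simp: almost_trivial_on_def)
      have "\<xi> x = \<xi> y * \<xi> (x - y)" "\<eta> x = \<eta> y * \<eta> (x - y)"
        using character_add[OF ch(1), of y "x - y"] character_add[OF ch(2), of y "x - y"] by auto
      then have "\<xi> x - \<eta> x = (\<xi> y - \<eta> y) + (\<xi> y * (\<xi> (x - y) - 1) - \<eta> y * (\<eta> (x - y) - 1))"
        by (simp add: algebra_simps)
      also have "cmod \<dots> \<le> cmod (\<xi> y - \<eta> y) + (cmod (\<xi> y * (\<xi> (x - y) - 1)) + cmod (\<eta> y * (\<eta> (x - y) - 1)))"
        by (meson add_left_mono norm_triangle_ineq norm_triangle_ineq4 order_trans)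
      also have "\<dots> < 1/4 + (1/4 + 1/4)"
        using 1 2 by (simp add: norm_mult character_norm[OF ch(1)] character_norm[OF ch(2)])
      finally show "cmod (\<xi> x - \<eta> x) < 1" by simp
    qed
  qed
  moreover have "R ` almost_trivial_on W \<subseteq> PiE F (\<lambda>_. T)"
    using r(1) by (auto simp: R_def almost_trivial_on_def character_norm)
  moreover have "finite (PiE F (\<lambda>_. T))" using F(1) T(1) by (simp add: finite_PiE)
  ultimately show ?thesis by (meson finite_imageD finite_subset)
qed

section \<open>Sums over lists\<close>

lemma Re_sum_list: "Re (\<Sum>x\<leftarrow>xs. h x) = (\<Sum>x\<leftarrow>xs. Re (h x))"
  and Im_sum_list: "Im (\<Sum>x\<leftarrow>xs. h x) = (\<Sum>x\<leftarrow>xs. Im (h x))"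
  and cnj_sum_list: "cnj (\<Sum>x\<leftarrow>xs. h x) = (\<Sum>x\<leftarrow>xs. cnj (h x))"
  by (induction xs) simp_all

lemma sum_list_concat_map:
  fixes f :: "'b \<Rightarrow> 'c::comm_monoid_add"
  shows "(\<Sum>z\<leftarrow>concat (map (\<lambda>x. map (k x) ys) xs). f z) = (\<Sum>x\<leftarrow>xs. \<Sum>y\<leftarrow>ys. f (k x y))"
  by (induction xs) (simp_all add: o_def)

lemma sum_list_swap:
  fixes h :: "'b \<Rightarrow> 'c \<Rightarrow> 'd::comm_monoid_add"
  shows "(\<Sum>x\<leftarrow>xs. \<Sum>y\<leftarrow>ys. h x y) = (\<Sum>y\<leftarrow>ys. \<Sum>x\<leftarrow>xs. h x y)"
  by (induction xs) (simp_all add: sum_list_addf)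

lemma sum_list_divide:
  fixes h :: "'b \<Rightarrow> 'd::field"
  shows "(\<Sum>x\<leftarrow>xs. h x / c) = (\<Sum>x\<leftarrow>xs. h x) / c"
  by (induction xs) (simp_all add: add_divide_distrib)

lemma sum_list_square_le:
  fixes a :: "'b \<Rightarrow> complex"
  shows "(cmod (\<Sum>x\<leftarrow>xs. a x))\<^sup>2 \<le> real (length xs) * (\<Sum>x\<leftarrow>xs. (cmod (a x))\<^sup>2)"
proof -
  have "cmod (\<Sum>x\<leftarrow>xs. a x) \<le> (\<Sum>i<length xs. cmod (a (xs ! i)))"
    unfolding sum_list_sum_nth by (simp add: norm_sum atLeast0LessThan)
  then have "(cmod (\<Sum>x\<leftarrow>xs. a x))\<^sup>2 \<le> (\<Sum>i<length xs. cmod (a (xs ! i)))\<^sup>2"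
    by (rule power_mono) simp
  also have "\<dots> \<le> (\<Sum>i<length xs. (cmod (a (xs ! i)))\<^sup>2) * real (card {..<length xs})"
    by (rule sum_squared_le_sum_of_squares)
  finally show ?thesis by (simp add: sum_list_sum_nth atLeast0LessThan mult.commute)
qed

lemma sum_sum_list:
  fixes h :: "'b \<Rightarrow> 'c \<Rightarrow> 'd::comm_monoid_add"
  shows "(\<Sum>x\<leftarrow>xs. \<Sum>f\<in>F. h x f) = (\<Sum>f\<in>F. \<Sum>x\<leftarrow>xs. h x f)"
  by (induction xs) (simp_all add: sum.distrib)

lemma sum_list_product:
  fixes a b :: "'b \<Rightarrow> 'd::semiring_0"
  shows "(\<Sum>x\<leftarrow>xs. a x) * (\<Sum>y\<leftarrow>ys. b y) = (\<Sum>x\<leftarrow>xs. \<Sum>y\<leftarrow>ys. a x * b y)"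
  by (simp add: sum_list_const_mult sum_list_mult_const)

section \<open>Positive definite functions and the characters that dominate them\<close>

text \<open>
The sesquilinear form of a function on the group, evaluated at finitely supported measures. A measure is a
list of pairs of a weight and a point, with repetitions of points allowed, so that addition and
translation of measures become concatenation and a map.
\<close>

definition herm_form :: "('a::ab_group_add \<Rightarrow> complex) \<Rightarrow> (complex \<times> 'a) list \<Rightarrow> (complex \<times> 'a) list \<Rightarrow> complex" where
  "herm_form \<phi> xs ys = (\<Sum>p\<leftarrow>xs. \<Sum>q\<leftarrow>ys. fst p * cnj (fst q) * \<phi> (snd p - snd q))"

definition pos_def :: "('a::ab_group_add \<Rightarrow> complex) \<Rightarrow> bool" where
  "pos_def \<phi> \<longleftrightarrow> (\<forall>xs. herm_form \<phi> xs xs \<in> \<real>\<^sub>\<ge>\<^sub>0)"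

definition state :: "('a::ab_group_add \<Rightarrow> complex) \<Rightarrow> bool" where
  "state \<phi> \<longleftrightarrow> pos_def \<phi> \<and> \<phi> 0 = 1"

lemma herm_form_append_left: "herm_form \<phi> (xs @ xs') ys = herm_form \<phi> xs ys + herm_form \<phi> xs' ys"
  by (simp add: herm_form_def)

lemma herm_form_append_right: "herm_form \<phi> xs (ys @ ys') = herm_form \<phi> xs ys + herm_form \<phi> xs ys'"
  by (simp add: herm_form_def sum_list_addf)

lemma herm_form_add: "herm_form (\<lambda>z. \<phi> z + \<psi> z) xs ys = herm_form \<phi> xs ys + herm_form \<psi> xs ys"
  by (simp add: herm_form_def sum_list_addf distrib_left)

lemma herm_form_scale: "herm_form (\<lambda>z. a * \<phi> z) xs ys = a * herm_form \<phi> xs ys"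
  by (simp add: herm_form_def sum_list_const_mult[symmetric] mult.left_commute)

definition shift_pts :: "complex \<Rightarrow> 'a::ab_group_add \<Rightarrow> (complex \<times> 'a) list \<Rightarrow> (complex \<times> 'a) list" where
  "shift_pts c g xs = map (\<lambda>p. (c * fst p, snd p + g)) xs"

lemma herm_form_shift_left: "herm_form \<phi> (shift_pts c g xs) ys = herm_form (\<lambda>z. c * \<phi> (z + g)) xs ys"
  unfolding herm_form_def shift_pts_def by (simp add: o_def algebra_simps)

lemma herm_form_shift_right: "herm_form \<phi> xs (shift_pts c g ys) = herm_form (\<lambda>z. cnj c * \<phi> (z - g)) xs ys"
  unfolding herm_form_def shift_pts_def by (simp add: o_def algebra_simps)

lemma state_bounds:
  assumes "state \<phi>"
  shows state_minus: "\<phi> (- x) = cnj (\<phi> x)" and state_norm: "cmod (\<phi> x) \<le> 1"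
proof -
  have *: "1 + cnj w * \<phi> x + w * \<phi> (-x) + w * cnj w \<in> \<real>\<^sub>\<ge>\<^sub>0" for w
  proof -
    have "herm_form \<phi> [(1,x),(w,0)] [(1,x),(w,0)] \<in> \<real>\<^sub>\<ge>\<^sub>0"
      using assms by (simp add: state_def pos_def_def)
    then show ?thesis using assms by (simp add: herm_form_def state_def algebra_simps)
  qed
  have "Im (\<phi> x) + Im (\<phi> (-x)) = 0" "Re (\<phi> (-x)) = Re (\<phi> x)"
    using *[of 1] *[of \<i>] unfolding complex_nonneg_Reals_iff by simp_all
  then show m: "\<phi> (- x) = cnj (\<phi> x)" by (simp add: complex_eq_iff)
  show "cmod (\<phi> x) \<le> 1"
  proof (cases "\<phi> x = 0")
    case False
    define w where "w = - sgn (\<phi> x)"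
    have w: "cnj w * \<phi> x = - complex_of_real (cmod (\<phi> x))" "w * cnj w = 1"
    proof -
      have z: "\<phi> x * cnj (\<phi> x) = complex_of_real (cmod (\<phi> x)) * complex_of_real (cmod (\<phi> x))"
        by (metis complex_norm_square of_real_power power2_eq_square)
      show "cnj w * \<phi> x = - complex_of_real (cmod (\<phi> x))" "w * cnj w = 1"
        using False z by (auto simp: w_def sgn_eq field_simps)
    qed
    have w': "w * \<phi> (-x) = cnj (cnj w * \<phi> x)" by (simp add: m)
    have "Re (1 + cnj w * \<phi> x + w * \<phi> (-x) + w * cnj w) \<ge> 0"
      using *[of w] by (simp only: complex_nonneg_Reals_iff)
    then show ?thesis unfolding w' w by simp
  qed simp
qed

lemma continuous_on_eval [continuous_intros]: "continuous_on S (\<lambda>\<phi>. \<phi> x :: complex)"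
  by (rule continuous_on_subset[OF continuous_on_product_coordinates]) auto

lemma continuous_on_sum_list [continuous_intros]:
  fixes f :: "'b \<Rightarrow> 'c::topological_space \<Rightarrow> 'd::real_normed_vector"
  shows "(\<And>p. p \<in> set ps \<Longrightarrow> continuous_on S (f p)) \<Longrightarrow> continuous_on S (\<lambda>x. \<Sum>p\<leftarrow>ps. f p x)"
  by (induction ps) (auto intro!: continuous_intros)

lemma compact_unit_functions: "compact {\<phi> :: 'a \<Rightarrow> complex. \<forall>x. cmod (\<phi> x) \<le> 1}"
proof -
  have "compactin (product_topology (\<lambda>_::'a. euclidean) UNIV) (PiE UNIV (\<lambda>_. cball (0::complex) 1))"
    by (auto simp: compactin_PiE)
  moreover have "PiE UNIV (\<lambda>_::'a. cball (0::complex) 1) = {\<phi>. \<forall>x. cmod (\<phi> x) \<le> 1}"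
    by auto
  ultimately show ?thesis by (simp add: euclidean_product_topology)
qed

lemma closed_states: "closed {\<phi> :: 'a::ab_group_add \<Rightarrow> complex. state \<phi>}"
proof -
  have "closed {\<phi> :: 'a \<Rightarrow> complex. herm_form \<phi> xs xs \<in> \<real>\<^sub>\<ge>\<^sub>0}" for xs
  proof -
    have "continuous_on UNIV (\<lambda>\<phi>::'a\<Rightarrow>complex. herm_form \<phi> xs xs)"
      unfolding herm_form_def by (intro continuous_intros)
    from closed_vimage[OF closed_nonneg_Reals_complex this]
    show ?thesis by (simp add: vimage_def)
  qed
  moreover have "closed {\<phi> :: 'a \<Rightarrow> complex. \<phi> 0 = 1}"
    by (intro closed_Collect_eq continuous_intros)
  moreover have "{\<phi> :: 'a \<Rightarrow> complex. state \<phi>} =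
     (\<Inter>xs. {\<phi>. herm_form \<phi> xs xs \<in> \<real>\<^sub>\<ge>\<^sub>0}) \<inter> {\<phi>. \<phi> 0 = 1}"
    by (auto simp: state_def pos_def_def)
  ultimately show ?thesis by (auto intro!: closed_Inter)
qed

lemma compact_states: "compact {\<phi> :: 'a::ab_group_add \<Rightarrow> complex. state \<phi>}"
proof -
  have "{\<phi> :: 'a \<Rightarrow> complex. state \<phi>} = {\<phi>. \<forall>x. cmod (\<phi> x) \<le> 1} \<inter> {\<phi>. state \<phi>}"
    by (auto dest: state_norm)
  then show ?thesis using compact_Int_closed[OF compact_unit_functions closed_states] by metis
qed

lemma closed_characters: "closed {\<xi> :: 'a::ab_group_add \<Rightarrow> complex. character \<xi>}"
proof -
  have "{\<xi> :: 'a \<Rightarrow> complex. character \<xi>} =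
     (\<Inter>x. \<Inter>y. {\<xi>. \<xi> (x + y) = \<xi> x * \<xi> y}) \<inter> (\<Inter>x. {\<xi>. cmod (\<xi> x) = 1})"
    by (auto simp: character_def)
  moreover have "closed {\<xi> :: 'a \<Rightarrow> complex. \<xi> (x + y) = \<xi> x * \<xi> y}" for x y
    by (intro closed_Collect_eq continuous_intros)
  moreover have "closed {\<xi> :: 'a \<Rightarrow> complex. cmod (\<xi> x) = 1}" for x
    by (intro closed_Collect_eq continuous_intros)
  ultimately show ?thesis by (auto intro!: closed_Inter)
qed

lemma compact_characters: "compact {\<xi> :: 'a::ab_group_add \<Rightarrow> complex. character \<xi>}"
proof -
  have "{\<xi> :: 'a \<Rightarrow> complex. character \<xi>} = {\<phi>. \<forall>x. cmod (\<phi> x) \<le> 1} \<inter> {\<phi>. character \<phi>}"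
    by (auto simp: character_norm)
  then show ?thesis using compact_Int_closed[OF compact_unit_functions closed_characters] by metis
qed

lemma norm_convex_combination:
  fixes a b :: complex and t :: real
  shows "(cmod (t * a + (1 - t) * b))\<^sup>2 = t * (cmod a)\<^sup>2 + (1 - t) * (cmod b)\<^sup>2 - t * (1 - t) * (cmod (a - b))\<^sup>2"
  unfolding cmod_power2 by (simp add: algebra_simps power2_eq_square)

text \<open>
Points of the circle are extreme in the disc. Hence the states that agree with \<open>\<phi>\<close> wherever \<open>\<bar>\<phi>\<bar> = 1\<close>
form a face of the set of all states.
\<close>

lemma unit_circle_extreme:
  fixes a b :: complex and t :: real
  assumes "0 < t" "t < 1" "cmod a \<le> 1" "cmod b \<le> 1" "cmod (t * a + (1 - t) * b) = 1"
  shows "a = b"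
proof -
  have "t * (cmod a)\<^sup>2 \<le> t" "(1 - t) * (cmod b)\<^sup>2 \<le> 1 - t"
    using assms by (auto simp: mult_left_le power_le_one)
  with norm_convex_combination[of t a b] assms(5)
  have "t * (1 - t) * (cmod (a - b))\<^sup>2 \<le> 0" by simp
  moreover have "0 < t * (1 - t) * (cmod (a - b))\<^sup>2" if "a \<noteq> b"
    using assms that by (intro mult_pos_pos) auto
  ultimately show "a = b" by fastforce
qed

text \<open>
On a character \<open>\<xi>\<close> this is multiplication by \<open>1 + Re (c * \<xi> g) / 2\<close>, which lies between \<open>1/2\<close> and \<open>3/2\<close>
for \<open>\<bar>c\<bar> = 1\<close>. On a superposition of characters it changes the weights by these positive factors, and the
tilts by \<open>c\<close> and \<open>- c\<close> average to the original function.
\<close>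

definition tilt :: "complex \<Rightarrow> 'a::ab_group_add \<Rightarrow> ('a \<Rightarrow> complex) \<Rightarrow> 'a \<Rightarrow> complex" where
  "tilt c g \<phi> z = \<phi> z + (c * \<phi> (z + g) + cnj c * \<phi> (z - g)) / 4"

text \<open>
The form of the tilt is half the form of \<open>\<phi>\<close> plus a quarter of the form of \<open>\<phi>\<close> on the measure to which its
translate by \<open>g\<close>, multiplied by \<open>c\<close>, has been added.
\<close>

lemma pos_def_tilt:
  assumes "pos_def \<phi>" "cmod c = 1" shows "pos_def (tilt c g \<phi>)"
  unfolding pos_def_def
proof
  fix xs
  let ?s = "shift_pts c g xs"
  have cc: "c * (cnj c * z) = z" for z
    using complex_norm_square[of c] assms(2) by (simp add: mult.assoc[symmetric])
  have "herm_form (tilt c g \<phi>) xs xs = herm_form (\<lambda>z. (1/2) * \<phi> z + (1/4) *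
          ((\<phi> z + c * \<phi> (z + g)) + (cnj c * \<phi> (z - g) + c * (cnj c * \<phi> (z + g - g))))) xs xs"
    by (simp add: cc) (simp add: tilt_def[abs_def] field_simps)
  also have "\<dots> = (1/2) * herm_form \<phi> xs xs + (1/4) * herm_form \<phi> (xs @ ?s) (xs @ ?s)"
    unfolding herm_form_add herm_form_scale herm_form_append_left herm_form_append_right herm_form_shift_left herm_form_shift_right
    by (simp add: herm_form_scale algebra_simps)
  finally have e: "herm_form (tilt c g \<phi>) xs xs = (1/2) * herm_form \<phi> xs xs + (1/4) * herm_form \<phi> (xs @ ?s) (xs @ ?s)" .
  have "herm_form \<phi> xs xs \<in> \<real>\<^sub>\<ge>\<^sub>0" "herm_form \<phi> (xs @ ?s) (xs @ ?s) \<in> \<real>\<^sub>\<ge>\<^sub>0"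
    using assms(1) by (auto simp: pos_def_def)
  then show "herm_form (tilt c g \<phi>) xs xs \<in> \<real>\<^sub>\<ge>\<^sub>0"
    unfolding e by (auto simp: complex_nonneg_Reals_iff)
qed

lemma state_scale:
  assumes "pos_def \<phi>" "\<phi> 0 = complex_of_real r" "r > 0" shows "state (\<lambda>z. (1 / r) * \<phi> z)"
proof -
  have "herm_form (\<lambda>z. complex_of_real (1 / r) * \<phi> z) xs xs \<in> \<real>\<^sub>\<ge>\<^sub>0" for xs
    unfolding herm_form_scale using assms by (simp add: pos_def_def complex_nonneg_Reals_iff)
  then show ?thesis using assms by (simp add: state_def pos_def_def)
qed

definition eval_sum :: "(complex \<times> 'a) list \<Rightarrow> ('a \<Rightarrow> complex) \<Rightarrow> real" where
  "eval_sum zs \<phi> = Re (\<Sum>p\<leftarrow>zs. fst p * \<phi> (snd p))"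

lemma eval_sum_convex:
  "eval_sum zs (\<lambda>z. complex_of_real t * a z + complex_of_real s * b z) = t * eval_sum zs a + s * eval_sum zs b"
  by (induction zs) (auto simp: eval_sum_def algebra_simps)

lemma continuous_on_eval_sum [continuous_intros]: "continuous_on S (eval_sum zs)"
  unfolding eval_sum_def by (intro continuous_intros)

text \<open>
The state \<open>\<psi>\<close> is a proper convex combination of its normalised tilts by \<open>c\<close> and \<open>- c\<close>, and these lie in
the same face. Since \<open>F\<close> is strictly convex in the values on \<open>B\<close>, at a maximum both tilts agree with \<open>\<psi>\<close>
on \<open>B\<close>. For \<open>c = 1\<close> and \<open>c = \<i>\<close> this gives \<open>\<psi> (x + g) + \<psi> (x - g)\<close> and \<open>\<psi> (x + g) - \<psi> (x - g)\<close> as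
multiples of \<open>\<psi> x\<close>, and their sum is the claim.
\<close>

lemma maximizer_multiplicative:
  fixes \<phi> \<psi> :: "'a::ab_group_add \<Rightarrow> complex" and zs \<epsilon> B
  defines "F \<equiv> \<lambda>\<psi>. eval_sum zs \<psi> + \<epsilon> * (\<Sum>x\<in>B. (cmod (\<psi> x))\<^sup>2)"
  assumes B: "finite B" "\<epsilon> > 0"
    and \<psi>: "state \<psi>" "\<And>x. cmod (\<phi> x) = 1 \<Longrightarrow> \<psi> x = \<phi> x"
    and max: "\<And>\<theta>. state \<theta> \<Longrightarrow> (\<And>x. cmod (\<phi> x) = 1 \<Longrightarrow> \<theta> x = \<phi> x) \<Longrightarrow> F \<theta> \<le> F \<psi>"
    and x: "x \<in> B"
  shows "\<psi> (x + g) = \<psi> x * \<psi> g"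
proof -
  have main: "c * \<psi> (x + g) + cnj c * \<psi> (x - g) = 2 * Re (c * \<psi> g) * \<psi> x" if c: "cmod c = 1" for c
  proof -
    \<comment> \<open>The tilts by \<open>c\<close> and \<open>- c\<close> take the values \<open>1 + r\<close> and \<open>1 - r\<close> at 0, both of which are positive.\<close>
    define r where "r = Re (c * \<psi> g) / 2"
    have "cmod (c * \<psi> g) \<le> 1" using state_norm[OF \<psi>(1)] c by (simp add: norm_mult)
    then have "\<bar>Re (c * \<psi> g)\<bar> \<le> 1" using abs_Re_le_cmod order_trans by blast
    then have r: "-1 < r" "r < 1" unfolding r_def by (auto simp: abs_le_iff)
    have pd: "pos_def (tilt c g \<psi>)" "pos_def (tilt (-c) g \<psi>)"
      using \<psi>(1) c by (auto simp: state_def intro!: pos_def_tilt)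
    have ps: "\<psi> (0 - g) = cnj (\<psi> g)" "\<psi> 0 = 1"
      using state_minus[OF \<psi>(1)] \<psi>(1) by (auto simp: state_def)
    have v0: "tilt c g \<psi> 0 = complex_of_real (1 + r)" "tilt (-c) g \<psi> 0 = complex_of_real (1 - r)"
      unfolding tilt_def r_def ps by (simp_all add: ps complex_eq_iff field_simps)
    define a where "a = (\<lambda>z. complex_of_real (1 / (1 + r)) * tilt c g \<psi> z)"
    define b where "b = (\<lambda>z. complex_of_real (1 / (1 - r)) * tilt (-c) g \<psi> z)"
    have ab: "state a" "state b" unfolding a_def b_def
      using state_scale[OF pd(1) v0(1)] state_scale[OF pd(2) v0(2)] r by auto
    define t where "t = (1 + r) / 2"
    have t: "0 < t" "t < 1" "1 - t = (1 - r) / 2" using r by (auto simp: t_def field_simps)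
    have ta: "complex_of_real t * a z = tilt c g \<psi> z / 2" for z
    proof -
      have "t * (1 / (1 + r)) = 1 / 2" unfolding t_def using r by (simp add: field_simps)
      then have "complex_of_real t * complex_of_real (1 / (1 + r)) = 1 / 2"
        unfolding of_real_mult[symmetric] by (simp only:) simp
      then show ?thesis unfolding a_def mult.assoc[symmetric] by (simp only:) simp
    qed
    have tb: "complex_of_real (1 - t) * b z = tilt (-c) g \<psi> z / 2" for z
    proof -
      have "(1 - t) * (1 / (1 - r)) = 1 / 2" unfolding t(3) using r by (simp add: field_simps)
      then have "complex_of_real (1 - t) * complex_of_real (1 / (1 - r)) = 1 / 2"
        unfolding of_real_mult[symmetric] by (simp only:) simp
      then show ?thesis unfolding b_def mult.assoc[symmetric] by (simp only:) simp
    qed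
    have comb: "\<psi> z = complex_of_real t * a z + complex_of_real (1 - t) * b z" for z
      unfolding ta tb by (simp add: tilt_def field_simps)
    have face: "a y = \<phi> y" "b y = \<phi> y" if "cmod (\<phi> y) = 1" for y
    proof -
      have "cmod (complex_of_real t * a y + complex_of_real (1 - t) * b y) = 1"
        unfolding comb[symmetric] using \<psi>(2)[OF that] that by simp
      then have "a y = b y" by (rule unit_circle_extreme[OF t(1,2) state_norm[OF ab(1)] state_norm[OF ab(2)]])
      then have "\<psi> y = a y" using comb[of y] by (simp add: algebra_simps)
      then show "a y = \<phi> y" "b y = \<phi> y" using \<psi>(2)[OF that] \<open>a y = b y\<close> by auto
    qed
    have Fab: "F a \<le> F \<psi>" "F b \<le> F \<psi>" using max ab face by auto
    have l: "eval_sum zs \<psi> = t * eval_sum zs a + (1 - t) * eval_sum zs b"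
      using eval_sum_convex[of zs t a "1-t" b] unfolding comb[symmetric] .
    have s: "(\<Sum>x\<in>B. (cmod (\<psi> x))\<^sup>2) = t * (\<Sum>x\<in>B. (cmod (a x))\<^sup>2) + (1 - t) * (\<Sum>x\<in>B. (cmod (b x))\<^sup>2)
        - t * (1 - t) * (\<Sum>x\<in>B. (cmod (a x - b x))\<^sup>2)"
      unfolding comb norm_convex_combination sum.distrib sum_subtractf sum_distrib_left by simp
    have "F \<psi> = t * F a + (1 - t) * F b - \<epsilon> * t * (1 - t) * (\<Sum>x\<in>B. (cmod (a x - b x))\<^sup>2)"
      unfolding F_def l s by (simp add: algebra_simps)
    moreover have "t * F a + (1 - t) * F b \<le> t * F \<psi> + (1 - t) * F \<psi>"
      using Fab t by (intro add_mono mult_left_mono) auto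
    ultimately have "\<epsilon> * t * (1 - t) * (\<Sum>x\<in>B. (cmod (a x - b x))\<^sup>2) \<le> 0" by (simp add: algebra_simps)
    moreover have "\<epsilon> * t * (1 - t) > 0" using t B by simp
    ultimately have "(\<Sum>x\<in>B. (cmod (a x - b x))\<^sup>2) \<le> 0"
      using mult_pos_pos[of "\<epsilon> * t * (1 - t)"] by (meson not_le)
    then have "(\<Sum>x\<in>B. (cmod (a x - b x))\<^sup>2) = 0" by (meson antisym sum_nonneg zero_le_power2)
    then have "a x = b x" using x B(1) by (simp add: sum_nonneg_eq_0_iff)
    then have "\<psi> x = a x" using comb[of x] by (simp add: algebra_simps)
    then have "complex_of_real (1 + r) * \<psi> x = complex_of_real ((1 + r) * (1 / (1 + r))) * tilt c g \<psi> x"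
      unfolding a_def of_real_mult by (simp only: mult.assoc)
    moreover have "(1 + r) * (1 / (1 + r)) = 1" using r by simp
    ultimately have "complex_of_real (1 + r) * \<psi> x = tilt c g \<psi> x"
      by (simp only: of_real_1 mult_1_left)
    then have "complex_of_real r * \<psi> x = (c * \<psi> (x + g) + cnj c * \<psi> (x - g)) / 4"
      unfolding tilt_def by (simp add: distrib_right)
    then have "c * \<psi> (x + g) + cnj c * \<psi> (x - g) = complex_of_real (4 * r) * \<psi> x"
      by (simp add: mult_ac)
    moreover have "4 * r = 2 * Re (c * \<psi> g)" by (simp add: r_def)
    ultimately show ?thesis by (simp only:)
  qed
  have plus: "\<psi> (x + g) + \<psi> (x - g) = 2 * Re (\<psi> g) * \<psi> x" using main[of 1] by simp
  have h: "\<i> * \<psi> (x + g) + cnj \<i> * \<psi> (x - g) = complex_of_real (2 * Re (\<i> * \<psi> g)) * \<psi> x"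
    by (rule main) simp
  have "\<psi> (x + g) - \<psi> (x - g) = - \<i> * (\<i> * \<psi> (x + g) + cnj \<i> * \<psi> (x - g))"
    by (simp add: complex_eq_iff)
  also have "\<dots> = 2 * (\<i> * Im (\<psi> g)) * \<psi> x"
    unfolding h by (simp add: complex_eq_iff)
  finally have minus: "\<psi> (x + g) - \<psi> (x - g) = 2 * (\<i> * Im (\<psi> g)) * \<psi> x" .
  have "2 * \<psi> (x + g) = (\<psi> (x + g) + \<psi> (x - g)) + (\<psi> (x + g) - \<psi> (x - g))" by simp
  also have "\<dots> = 2 * ((complex_of_real (Re (\<psi> g)) + \<i> * Im (\<psi> g)) * \<psi> x)"
    unfolding plus minus by (simp add: distrib_left distrib_right)
  also have "complex_of_real (Re (\<psi> g)) + \<i> * Im (\<psi> g) = \<psi> g" by (rule complex_eq[symmetric])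
  finally show ?thesis by (simp add: mult.commute)
qed

text \<open>
A finite form of the Krein-Milman theorem. The functional is perturbed by a small multiple of a strictly
convex function of the values on a finite set \<open>B\<close>; maximisers are then multiplicative on \<open>B\<close>, and by
compactness \<open>B\<close> can exhaust the group while the perturbation vanishes. Control of \<open>\<xi>\<close> where \<open>\<bar>\<phi>\<bar> = 1\<close>
makes the theorem an extension theorem for characters of subgroups as well.
\<close>

theorem state_dominated_by_character:
  fixes \<phi> :: "'a::ab_group_add \<Rightarrow> complex"
  assumes "state \<phi>"
  obtains \<xi> where "character \<xi>" "\<And>x. cmod (\<phi> x) = 1 \<Longrightarrow> \<xi> x = \<phi> x" "eval_sum zs \<phi> \<le> eval_sum zs \<xi>"
proof -
  define P where "P = {\<psi>. state \<psi> \<and> (\<forall>x. cmod (\<phi> x) = 1 \<longrightarrow> \<psi> x = \<phi> x)}"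
  have "P = {\<psi>. state \<psi>} \<inter> (\<Inter>x\<in>{x. cmod (\<phi> x) = 1}. {\<psi>. \<psi> x = \<phi> x})" by (auto simp: P_def)
  moreover have "closed (\<Inter>x\<in>{x. cmod (\<phi> x) = 1}. {\<psi>. \<psi> x = \<phi> x})"
    by (intro closed_INT ballI closed_Collect_eq continuous_intros)
  ultimately have cP: "compact P" by (simp only: compact_Int_closed[OF compact_states])
  define K where "K = (\<lambda>(B,\<epsilon>). {\<psi>. (\<forall>x\<in>B. \<forall>g. \<psi> (x + g) = \<psi> x * \<psi> g) \<and> eval_sum zs \<phi> - \<epsilon> \<le> eval_sum zs \<psi>})"
  define I where "I = {(B :: 'a set, \<epsilon> :: real). finite B \<and> \<epsilon> > 0}"
  have "P \<inter> (\<Inter>i\<in>I. K i) \<noteq> {}"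
  proof (rule compact_imp_fip_image[OF cP])
    fix i :: "'a set \<times> real"
    obtain B \<epsilon> where i: "i = (B, \<epsilon>)" by (cases i)
    have "K i = (\<Inter>x\<in>B. \<Inter>g. {\<psi>. \<psi> (x + g) = \<psi> x * \<psi> g}) \<inter> {\<psi>. eval_sum zs \<phi> - \<epsilon> \<le> eval_sum zs \<psi>}"
      by (auto simp: K_def i)
    then show "closed (K i)"
      by (auto intro!: closed_Int closed_INT closed_Collect_eq closed_Collect_le continuous_intros)
  next
    fix J assume J: "finite J" "J \<subseteq> I"
    define B where "B = (\<Union>j\<in>J. fst j)"
    define \<delta> where "\<delta> = Min (insert 1 (snd ` J))"
    have fB: "finite B" using J by (force simp: B_def I_def)
    have d: "\<delta> > 0" using J by (force simp: \<delta>_def I_def)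
    define \<epsilon> where "\<epsilon> = \<delta> / (1 + real (card B))"
    have e: "\<epsilon> > 0" "\<epsilon> * real (card B) \<le> \<delta>" using d by (auto simp: \<epsilon>_def field_simps)
    define F where "F = (\<lambda>\<psi>. eval_sum zs \<psi> + \<epsilon> * (\<Sum>x\<in>B. (cmod (\<psi> x))\<^sup>2))"
    have cF: "continuous_on P F"
      unfolding F_def by (intro continuous_intros)
    have \<phi>P: "\<phi> \<in> P" by (auto simp: P_def assms)
    then obtain \<psi> where \<psi>: "\<psi> \<in> P" and max: "\<And>\<theta>. \<theta> \<in> P \<Longrightarrow> F \<theta> \<le> F \<psi>"
      using continuous_attains_sup[OF cP _ cF] by auto
    have mult: "\<psi> (x + g) = \<psi> x * \<psi> g" if "x \<in> B" for x g
      by (rule maximizer_multiplicative[OF fB e(1), where zs = zs and \<phi> = \<phi>])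
         (use \<psi> max that in \<open>auto simp: P_def F_def\<close>)
    have "eval_sum zs \<phi> \<le> F \<phi>" unfolding F_def using e by (simp add: sum_nonneg)
    also have "\<dots> \<le> F \<psi>" using max \<phi>P by simp
    also have "\<dots> \<le> eval_sum zs \<psi> + \<epsilon> * (\<Sum>x\<in>B. 1)"
      unfolding F_def using e \<psi> state_norm[of \<psi>]
      by (intro add_left_mono mult_left_mono sum_mono) (auto simp: P_def power_le_one)
    also have "\<dots> \<le> eval_sum zs \<psi> + \<delta>" using e by simp
    finally have l: "eval_sum zs \<phi> - \<delta> \<le> eval_sum zs \<psi>" by simp
    have "\<psi> \<in> K j" if "j \<in> J" for j
    proof -
      have "\<delta> \<le> snd j" using J that by (auto simp: \<delta>_def)
      then show ?thesis using l mult that by (fastforce simp: K_def B_def split: prod.splits)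
    qed
    then show "P \<inter> (\<Inter>j\<in>J. K j) \<noteq> {}" using \<psi> by auto
  qed
  then obtain \<xi> where \<xi>: "\<xi> \<in> P" "\<And>B \<epsilon>. finite B \<Longrightarrow> \<epsilon> > 0 \<Longrightarrow> \<xi> \<in> K (B, \<epsilon>)" by (auto simp: I_def)
  have mult: "\<xi> (x + g) = \<xi> x * \<xi> g" for x g using \<xi>(2)[of "{x}" 1] by (auto simp: K_def)
  have st: "state \<xi>" using \<xi>(1) by (auto simp: P_def)
  have "cmod (\<xi> x) = 1" for x
  proof -
    have "\<xi> x * \<xi> (-x) = 1" using mult[of x "-x"] st by (simp add: state_def)
    then have "cmod (\<xi> x) * cmod (\<xi> (-x)) = 1" by (metis norm_mult norm_one)
    then show ?thesis using state_norm[OF st, of x] state_norm[OF st, of "-x"]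
      by (smt (verit) mult_left_le norm_ge_zero)
  qed
  then have "character \<xi>" by (auto simp: character_def mult)
  moreover have "eval_sum zs \<phi> \<le> eval_sum zs \<xi>"
    by (rule field_le_epsilon) (use \<xi>(2)[of "{}"] in \<open>auto simp: K_def algebra_simps\<close>)
  ultimately show ?thesis using that \<xi>(1) by (auto simp: P_def)
qed

section \<open>Means of Lipschitz functions\<close>

definition avg :: "'a::ab_group_add list \<Rightarrow> ('a \<Rightarrow> real) \<Rightarrow> 'a \<Rightarrow> real" where
  "avg xs f y = (\<Sum>x\<leftarrow>xs. f (y + x)) / real (length xs)"

text \<open>
The list of all sums, so that averaging over it is the composition of the two averages.
\<close>

definition add_lists :: "'a::ab_group_add list \<Rightarrow> 'a list \<Rightarrow> 'a list" where
  "add_lists xs ys = concat (map (\<lambda>x. map (\<lambda>y. x + y) ys) xs)"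

lemma sum_list_add_lists: "(\<Sum>z\<leftarrow>add_lists xs ys. h z) = (\<Sum>x\<leftarrow>xs. \<Sum>y\<leftarrow>ys. h (x + y))"
  by (induction xs) (simp_all add: add_lists_def o_def)

lemma length_add_lists: "length (add_lists xs ys) = length xs * length ys"
  by (induction xs) (simp_all add: add_lists_def)

lemma add_lists_eq_Nil_iff: "add_lists xs ys = [] \<longleftrightarrow> xs = [] \<or> ys = []"
  using length_add_lists[of xs ys] by (metis length_0_conv mult_is_0)

lemma avg_add_lists: "avg (add_lists xs ys) f = avg xs (avg ys f)"
  by (rule ext) (simp add: avg_def sum_list_add_lists length_add_lists sum_list_divide add.assoc mult.commute)

lemma avg_commute: "avg xs (avg ys f) = avg ys (avg xs f)"
proof -
  have "avg (add_lists xs ys) f = avg (add_lists ys xs) f"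
    by (rule ext, simp add: avg_def sum_list_add_lists length_add_lists, subst sum_list_swap)
       (simp add: add.commute mult.commute)
  then show ?thesis by (simp add: avg_add_lists)
qed

lemma avg_le: "xs \<noteq> [] \<Longrightarrow> (\<And>y. f y \<le> c) \<Longrightarrow> avg xs f y \<le> c"
  using sum_list_mono[of xs "\<lambda>x. f (y + x)" "\<lambda>_. c"]
  by (simp add: avg_def sum_list_triv divide_le_eq mult.commute)

lemma avg_add: "avg xs (\<lambda>y. f y + g y) y = avg xs f y + avg xs g y"
  by (simp add: avg_def sum_list_addf add_divide_distrib)

lemma avg_scale: "avg xs (\<lambda>y. c * f y) y = c * avg xs f y"
  by (simp add: avg_def sum_list_const_mult)

lemma avg_const: "xs \<noteq> [] \<Longrightarrow> avg xs (\<lambda>y. c) y = c"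
  by (simp add: avg_def sum_list_triv)

lemma avg_close:
  assumes "xs \<noteq> []" "\<And>y. \<bar>f y - c\<bar> \<le> e" shows "\<bar>avg xs f y - c\<bar> \<le> e"
proof -
  have "f y \<le> c + e" "(-1) * f y \<le> e - c" for y using assms(2)[of y] by (auto simp: abs_le_iff)
  then have "avg xs f y \<le> c + e" "avg xs (\<lambda>y. (-1) * f y) y \<le> e - c" using avg_le[OF assms(1)] by metis+
  then show ?thesis unfolding avg_scale by auto
qed

text \<open>
Von Neumann's description of the mean of an almost periodic function: the constant that is uniformly
approximated by averages of translates.
\<close>

definition has_mean :: "('a::ab_group_add \<Rightarrow> real) \<Rightarrow> real \<Rightarrow> bool" where
  "has_mean f c \<longleftrightarrow> (\<forall>e>0. \<exists>xs. xs \<noteq> [] \<and> (\<forall>y. \<bar>avg xs f y - c\<bar> \<le> e))"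

text \<open>
Averages commute and do not increase the distance from a constant, so averaging over all sums works for both
functions.
\<close>

lemma has_mean_common:
  assumes "has_mean f c" "has_mean g d" "e > 0"
  obtains xs where "xs \<noteq> []" "\<And>y. \<bar>avg xs f y - c\<bar> \<le> e" "\<And>y. \<bar>avg xs g y - d\<bar> \<le> e"
proof -
  obtain xs ys where xs: "xs \<noteq> []" "\<And>y. \<bar>avg xs f y - c\<bar> \<le> e"
    and ys: "ys \<noteq> []" "\<And>y. \<bar>avg ys g y - d\<bar> \<le> e"
    using assms unfolding has_mean_def by metis
  show ?thesis
  proof (rule that[of "add_lists xs ys"])
    show "add_lists xs ys \<noteq> []" using xs ys by (simp add: add_lists_eq_Nil_iff)
    show "\<bar>avg (add_lists xs ys) f y - c\<bar> \<le> e" for y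
      unfolding avg_add_lists avg_commute[of xs] by (rule avg_close[OF ys(1) xs(2)])
    show "\<bar>avg (add_lists xs ys) g y - d\<bar> \<le> e" for y
      unfolding avg_add_lists by (rule avg_close[OF xs(1) ys(2)])
  qed
qed

lemma has_mean_mono:
  assumes "has_mean f c" "has_mean g d" "\<And>y. f y \<le> g y" shows "c \<le> d"
proof (rule field_le_epsilon)
  fix e :: real assume "e > 0"
  then obtain xs where xs: "xs \<noteq> []" "\<And>y. \<bar>avg xs f y - c\<bar> \<le> e/2" "\<And>y. \<bar>avg xs g y - d\<bar> \<le> e/2"
    using has_mean_common[OF assms(1,2), of "e/2"] by auto
  have "avg xs f 0 \<le> avg xs g 0"
    using assms(3) by (auto simp: avg_def intro!: divide_right_mono sum_list_mono)
  then show "c \<le> d + e" using xs(2)[of 0] xs(3)[of 0] by linarith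
qed

lemma has_mean_unique: "has_mean f c \<Longrightarrow> has_mean f d \<Longrightarrow> c = d"
  by (meson antisym has_mean_mono order_refl)

lemma has_mean_add:
  assumes "has_mean f c" "has_mean g d" shows "has_mean (\<lambda>y. f y + g y) (c + d)"
  unfolding has_mean_def
proof safe
  fix e :: real assume "e > 0"
  then obtain xs where xs: "xs \<noteq> []" "\<And>y. \<bar>avg xs f y - c\<bar> \<le> e/2" "\<And>y. \<bar>avg xs g y - d\<bar> \<le> e/2"
    using has_mean_common[OF assms, of "e/2"] by auto
  have "\<bar>avg xs (\<lambda>y. f y + g y) y - (c + d)\<bar> \<le> e" for y
    using xs(2,3)[of y] unfolding avg_add by linarith
  with xs(1) show "\<exists>xs. xs \<noteq> [] \<and> (\<forall>y. \<bar>avg xs (\<lambda>y. f y + g y) y - (c + d)\<bar> \<le> e)" by blast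
qed

lemma has_mean_scale:
  assumes "has_mean f c" shows "has_mean (\<lambda>y. a * f y) (a * c)"
  unfolding has_mean_def
proof safe
  fix e :: real assume e: "e > 0"
  define e' where "e' = e / (\<bar>a\<bar> + 1)"
  have e': "e' > 0" "\<bar>a\<bar> * e' \<le> e" using e by (auto simp: e'_def field_simps)
  then obtain xs where xs: "xs \<noteq> []" "\<And>y. \<bar>avg xs f y - c\<bar> \<le> e'"
    using assms unfolding has_mean_def by metis
  have "\<bar>avg xs (\<lambda>y. a * f y) y - a * c\<bar> \<le> e" for y
  proof -
    have "\<bar>a * (avg xs f y - c)\<bar> \<le> \<bar>a\<bar> * e'" unfolding abs_mult using xs(2) by (intro mult_left_mono) auto
    then show ?thesis using e'(2) unfolding avg_scale by (simp add: right_diff_distrib)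
  qed
  with xs(1) show "\<exists>xs. xs \<noteq> [] \<and> (\<forall>y. \<bar>avg xs (\<lambda>y. a * f y) y - a * c\<bar> \<le> e)" by blast
qed

lemma has_mean_const: "has_mean (\<lambda>y. c) c"
  unfolding has_mean_def
proof safe
  fix e :: real assume "e > 0"
  then show "\<exists>xs. xs \<noteq> [] \<and> (\<forall>y. \<bar>avg xs (\<lambda>y. c) y - c\<bar> \<le> e)"
    by (intro exI[of _ "[0]"]) (simp add: avg_const)
qed

lemma has_mean_shift:
  assumes "has_mean f c" shows "has_mean (\<lambda>y. f (y + v)) c"
proof -
  have "avg xs (\<lambda>y. f (y + v)) y = avg xs f (y + v)" for xs y
    by (simp add: avg_def add_ac)
  then show ?thesis using assms unfolding has_mean_def by metis
qed

definition mean :: "('a::ab_group_add \<Rightarrow> real) \<Rightarrow> real" where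
  "mean f = (THE c. has_mean f c)"

lemma mean_eqI: "has_mean f c \<Longrightarrow> mean f = c"
  unfolding mean_def using has_mean_unique by blast

text \<open>
The topology-free shape of precompactness: \<open>(x, y) \<mapsto> p (x - y)\<close> is a totally bounded invariant
pseudometric, and its Lipschitz functions take the place of uniformly continuous ones.
\<close>

locale totally_bounded_seminorm =
  fixes p :: "'a::ab_group_add \<Rightarrow> real"
  assumes p_0: "p 0 = 0"
    and p_minus: "p (- x) = p x"
    and p_triangle: "p (x + y) \<le> p x + p y"
    and p_totally_bounded: "0 < e \<Longrightarrow> \<exists>F. finite F \<and> (\<forall>x. \<exists>y\<in>F. p (x - y) < e)"
begin

lemma p_nonneg: "0 \<le> p x"
  using p_triangle[of x "-x"] by (simp add: p_minus p_0)

lemma p_bounded: "\<exists>K. \<forall>x. p x \<le> K"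
proof -
  obtain F where F: "finite F" "\<And>x. \<exists>y\<in>F. p (x - y) < 1" using p_totally_bounded[of 1] by auto
  have "p x \<le> 1 + sum p F" for x
  proof -
    obtain y where y: "y \<in> F" "p (x - y) < 1" using F(2) by auto
    have "p x \<le> p (x - y) + p y" using p_triangle[of "x - y" y] by simp
    moreover have "p y \<le> sum p F" using F(1) y(1) p_nonneg by (simp add: member_le_sum)
    ultimately show ?thesis using y(2) by simp
  qed
  then show ?thesis by blast
qed

definition lip :: "real \<Rightarrow> ('a \<Rightarrow> real) \<Rightarrow> bool" where
  "lip C f \<longleftrightarrow> 0 \<le> C \<and> (\<forall>x v. \<bar>f (x + v) - f x\<bar> \<le> C * p v)"

definition lipschitz :: "('a \<Rightarrow> real) \<Rightarrow> bool" where
  "lipschitz f \<longleftrightarrow> (\<exists>C. lip C f)"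

lemma lipschitzI: "(\<And>x v. \<bar>f (x + v) - f x\<bar> \<le> C * p v) \<Longrightarrow> 0 \<le> C \<Longrightarrow> lipschitz f"
  by (auto simp: lipschitz_def lip_def)

lemma lipschitzE:
  assumes "lipschitz f"
  obtains C where "0 \<le> C" "\<And>x v. \<bar>f (x + v) - f x\<bar> \<le> C * p v"
  using assms by (auto simp: lipschitz_def lip_def)

lemma lipschitz_bounded:
  assumes "lipschitz f" obtains K where "0 \<le> K" "\<And>x. \<bar>f x\<bar> \<le> K"
proof -
  obtain C where C: "0 \<le> C" "\<And>x v. \<bar>f (x + v) - f x\<bar> \<le> C * p v" using lipschitzE[OF assms] by blast
  obtain K where K: "\<And>x. p x \<le> K" using p_bounded by auto
  have "\<bar>f x\<bar> \<le> \<bar>f 0\<bar> + C * K" for x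
    using C(2)[of 0 x] mult_left_mono[OF K[of x] C(1)] by auto
  moreover have "0 \<le> K" using K[of 0] p_0 by simp
  ultimately show ?thesis using that[of "\<bar>f 0\<bar> + C * K"] C(1) by auto
qed

named_theorems lip_intros

lemma lipschitz_const [lip_intros]: "lipschitz (\<lambda>x. c)"
  by (rule lipschitzI[of _ 0]) auto

lemma lipschitz_add [lip_intros]:
  assumes "lipschitz f" "lipschitz g" shows "lipschitz (\<lambda>x. f x + g x)"
proof -
  obtain C D where C: "0 \<le> C" "\<And>x v. \<bar>f (x + v) - f x\<bar> \<le> C * p v"
    and D: "0 \<le> D" "\<And>x v. \<bar>g (x + v) - g x\<bar> \<le> D * p v" using lipschitzE assms by metis
  show ?thesis
  proof (rule lipschitzI)
    show "\<bar>f (x + v) + g (x + v) - (f x + g x)\<bar> \<le> (C + D) * p v" for x v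
      using C(2)[of x v] D(2)[of x v] by (simp add: distrib_right)
  qed (use C D in auto)
qed

lemma lipschitz_mult [lip_intros]:
  assumes "lipschitz f" "lipschitz g" shows "lipschitz (\<lambda>x. f x * g x)"
proof -
  obtain C D where C: "0 \<le> C" "\<And>x v. \<bar>f (x + v) - f x\<bar> \<le> C * p v"
    and D: "0 \<le> D" "\<And>x v. \<bar>g (x + v) - g x\<bar> \<le> D * p v" using lipschitzE assms by metis
  obtain K L where K: "0 \<le> K" "\<And>x. \<bar>f x\<bar> \<le> K" and L: "0 \<le> L" "\<And>x. \<bar>g x\<bar> \<le> L"
    using lipschitz_bounded assms by metis
  show ?thesis
  proof (rule lipschitzI)
    fix x v
    have "f (x + v) * g (x + v) - f x * g x = f (x + v) * (g (x + v) - g x) + g x * (f (x + v) - f x)"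
      by (simp add: algebra_simps)
    also have "\<bar>\<dots>\<bar> \<le> \<bar>f (x + v)\<bar> * \<bar>g (x + v) - g x\<bar> + \<bar>g x\<bar> * \<bar>f (x + v) - f x\<bar>"
      using abs_triangle_ineq by (metis abs_mult)
    also have "\<dots> \<le> K * (D * p v) + L * (C * p v)"
      by (intro add_mono mult_mono C D K L) (use C D K L p_nonneg in auto)
    finally show "\<bar>f (x + v) * g (x + v) - f x * g x\<bar> \<le> (K * D + L * C) * p v"
      by (simp add: algebra_simps)
  qed (use C D K L in auto)
qed

lemma lipschitz_diff [lip_intros]:
  "lipschitz f \<Longrightarrow> lipschitz g \<Longrightarrow> lipschitz (\<lambda>x. f x - g x)"
  using lipschitz_add[of f "\<lambda>x. (-1) * g x"] lipschitz_mult[OF lipschitz_const[of "-1"], of g] by simp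

lemma lipschitz_power2 [lip_intros]: "lipschitz f \<Longrightarrow> lipschitz (\<lambda>x. (f x)\<^sup>2)"
  unfolding power2_eq_square by (rule lipschitz_mult)

lemma lipschitz_shift: "lipschitz f \<Longrightarrow> lipschitz (\<lambda>x. f (x + z))"
  unfolding lipschitz_def lip_def by (metis add.assoc add.commute)

lemma lipschitz_sum_list [lip_intros]:
  "(\<And>p. p \<in> set ps \<Longrightarrow> lipschitz (f p)) \<Longrightarrow> lipschitz (\<lambda>x. \<Sum>p\<leftarrow>ps. f p x)"
  by (induction ps) (auto intro!: lip_intros)

lemma lip_avg:
  assumes "lip C f" "xs \<noteq> []" shows "lip C (avg xs f)"
  unfolding lip_def
proof safe
  fix y v
  have "avg xs f (y + v) - avg xs f y = avg xs (\<lambda>z. f (z + v) - f z) y"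
    using avg_add[of xs "\<lambda>z. f (z + v)" "\<lambda>z. (-1) * f z" y] avg_scale[of xs "-1" f y]
    by (simp add: avg_def add_ac)
  moreover have "\<bar>avg xs (\<lambda>z. f (z + v) - f z) y - 0\<bar> \<le> C * p v"
    by (rule avg_close[OF assms(2)]) (use assms(1) in \<open>auto simp: lip_def\<close>)
  ultimately show "\<bar>avg xs f (y + v) - avg xs f y\<bar> \<le> C * p v" by simp
qed (use assms in \<open>auto simp: lip_def\<close>)

text \<open>
For a suitable \<open>x1 \<in> F\<close> the point \<open>y + x1\<close> is \<open>\<delta>\<close>-close to \<open>y' + x0\<close>. So one pair of summands of the two averages
differs by at most \<open>e\<close>, and each of the other pairs by at most \<open>d\<close>.
\<close>

lemma avg_reduces_oscillation:
  assumes f: "lip C f" and d: "\<And>y y'. f y - f y' \<le> d"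
    and F: "finite F" "\<And>x. \<exists>y\<in>F. p (x - y) < \<delta>" and xs: "set xs = F" "distinct xs" and e: "C * \<delta> \<le> e"
  shows "avg xs f y - avg xs f y' \<le> (1 - 1 / real (card F)) * d + e / real (card F)"
proof -
  have Fne: "F \<noteq> {}" using F(2) by auto
  then have k: "card F > 0" using F(1) by (simp add: card_gt_0_iff)
  obtain x0 where x0: "x0 \<in> F" using Fne by auto
  obtain x1 where x1: "x1 \<in> F" "p (y' + x0 - y - x1) < \<delta>" using F(2)[of "y' + x0 - y"] by auto
  have C: "0 \<le> C" using f by (simp add: lip_def)
  have near: "f (y + x1) - f (y' + x0) \<le> e"
  proof -
    have "\<bar>f (y + x1 + (y' + x0 - y - x1)) - f (y + x1)\<bar> \<le> C * p (y' + x0 - y - x1)"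
      using f unfolding lip_def by blast
    moreover have "y + x1 + (y' + x0 - y - x1) = y' + x0" by (simp add: algebra_simps)
    moreover have "C * p (y' + x0 - y - x1) \<le> C * \<delta>" using x1(2) C by (intro mult_left_mono) auto
    ultimately show ?thesis using e by (simp only:)
  qed
  have "card (F - {x1}) = card (F - {x0})" using x0 x1 by simp
  then obtain h where h: "bij_betw h (F - {x1}) (F - {x0})"
    using finite_same_card_bij F(1) by (metis finite_Diff)
  have av: "avg xs f z = (\<Sum>x\<in>F. f (z + x)) / real (card F)" for z
    using xs by (simp add: avg_def sum_list_distinct_conv_sum_set distinct_card[symmetric])
  have "(\<Sum>x\<in>F. f (y + x)) - (\<Sum>x\<in>F. f (y' + x))
      = (f (y + x1) - f (y' + x0)) + ((\<Sum>x\<in>F-{x1}. f (y + x)) - (\<Sum>x\<in>F-{x0}. f (y' + x)))"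
    using sum.remove[OF F(1) x1(1), of "\<lambda>x. f (y + x)"] sum.remove[OF F(1) x0, of "\<lambda>x. f (y' + x)"]
    by simp
  also have "(\<Sum>x\<in>F-{x0}. f (y' + x)) = (\<Sum>x\<in>F-{x1}. f (y' + h x))"
    using sum.reindex_bij_betw[OF h, of "\<lambda>x. f (y' + x)"] by simp
  also have "(f (y + x1) - f (y' + x0)) + ((\<Sum>x\<in>F-{x1}. f (y + x)) - (\<Sum>x\<in>F-{x1}. f (y' + h x)))
      \<le> e + (\<Sum>x\<in>F-{x1}. d)"
    unfolding sum_subtractf[symmetric] by (intro add_mono near sum_mono d)
  also have "\<dots> = e + (real (card F) - 1) * d" using x1 F(1) k by simp
  finally have "avg xs f y - avg xs f y' \<le> (e + (real (card F) - 1) * d) / real (card F)"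
    unfolding av diff_divide_distrib[symmetric] using k by (simp add: divide_right_mono)
  then show ?thesis using k by (simp add: field_simps)
qed

text \<open>
Averaging over the same net again and again keeps the Lipschitz constant, so the previous bound can be
iterated.
\<close>

lemma small_oscillation:
  assumes "lipschitz f" "0 < e"
  shows "\<exists>xs. xs \<noteq> [] \<and> (\<forall>y y'. avg xs f y - avg xs f y' \<le> e)"
proof -
  obtain C where C: "lip C f" using assms(1) by (auto simp: lipschitz_def)
  then have C0: "0 \<le> C" by (simp add: lip_def)
  obtain K where K: "0 \<le> K" "\<And>x. \<bar>f x\<bar> \<le> K" using lipschitz_bounded[OF assms(1)] by blast
  define d where "d = 2 * K"
  have d: "f y - f y' \<le> d" for y y' using K(2)[of y] K(2)[of y'] by (simp add: d_def)
  define \<delta> where "\<delta> = e / 2 / (C + 1)"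
  have \<delta>: "\<delta> > 0" "C * \<delta> \<le> e / 2" using C0 assms(2) by (auto simp: \<delta>_def field_simps)
  obtain F where F: "finite F" "\<And>x. \<exists>y\<in>F. p (x - y) < \<delta>" using p_totally_bounded[OF \<delta>(1)] by auto
  obtain as where as: "set as = F" "distinct as" using finite_distinct_list[OF F(1)] by auto
  have Fne: "F \<noteq> {}" using F(2) by auto
  then have k: "card F > 0" using F(1) by (simp add: card_gt_0_iff)
  define r where "r = 1 - 1 / real (card F)"
  have r: "0 \<le> r" "r < 1" using k by (auto simp: r_def)
  have *: "\<exists>xs. xs \<noteq> [] \<and> (\<forall>y y'. avg xs f y - avg xs f y' \<le> r ^ n * d + e / 2)" for n
  proof (induction n)
    case 0
    show ?case using d assms(2) by (intro exI[of _ "[0]"]) (auto simp: avg_def intro: add_increasing2)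
  next
    case (Suc n)
    then obtain xs where xs: "xs \<noteq> []" "\<And>y y'. avg xs f y - avg xs f y' \<le> r ^ n * d + e / 2" by auto
    have "avg (add_lists as xs) f y - avg (add_lists as xs) f y' \<le> r ^ Suc n * d + e / 2" for y y'
    proof -
      have "avg (add_lists as xs) f y - avg (add_lists as xs) f y' \<le> r * (r ^ n * d + e / 2) + e / 2 / real (card F)"
        unfolding avg_add_lists r_def
        by (rule avg_reduces_oscillation[OF lip_avg[OF C xs(1)] _ F as \<delta>(2)]) (use xs(2) r_def in auto)
      also have "\<dots> = r ^ Suc n * d + e / 2" by (simp add: r_def algebra_simps)
      finally show ?thesis .
    qed
    then show ?case using xs(1) as Fne by (intro exI[of _ "add_lists as xs"]) (auto simp: add_lists_eq_Nil_iff)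
  qed
  have "(\<lambda>n. r ^ n * d) \<longlonglongrightarrow> 0 * d" using r by (intro tendsto_intros LIMSEQ_power_zero) auto
  then have "\<forall>\<^sub>F n in sequentially. r ^ n * d < e / 2" using assms(2) by (intro order_tendstoD) auto
  then obtain n where n: "r ^ n * d < e / 2" by (auto simp: eventually_sequentially)
  obtain xs where xs: "xs \<noteq> []" "\<And>y y'. avg xs f y - avg xs f y' \<le> r ^ n * d + e / 2" using *[of n] by auto
  have "avg xs f y - avg xs f y' \<le> e" for y y' using xs(2)[of y y'] n by linarith
  with xs(1) show ?thesis by blast
qed

text \<open>
The mean is found as the infimum of all uniform upper bounds of averages: an average with small oscillation
and almost optimal upper bound cannot fall much below it.
\<close>

lemma has_mean_mean:
  assumes f: "lipschitz f" shows "has_mean f (mean f)"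
proof -
  define S where "S = {s. \<exists>xs. xs \<noteq> [] \<and> (\<forall>y. avg xs f y \<le> s)}"
  obtain K where K: "0 \<le> K" "\<And>x. \<bar>f x\<bar> \<le> K" using lipschitz_bounded[OF f] by blast
  have KS: "K \<in> S" unfolding S_def
    by (rule CollectI, rule exI[of _ "[0]"]) (use K(2) in \<open>auto simp: avg_def abs_le_iff\<close>)
  have bd: "bdd_below S"
  proof (rule bdd_belowI)
    fix s assume "s \<in> S"
    then obtain xs where xs: "xs \<noteq> []" "\<And>y. avg xs f y \<le> s" unfolding S_def by auto
    have "\<bar>avg xs f 0 - 0\<bar> \<le> K" by (rule avg_close[OF xs(1)]) (use K in auto)
    then show "- K \<le> s" using xs(2)[of 0] by auto
  qed
  define c where "c = Inf S"
  have "has_mean f c" unfolding has_mean_def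
  proof safe
    fix e :: real assume e: "e > 0"
    obtain s where s: "s \<in> S" "s < c + e / 2" using cInf_lessD[of S "c + e / 2"] KS e by (auto simp: c_def)
    then obtain xs where xs: "xs \<noteq> []" "\<And>y. avg xs f y \<le> s" unfolding S_def by auto
    obtain ys where ys: "ys \<noteq> []" "\<And>y y'. avg ys f y - avg ys f y' \<le> e / 2"
      using small_oscillation[OF f, of "e/2"] e by auto
    let ?g = "avg (add_lists xs ys) f"
    have up: "?g y \<le> s" for y
      unfolding avg_add_lists avg_commute[of xs] by (rule avg_le[OF ys(1) xs(2)])
    have osc: "?g y - ?g y' \<le> e / 2" for y y'
    proof -
      have a: "avg ys f z + (-1) * avg ys f (z + (y' - y)) \<le> e / 2" for z using ys(2)[of z "z + (y' - y)"] by simp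
      have "avg xs (\<lambda>z. avg ys f z + (-1) * avg ys f (z + (y' - y))) y \<le> e / 2"
        by (rule avg_le[OF xs(1) a])
      then show ?thesis unfolding avg_add avg_scale avg_add_lists
        by (simp add: avg_def[of xs] algebra_simps)
    qed
    have "?g y \<ge> c - e" for y
    proof (rule ccontr)
      assume "\<not> ?g y \<ge> c - e"
      then have "?g z \<le> c - e / 2" for z using osc[of z y] by linarith
      then have "c - e / 2 \<in> S" unfolding S_def using xs(1) ys(1) add_lists_eq_Nil_iff by blast
      then have "c \<le> c - e / 2" unfolding c_def using bd by (rule cInf_lower)
      then show False using e by simp
    qed
    then have "\<bar>?g y - c\<bar> \<le> e" for y using up[of y] s(2) e by (smt (verit, best) field_sum_of_halves)
    then show "\<exists>xs. xs \<noteq> [] \<and> (\<forall>y. \<bar>avg xs f y - c\<bar> \<le> e)"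
      using xs(1) ys(1) add_lists_eq_Nil_iff by blast
  qed
  then show ?thesis using mean_eqI by blast
qed

lemma mean_add: "lipschitz f \<Longrightarrow> lipschitz g \<Longrightarrow> mean (\<lambda>y. f y + g y) = mean f + mean g"
  by (intro mean_eqI has_mean_add has_mean_mean)

lemma mean_scale: "lipschitz f \<Longrightarrow> mean (\<lambda>y. a * f y) = a * mean f"
  by (intro mean_eqI has_mean_scale has_mean_mean)

lemma mean_diff: "lipschitz f \<Longrightarrow> lipschitz g \<Longrightarrow> mean (\<lambda>y. f y - g y) = mean f - mean g"
  using mean_add[of f "\<lambda>y. (-1) * g y"] mean_scale[of g "-1"]
    lipschitz_mult[OF lipschitz_const[of "-1"], of g] by simp

lemma mean_mono: "lipschitz f \<Longrightarrow> lipschitz g \<Longrightarrow> (\<And>y. f y \<le> g y) \<Longrightarrow> mean f \<le> mean g"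
  by (rule has_mean_mono[OF has_mean_mean has_mean_mean])

lemma mean_const: "mean (\<lambda>y. c) = c"
  by (rule mean_eqI has_mean_const)+

lemma mean_shift: "lipschitz f \<Longrightarrow> mean (\<lambda>y. f (y + v)) = mean f"
  by (intro mean_eqI has_mean_shift has_mean_mean)

lemma mean_nonneg: "lipschitz f \<Longrightarrow> (\<And>y. 0 \<le> f y) \<Longrightarrow> 0 \<le> mean f"
  using mean_mono[OF lipschitz_const, of f 0] by (simp add: mean_const)

lemma mean_sum_list:
  "(\<And>p. p \<in> set ps \<Longrightarrow> lipschitz (f p)) \<Longrightarrow> mean (\<lambda>y. \<Sum>p\<leftarrow>ps. f p y) = (\<Sum>p\<leftarrow>ps. mean (f p))"
  by (induction ps) (auto simp: mean_const mean_add lipschitz_sum_list)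

end

section \<open>Autocorrelations and the energy of a character\<close>

context totally_bounded_seminorm
begin

text \<open>
Round all points to the net \<open>F\<close>. By the Cauchy-Schwarz inequality at least a fraction \<open>1 / card F\<close> of all
pairs is rounded to the same point.
\<close>

lemma many_close_pairs:
  assumes F: "finite F" "\<And>x. \<exists>y\<in>F. p (x - y) < \<rho> / 2"
  shows "(real (length xs))\<^sup>2 \<le> real (card F) * (\<Sum>x\<leftarrow>xs. \<Sum>y\<leftarrow>xs. if p (x - y) < \<rho> then 1 else 0)"
proof -
  obtain c where c: "\<And>x. c x \<in> F" "\<And>x. p (x - c x) < \<rho> / 2" using F(2) by metis
  define N where "N f = (\<Sum>x\<leftarrow>xs. if c x = f then 1 else (0::real))" for f
  have "(\<Sum>f\<in>F. N f) = (\<Sum>x\<leftarrow>xs. \<Sum>f\<in>F. if c x = f then 1 else 0)"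
    unfolding N_def by (rule sum_sum_list[symmetric])
  also have "\<dots> = real (length xs)"
    using F(1) c(1) by (simp add: sum_list_triv)
  finally have "(real (length xs))\<^sup>2 = (\<Sum>f\<in>F. N f)\<^sup>2" by simp
  also have "\<dots> \<le> (\<Sum>f\<in>F. (N f)\<^sup>2) * real (card F)"
    using F(1) by (intro sum_squared_le_sum_of_squares)
  also have "(\<Sum>f\<in>F. (N f)\<^sup>2) = (\<Sum>f\<in>F. \<Sum>x\<leftarrow>xs. \<Sum>y\<leftarrow>xs. if c x = f \<and> c y = f then 1 else 0)"
    unfolding N_def power2_eq_square sum_list_product
    by (intro sum.cong refl arg_cong[of _ _ sum_list] map_cong) auto
  also have "\<dots> = (\<Sum>x\<leftarrow>xs. \<Sum>y\<leftarrow>xs. \<Sum>f\<in>F. if c x = f \<and> c y = f then 1 else 0)"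
    by (simp only: sum_sum_list)
  also have "\<dots> \<le> (\<Sum>x\<leftarrow>xs. \<Sum>y\<leftarrow>xs. if p (x - y) < \<rho> then 1 else 0)"
  proof (intro sum_list_mono)
    fix x y
    show "(\<Sum>f\<in>F. if c x = f \<and> c y = f then 1 else 0) \<le> (if p (x - y) < \<rho> then 1 else (0::real))"
    proof (cases "c x = c y")
      case True
      have "p (x - y) \<le> p (x - c x) + p (- (y - c y))" using p_triangle[of "x - c x" "-(y - c y)"] True by simp
      also have "\<dots> < \<rho>" using c(2)[of x] c(2)[of y] unfolding p_minus by simp
      finally show ?thesis using True F(1) by simp
    next
      case False
      then have "(\<Sum>f\<in>F. if c x = f \<and> c y = f then 1 else 0) = (\<Sum>f\<in>F. 0::real)"
        by (intro sum.cong) auto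
      then show ?thesis by simp
    qed
  qed
  finally show ?thesis by (simp add: mult.commute mult_right_mono)
qed

definition clipschitz :: "('a \<Rightarrow> complex) \<Rightarrow> bool" where
  "clipschitz h \<longleftrightarrow> lipschitz (\<lambda>y. Re (h y)) \<and> lipschitz (\<lambda>y. Im (h y))"

lemma clip_intros [lip_intros]:
  "clipschitz (\<lambda>y. c)"
  "clipschitz h \<Longrightarrow> clipschitz k \<Longrightarrow> clipschitz (\<lambda>y. h y + k y)"
  "clipschitz h \<Longrightarrow> clipschitz k \<Longrightarrow> clipschitz (\<lambda>y. h y - k y)"
  "clipschitz h \<Longrightarrow> clipschitz k \<Longrightarrow> clipschitz (\<lambda>y. h y * k y)"
  "lipschitz f \<Longrightarrow> clipschitz (\<lambda>y. complex_of_real (f y))"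
  by (auto simp: clipschitz_def intro!: lip_intros)

lemma clipschitz_shift: "clipschitz h \<Longrightarrow> clipschitz (\<lambda>y. h (y + z))"
  unfolding clipschitz_def using lipschitz_shift[of "\<lambda>y. Re (h y)" z] lipschitz_shift[of "\<lambda>y. Im (h y)" z] by simp

lemma clipschitz_sum_list [lip_intros]:
  "(\<And>p. p \<in> set ps \<Longrightarrow> clipschitz (h p)) \<Longrightarrow> clipschitz (\<lambda>y. \<Sum>p\<leftarrow>ps. h p y)"
  by (induction ps) (auto intro!: lip_intros)

lemma lipschitz_norm_square [lip_intros]:
  "clipschitz h \<Longrightarrow> lipschitz (\<lambda>y. (cmod (h y))\<^sup>2)"
  unfolding cmod_power2 clipschitz_def by (intro lip_intros) auto

lemma clipschitz_character:
  assumes "character \<xi>" "\<And>v. cmod (\<xi> v - 1) \<le> C * p v" "0 \<le> C"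
  shows "clipschitz \<xi>"
proof -
  have "cmod (\<xi> (x + v) - \<xi> x) \<le> C * p v" for x v
    using assms(2) character_norm_diff[OF assms(1)] by simp
  then have "\<bar>Re (\<xi> (x + v)) - Re (\<xi> x)\<bar> \<le> C * p v" "\<bar>Im (\<xi> (x + v)) - Im (\<xi> x)\<bar> \<le> C * p v" for x v
    using abs_Re_le_cmod[of "\<xi> (x + v) - \<xi> x"] abs_Im_le_cmod[of "\<xi> (x + v) - \<xi> x"]
    by (auto intro: order_trans simp del: minus_complex.sel simp add: minus_complex.sel[symmetric])
  then show ?thesis unfolding clipschitz_def using assms(3) by (auto intro!: lipschitzI)
qed

definition autocorr :: "('a \<Rightarrow> real) \<Rightarrow> 'a \<Rightarrow> real" where
  "autocorr g z = mean (\<lambda>y. g (y + z) * g y)"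

lemma autocorr_diff:
  assumes "lipschitz g" shows "autocorr g (a - b) = mean (\<lambda>y. g (y + a) * g (y + b))"
proof -
  have "lipschitz (\<lambda>y. g (y + (a - b)) * g y)" by (intro lipschitz_mult lipschitz_shift assms)
  from mean_shift[OF this, of b] show ?thesis by (simp add: autocorr_def add.assoc)
qed

lemma autocorr_minus: "lipschitz g \<Longrightarrow> autocorr g (- z) = autocorr g z"
  using autocorr_diff[of g 0 z] autocorr_diff[of g z 0] by (simp add: mult.commute)

text \<open>
The form of an autocorrelation is the mean of a square, so autocorrelations are positive definite.
\<close>

lemma herm_form_autocorr:
  assumes g: "lipschitz g"
  shows "herm_form (\<lambda>z. complex_of_real (autocorr g z)) ps ps
    = complex_of_real (mean (\<lambda>y. (cmod (\<Sum>p\<leftarrow>ps. fst p * complex_of_real (g (y + snd p))))\<^sup>2))"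
proof (rule complex_eqI)
  let ?q = "\<lambda>z. complex_of_real (autocorr g z)"
  have "cnj (herm_form ?q ps ps) = (\<Sum>p\<leftarrow>ps. \<Sum>q\<leftarrow>ps. fst q * cnj (fst p) * ?q (snd p - snd q))"
    unfolding herm_form_def cnj_sum_list by (simp add: mult.commute)
  also have "\<dots> = (\<Sum>p\<leftarrow>ps. \<Sum>q\<leftarrow>ps. fst q * cnj (fst p) * ?q (snd q - snd p))"
    by (intro arg_cong[of _ _ sum_list] map_cong refl) (metis autocorr_minus[OF g] minus_diff_eq)
  also have "\<dots> = herm_form ?q ps ps" unfolding herm_form_def by (rule sum_list_swap)
  finally have "Im (cnj (herm_form ?q ps ps)) = Im (herm_form ?q ps ps)" by (rule arg_cong)
  then have "Im (herm_form ?q ps ps) = 0" by simp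
  then show "Im (herm_form ?q ps ps) = Im (complex_of_real (mean (\<lambda>y. (cmod (\<Sum>p\<leftarrow>ps. fst p * complex_of_real (g (y + snd p))))\<^sup>2)))"
    by simp
  have sq: "(cmod (\<Sum>p\<leftarrow>ps. fst p * complex_of_real (g (y + snd p))))\<^sup>2
     = (\<Sum>p\<leftarrow>ps. \<Sum>q\<leftarrow>ps. Re (fst p * cnj (fst q)) * (g (y + snd p) * g (y + snd q)))" for y
  proof -
    have "(cmod (\<Sum>p\<leftarrow>ps. fst p * complex_of_real (g (y + snd p))))\<^sup>2
      = (\<Sum>p\<leftarrow>ps. Re (fst p) * g (y + snd p)) * (\<Sum>p\<leftarrow>ps. Re (fst p) * g (y + snd p))
      + (\<Sum>p\<leftarrow>ps. Im (fst p) * g (y + snd p)) * (\<Sum>p\<leftarrow>ps. Im (fst p) * g (y + snd p))"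
      unfolding cmod_power2 by (simp add: Re_sum_list Im_sum_list power2_eq_square)
    also have "\<dots> = (\<Sum>p\<leftarrow>ps. \<Sum>q\<leftarrow>ps. Re (fst p * cnj (fst q)) * (g (y + snd p) * g (y + snd q)))"
      unfolding sum_list_product sum_list_addf[symmetric]
      by (intro arg_cong[of _ _ sum_list] map_cong refl) (simp add: algebra_simps)
    finally show ?thesis .
  qed
  have "mean (\<lambda>y. (cmod (\<Sum>p\<leftarrow>ps. fst p * complex_of_real (g (y + snd p))))\<^sup>2)
     = (\<Sum>p\<leftarrow>ps. \<Sum>q\<leftarrow>ps. Re (fst p * cnj (fst q)) * mean (\<lambda>y. g (y + snd p) * g (y + snd q)))"
    unfolding sq by (simp add: mean_sum_list mean_scale lip_intros lipschitz_shift[OF g] g)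
  also have "\<dots> = Re (herm_form ?q ps ps)"
    unfolding herm_form_def Re_sum_list autocorr_diff[OF g] by simp
  finally show "Re (herm_form ?q ps ps) = Re (complex_of_real (mean (\<lambda>y. (cmod (\<Sum>p\<leftarrow>ps. fst p * complex_of_real (g (y + snd p))))\<^sup>2)))"
    by simp
qed

lemma state_autocorr:
  assumes g: "lipschitz g" and "autocorr g 0 > 0"
  shows "state (\<lambda>z. complex_of_real (1 / autocorr g 0) * complex_of_real (autocorr g z))"
proof -
  have "pos_def (\<lambda>z. complex_of_real (autocorr g z))"
    unfolding pos_def_def herm_form_autocorr[OF g]
    by (auto intro!: mean_nonneg lip_intros lipschitz_shift[OF g] g)
  from state_scale[OF this refl assms(2)] show ?thesis by simp
qed

definition twisted_avg :: "('a \<Rightarrow> real) \<Rightarrow> 'a list \<Rightarrow> ('a \<Rightarrow> complex) \<Rightarrow> 'a \<Rightarrow> complex" where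
  "twisted_avg g xs \<xi> y = (\<Sum>x\<leftarrow>xs. \<xi> x * complex_of_real (g (y + x))) / of_nat (length xs)"

text \<open>
As the list grows, this decreases to the squared modulus of the Fourier coefficient \<open>mean (g * \<xi>)\<close> if \<open>\<xi>\<close>
is continuous. Working with all finite lists gives a quantity that makes sense for discontinuous \<open>\<xi>\<close> as well.
\<close>

definition energy :: "('a \<Rightarrow> real) \<Rightarrow> 'a list \<Rightarrow> ('a \<Rightarrow> complex) \<Rightarrow> real" where
  "energy g xs \<xi> = mean (\<lambda>y. (cmod (twisted_avg g xs \<xi> y))\<^sup>2)"

text \<open>
The finitely supported functional that computes the energy at a character. Unlike the energy it is linear,
so it can be evaluated at arbitrary states.
\<close>

definition energy_pts :: "('a \<Rightarrow> real) \<Rightarrow> 'a list \<Rightarrow> (complex \<times> 'a) list" where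
  "energy_pts g xs = concat (map (\<lambda>x. map (\<lambda>y.
     (complex_of_real (autocorr g (x - y) / (real (length xs))\<^sup>2), x - y)) xs) xs)"

lemma clipschitz_twisted_avg [lip_intros]: "lipschitz g \<Longrightarrow> clipschitz (twisted_avg g xs \<xi>)"
  unfolding twisted_avg_def divide_inverse by (intro lip_intros lipschitz_shift[of g])

lemma clipschitz_twisted_avg_shift [lip_intros]: "lipschitz g \<Longrightarrow> clipschitz (\<lambda>y. twisted_avg g xs \<xi> (y + z))"
  by (rule clipschitz_shift[OF clipschitz_twisted_avg])

lemma eval_sum_energy_pts:
  "eval_sum (energy_pts g xs) \<phi> = (\<Sum>x\<leftarrow>xs. \<Sum>y\<leftarrow>xs. autocorr g (x - y) * Re (\<phi> (x - y))) / (real (length xs))\<^sup>2"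
proof -
  show ?thesis unfolding eval_sum_def energy_pts_def sum_list_concat_map Re_sum_list sum_list_divide[symmetric] by simp
qed

lemma eval_sum_energy_pts_character:
  assumes g: "lipschitz g" and \<xi>: "character \<xi>"
  shows "eval_sum (energy_pts g xs) \<xi> = energy g xs \<xi>"
proof -
  let ?ps = "map (\<lambda>x. (\<xi> x, x)) xs" and ?n = "real (length xs)"
  have "energy g xs \<xi> = mean (\<lambda>y. (1 / ?n\<^sup>2) * (cmod (\<Sum>x\<leftarrow>xs. \<xi> x * complex_of_real (g (y + x))))\<^sup>2)"
    unfolding energy_def twisted_avg_def norm_divide power_divide by simp
  also have "\<dots> = (1 / ?n\<^sup>2) * mean (\<lambda>y. (cmod (\<Sum>x\<leftarrow>xs. \<xi> x * complex_of_real (g (y + x))))\<^sup>2)"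
    by (intro mean_scale lip_intros lipschitz_shift[OF g] g)
  also have "mean (\<lambda>y. (cmod (\<Sum>x\<leftarrow>xs. \<xi> x * complex_of_real (g (y + x))))\<^sup>2)
      = Re (herm_form (\<lambda>z. complex_of_real (autocorr g z)) ?ps ?ps)"
    unfolding herm_form_autocorr[OF g] by (simp add: o_def)
  also have "\<dots> = (\<Sum>x\<leftarrow>xs. \<Sum>y\<leftarrow>xs. autocorr g (x - y) * Re (\<xi> (x - y)))"
    unfolding herm_form_def by (simp add: o_def Re_sum_list character_diff[OF \<xi>] algebra_simps)
  finally show ?thesis unfolding eval_sum_energy_pts by simp
qed

lemma twisted_avg_add_lists:
  assumes "character \<xi>"
  shows "twisted_avg g (add_lists xs ys) \<xi> y = (\<Sum>z\<leftarrow>ys. \<xi> z * twisted_avg g xs \<xi> (y + z)) / of_nat (length ys)"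
proof -
  have "twisted_avg g (add_lists xs ys) \<xi> y
     = (\<Sum>z\<leftarrow>ys. \<Sum>x\<leftarrow>xs. \<xi> z * (\<xi> x * complex_of_real (g (y + z + x)))) / (of_nat (length xs) * of_nat (length ys))"
    unfolding twisted_avg_def sum_list_add_lists length_add_lists
    by (subst sum_list_swap) (simp add: character_add[OF assms] add_ac mult_ac)
  also have "\<dots> = (\<Sum>z\<leftarrow>ys. \<xi> z * twisted_avg g xs \<xi> (y + z)) / of_nat (length ys)"
    unfolding twisted_avg_def by (simp add: sum_list_const_mult sum_list_divide)
  finally show ?thesis .
qed

lemma add_lists_commute_twisted_avg:
  assumes "character \<xi>" shows "twisted_avg g (add_lists xs ys) \<xi> = twisted_avg g (add_lists ys xs) \<xi>"
  by (rule ext, simp add: twisted_avg_def sum_list_add_lists length_add_lists, subst sum_list_swap)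
     (simp add: add.commute mult.commute)

text \<open>
Averaging once more is a contraction in mean square.
\<close>

lemma energy_add_lists_le:
  assumes g: "lipschitz g" and \<xi>: "character \<xi>" and "ys \<noteq> []"
  shows "energy g (add_lists xs ys) \<xi> \<le> energy g xs \<xi>"
proof -
  let ?m = "real (length ys)"
  have m: "?m > 0" using assms(3) by simp
  have "(cmod (twisted_avg g (add_lists xs ys) \<xi> y))\<^sup>2 \<le> (1 / ?m) * (\<Sum>z\<leftarrow>ys. (cmod (twisted_avg g xs \<xi> (y + z)))\<^sup>2)" for y
  proof -
    have "(cmod (twisted_avg g (add_lists xs ys) \<xi> y))\<^sup>2 = (cmod (\<Sum>z\<leftarrow>ys. \<xi> z * twisted_avg g xs \<xi> (y + z)))\<^sup>2 / ?m\<^sup>2"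
      unfolding twisted_avg_add_lists[OF \<xi>] norm_divide power_divide by simp
    also have "\<dots> \<le> (?m * (\<Sum>z\<leftarrow>ys. (cmod (\<xi> z * twisted_avg g xs \<xi> (y + z)))\<^sup>2)) / ?m\<^sup>2"
      by (intro divide_right_mono sum_list_square_le) simp
    also have "\<dots> = (1 / ?m) * (\<Sum>z\<leftarrow>ys. (cmod (twisted_avg g xs \<xi> (y + z)))\<^sup>2)"
      using m by (simp add: norm_mult character_norm[OF \<xi>] power2_eq_square)
    finally show ?thesis .
  qed
  then have "energy g (add_lists xs ys) \<xi> \<le> mean (\<lambda>y. (1 / ?m) * (\<Sum>z\<leftarrow>ys. (cmod (twisted_avg g xs \<xi> (y + z)))\<^sup>2))"
    unfolding energy_def by (intro mean_mono lip_intros lipschitz_shift[OF g] g)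
  also have "\<dots> = (1 / ?m) * (\<Sum>z\<leftarrow>ys. mean (\<lambda>y. (cmod (twisted_avg g xs \<xi> (y + z)))\<^sup>2))"
    by (subst mean_scale, intro lip_intros lipschitz_shift[OF g] g, subst mean_sum_list, intro lip_intros lipschitz_shift[OF g] g, rule refl)
  also have "\<dots> = (1 / ?m) * (\<Sum>z\<leftarrow>ys. energy g xs \<xi>)"
  proof -
    have "mean (\<lambda>y. (cmod (twisted_avg g xs \<xi> (y + z)))\<^sup>2) = energy g xs \<xi>" for z
      unfolding energy_def
      by (rule mean_shift[where f = "\<lambda>y. (cmod (twisted_avg g xs \<xi> y))\<^sup>2"]) (intro lip_intros lipschitz_shift[OF g] g)
    then show ?thesis by (simp only:)
  qed
  also have "\<dots> = energy g xs \<xi>" using m by (simp add: sum_list_triv)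
  finally show ?thesis .
qed

lemma energy_nonneg: "lipschitz g \<Longrightarrow> 0 \<le> energy g xs \<xi>"
  unfolding energy_def by (intro mean_nonneg lip_intros) auto

text \<open>
For a single list the bound passes from the state to a character. Energies decrease when lists are added,
so finitely many lists can be treated as one, and compactness of the set of characters handles all of them.
\<close>

lemma exists_character_with_energy:
  assumes g: "lipschitz g" and \<phi>: "state \<phi>"
    and lower: "\<And>xs. xs \<noteq> [] \<Longrightarrow> \<kappa> \<le> eval_sum (energy_pts g xs) \<phi>"
  shows "\<exists>\<xi>. character \<xi> \<and> (\<forall>xs. xs \<noteq> [] \<longrightarrow> \<kappa> \<le> energy g xs \<xi>)"
proof -
  define K where "K xs = {\<xi>. \<kappa> \<le> eval_sum (energy_pts g xs) \<xi>}" for xs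
  have "{\<xi>. character \<xi>} \<inter> (\<Inter>xs\<in>{xs. xs \<noteq> []}. K xs) \<noteq> {}"
  proof (rule compact_imp_fip_image[OF compact_characters])
    show "closed (K xs)" for xs
      unfolding K_def by (intro closed_Collect_le continuous_intros)
    fix J :: "'a list set" assume J: "finite J" "J \<subseteq> {xs. xs \<noteq> []}"
    have "\<exists>ys. ys \<noteq> [] \<and> (\<forall>xs\<in>J. \<forall>\<xi>. character \<xi> \<longrightarrow> energy g ys \<xi> \<le> energy g xs \<xi>)"
      using J
    proof (induction J rule: finite_induct)
      case empty
      show ?case by (intro exI[of _ "[0]"]) auto
    next
      case (insert xs J)
      then obtain ys where ys: "ys \<noteq> []" "\<forall>xs\<in>J. \<forall>\<xi>. character \<xi> \<longrightarrow> energy g ys \<xi> \<le> energy g xs \<xi>" by auto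
      have xs: "xs \<noteq> []" using insert by auto
      have "energy g (add_lists xs ys) \<xi> \<le> energy g xs \<xi>" "energy g (add_lists xs ys) \<xi> \<le> energy g ys \<xi>"
        if "character \<xi>" for \<xi>
        using energy_add_lists_le[OF g that ys(1), of xs] energy_add_lists_le[OF g that xs, of ys]
        by (auto simp: energy_def add_lists_commute_twisted_avg[OF that, of g xs ys])
      then show ?case using ys xs
        by (intro exI[of _ "add_lists xs ys"] conjI ballI allI impI)
          (simp_all add: add_lists_eq_Nil_iff, metis order_trans)
    qed
    then obtain ys where ys: "ys \<noteq> []" "\<And>xs \<xi>. xs \<in> J \<Longrightarrow> character \<xi> \<Longrightarrow> energy g ys \<xi> \<le> energy g xs \<xi>" by auto
    obtain \<xi> where \<xi>: "character \<xi>" "eval_sum (energy_pts g ys) \<phi> \<le> eval_sum (energy_pts g ys) \<xi>"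
      using state_dominated_by_character[OF \<phi>] by metis
    have "\<xi> \<in> K xs" if "xs \<in> J" for xs
    proof -
      have "\<kappa> \<le> energy g ys \<xi>" using lower[OF ys(1)] \<xi> eval_sum_energy_pts_character[OF g \<xi>(1)] by simp
      also have "\<dots> \<le> energy g xs \<xi>" using ys(2)[OF that \<xi>(1)] .
      finally show ?thesis unfolding K_def using eval_sum_energy_pts_character[OF g \<xi>(1)] by simp
    qed
    then show "{\<xi>. character \<xi>} \<inter> (\<Inter>xs\<in>J. K xs) \<noteq> {}" using \<xi>(1) by blast
  qed
  then obtain \<xi> where "character \<xi>" "\<And>xs. xs \<noteq> [] \<Longrightarrow> \<xi> \<in> K xs" by auto
  then show ?thesis unfolding K_def using eval_sum_energy_pts_character[OF g] by auto
qed

lemma norm_add_square_le: "(cmod (a + b))\<^sup>2 \<le> 2 * (cmod a)\<^sup>2 + 2 * (cmod b)\<^sup>2"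
proof -
  have "(cmod (a + b))\<^sup>2 + (cmod (a - b))\<^sup>2 = 2 * (cmod a)\<^sup>2 + 2 * (cmod b)\<^sup>2"
    unfolding cmod_power2 by (simp add: power2_eq_square algebra_simps)
  then show ?thesis by (smt (verit) zero_le_power2)
qed

lemma twisted_avg_lip:
  assumes g: "\<And>y v. \<bar>g (y + v) - g y\<bar> \<le> D * p v" and \<xi>: "character \<xi>" and xs: "xs \<noteq> []"
  shows "cmod (twisted_avg g xs \<xi> (y + v) - twisted_avg g xs \<xi> y) \<le> D * p v"
proof -
  have "twisted_avg g xs \<xi> (y + v) - twisted_avg g xs \<xi> y
     = (\<Sum>x\<leftarrow>xs. \<xi> x * complex_of_real (g (y + x + v) - g (y + x))) / of_nat (length xs)"
    unfolding twisted_avg_def diff_divide_distrib[symmetric] sum_list_subtractf[symmetric]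
    by (simp add: right_diff_distrib add_ac)
  also have "cmod \<dots> = cmod (\<Sum>x\<leftarrow>xs. \<xi> x * complex_of_real (g (y + x + v) - g (y + x))) / real (length xs)"
    by (simp add: norm_divide)
  also have "\<dots> \<le> (\<Sum>x\<leftarrow>xs. cmod (\<xi> x * complex_of_real (g (y + x + v) - g (y + x)))) / real (length xs)"
    by (intro divide_right_mono) (induction xs, auto intro: norm_triangle_le)
  also have "\<dots> \<le> (\<Sum>x\<leftarrow>xs. D * p v) / real (length xs)"
    by (intro divide_right_mono sum_list_mono) (auto simp: norm_mult character_norm[OF \<xi>] g simp del: of_real_diff)
  also have "\<dots> = D * p v" using xs by (simp add: sum_list_triv)
  finally show ?thesis .
qed

text \<open>
For a list of almost minimal energy let \<open>H\<close> be the twisted average. Averaging once more over \<open>0\<close> and \<open>v\<close>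
cannot lower the energy noticeably, so by the parallelogram law \<open>H y\<close> and \<open>\<xi> v * H (y + v)\<close> are close in mean
square. As \<open>H\<close> itself moves by at most \<open>2 * p v\<close>, also \<open>(\<xi> v - 1) * H\<close> is small, while \<open>H\<close> is not.
\<close>

lemma character_lipschitz_of_energy:
  assumes g: "lipschitz g" "\<And>y v. \<bar>g (y + v) - g y\<bar> \<le> 2 * p v"
    and \<xi>: "character \<xi>" and low: "\<And>xs. xs \<noteq> [] \<Longrightarrow> \<kappa> \<le> energy g xs \<xi>"
  shows "(cmod (\<xi> v - 1))\<^sup>2 * \<kappa> \<le> 8 * (p v)\<^sup>2"
proof -
  define K where "K = (INF xs\<in>{xs. xs \<noteq> []}. energy g xs \<xi>)"
  have bdd: "bdd_below ((\<lambda>xs. energy g xs \<xi>) ` {xs. xs \<noteq> []})"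
    using energy_nonneg[OF g(1)] by (auto intro!: bdd_belowI)
  have Kle: "K \<le> energy g xs \<xi>" if "xs \<noteq> []" for xs
    unfolding K_def by (rule cINF_lower[OF bdd]) (use that in auto)
  have "(cmod (\<xi> v - 1))\<^sup>2 * \<kappa> \<le> 8 * (p v)\<^sup>2 + e" if e: "e > 0" for e
  proof -
    have "K < K + e / 8" using e by simp
    then have "\<exists>xs\<in>{xs. xs \<noteq> []}. energy g xs \<xi> < K + e / 8"
      using cInf_lessD[of "(\<lambda>xs. energy g xs \<xi>) ` {xs. xs \<noteq> []}" "K + e / 8"]
      by (force simp: K_def)
    then obtain xs where xs: "xs \<noteq> []" "energy g xs \<xi> < K + e / 8" by auto
    define H where "H = twisted_avg g xs \<xi>"
    have H: "clipschitz H" unfolding H_def by (intro lip_intros lipschitz_shift[OF g(1)] g(1))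
    have Hs: "clipschitz (\<lambda>y. H (y + v))" using H by (rule clipschitz_shift)
    have EH: "energy g xs \<xi> = mean (\<lambda>y. (cmod (H y))\<^sup>2)" by (simp add: energy_def H_def)
    have EHs: "energy g xs \<xi> = mean (\<lambda>y. (cmod (H (y + v)))\<^sup>2)"
      unfolding EH by (rule mean_shift[symmetric]) (intro lip_intros H)
    have "energy g (add_lists xs [0, v]) \<xi> = mean (\<lambda>y. (1/4) * (cmod (\<xi> v * H (y + v) + H y))\<^sup>2)"
      unfolding energy_def twisted_avg_add_lists[OF \<xi>]
      by (simp add: H_def character_0[OF \<xi>] norm_divide power_divide add.commute)
    also have "\<dots> = (1/4) * mean (\<lambda>y. (cmod (\<xi> v * H (y + v) + H y))\<^sup>2)"
      by (intro mean_scale lip_intros H Hs)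
    finally have E2: "4 * K \<le> mean (\<lambda>y. (cmod (\<xi> v * H (y + v) + H y))\<^sup>2)"
      using Kle[of "add_lists xs [0, v]"] xs(1) by (simp add: add_lists_eq_Nil_iff)
    have par: "(cmod (\<xi> v * H (y + v) - H y))\<^sup>2
        = (2 * (cmod (H (y + v)))\<^sup>2 + 2 * (cmod (H y))\<^sup>2) - (cmod (\<xi> v * H (y + v) + H y))\<^sup>2" for y
    proof -
      have "(cmod (a - b))\<^sup>2 = (2 * (cmod a)\<^sup>2 + 2 * (cmod b)\<^sup>2) - (cmod (a + b))\<^sup>2" for a b
        unfolding cmod_power2 by (simp add: power2_eq_square algebra_simps)
      from this[of "\<xi> v * H (y + v)" "H y"] show ?thesis
        by (simp add: norm_mult character_norm[OF \<xi>])
    qed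
    have "mean (\<lambda>y. (cmod (\<xi> v * H (y + v) - H y))\<^sup>2)
       = mean (\<lambda>y. 2 * (cmod (H (y + v)))\<^sup>2 + 2 * (cmod (H y))\<^sup>2) - mean (\<lambda>y. (cmod (\<xi> v * H (y + v) + H y))\<^sup>2)"
      unfolding par by (intro mean_diff lip_intros H Hs)
    also have "mean (\<lambda>y. 2 * (cmod (H (y + v)))\<^sup>2 + 2 * (cmod (H y))\<^sup>2) = 4 * energy g xs \<xi>"
      by (subst mean_add, (intro lip_intros H Hs)+, (subst mean_scale, intro lip_intros H Hs)+)
         (simp add: EH[symmetric] EHs[symmetric])
    finally have small: "mean (\<lambda>y. (cmod (\<xi> v * H (y + v) - H y))\<^sup>2) \<le> e / 2"
      using E2 xs(2) by simp
    have "(cmod (\<xi> v - 1))\<^sup>2 * (cmod (H y))\<^sup>2 \<le> 2 * (cmod (\<xi> v * H (y + v) - H y))\<^sup>2 + 8 * (p v)\<^sup>2" for y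
    proof -
      have "(\<xi> v - 1) * H y = (\<xi> v * H (y + v) - H y) + (- (\<xi> v * (H (y + v) - H y)))"
        by (simp add: algebra_simps)
      then have "(cmod ((\<xi> v - 1) * H y))\<^sup>2 \<le> 2 * (cmod (\<xi> v * H (y + v) - H y))\<^sup>2
          + 2 * (cmod (- (\<xi> v * (H (y + v) - H y))))\<^sup>2" using norm_add_square_le by metis
      moreover have "cmod (H (y + v) - H y) \<le> 2 * p v"
        unfolding H_def by (rule twisted_avg_lip[OF g(2) \<xi> xs(1)])
      then have "(cmod (H (y + v) - H y))\<^sup>2 \<le> (2 * p v)\<^sup>2" by (rule power_mono) simp
      ultimately show ?thesis by (simp add: norm_mult power_mult_distrib character_norm[OF \<xi>])
    qed
    then have "mean (\<lambda>y. (cmod (\<xi> v - 1))\<^sup>2 * (cmod (H y))\<^sup>2)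
       \<le> mean (\<lambda>y. 2 * (cmod (\<xi> v * H (y + v) - H y))\<^sup>2 + 8 * (p v)\<^sup>2)"
      by (intro mean_mono lip_intros H Hs)
    also have "\<dots> = 2 * mean (\<lambda>y. (cmod (\<xi> v * H (y + v) - H y))\<^sup>2) + 8 * (p v)\<^sup>2"
      by (subst mean_add, (intro lip_intros H Hs)+, subst mean_scale, intro lip_intros H Hs)
         (simp add: mean_const)
    also have "mean (\<lambda>y. (cmod (\<xi> v - 1))\<^sup>2 * (cmod (H y))\<^sup>2) = (cmod (\<xi> v - 1))\<^sup>2 * energy g xs \<xi>"
      unfolding EH by (intro mean_scale lip_intros H Hs)
    finally have "(cmod (\<xi> v - 1))\<^sup>2 * energy g xs \<xi> \<le> 8 * (p v)\<^sup>2 + e" using small by simp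
    moreover have "(cmod (\<xi> v - 1))\<^sup>2 * \<kappa> \<le> (cmod (\<xi> v - 1))\<^sup>2 * energy g xs \<xi>"
      by (intro mult_left_mono low xs) simp
    ultimately show ?thesis by simp
  qed
  then show ?thesis by (rule field_le_epsilon)
qed

definition bump :: "'a \<Rightarrow> real" where
  "bump y = max 0 (1 - p y)"

lemma bump_lip: "\<bar>bump (y + v) - bump y\<bar> \<le> p v"
  using p_triangle[of y v] p_triangle[of "y + v" "-v"] p_minus[of v] p_nonneg[of v] unfolding bump_def by auto

lemma bump_bounds: "0 \<le> bump y" "bump y \<le> 1" "bump 0 = 1" "1 \<le> p y \<Longrightarrow> bump y = 0"
  using p_nonneg[of y] by (auto simp: bump_def p_0)

lemma lipschitz_bump [lip_intros]: "lipschitz bump"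
  by (rule lipschitzI[of _ 1]) (use bump_lip in auto)

text \<open>
The function whose Fourier coefficients single out the characters that differ from 1 at \<open>x\<close>: at \<open>\<xi>\<close> the
coefficient of the bump function is multiplied by \<open>cnj (\<xi> x) - 1\<close>.
\<close>

definition bump_diff :: "'a \<Rightarrow> 'a \<Rightarrow> real" where
  "bump_diff x y = bump (y + x) - bump y"

lemma lipschitz_bump_diff: "lipschitz (bump_diff x)"
  unfolding bump_diff_def by (intro lip_intros lipschitz_shift[of bump])

lemma bump_diff_lip: "\<bar>bump_diff x (y + v) - bump_diff x y\<bar> \<le> 2 * p v"
  using bump_lip[of y v] bump_lip[of "y + x" v] by (simp add: bump_diff_def add_ac)

lemma bump_diff_bound: "\<bar>bump_diff x y\<bar> \<le> 1"
  using bump_bounds(1,2)[of "y + x"] bump_bounds(1,2)[of y] by (simp add: bump_diff_def)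

lemma autocorr_bump_diff_lip: "autocorr (bump_diff x) 0 - 2 * p v \<le> autocorr (bump_diff x) v"
proof -
  let ?g = "bump_diff x"
  note g = lipschitz_bump_diff[of x]
  have "?g y * ?g y - 2 * p v \<le> ?g (y + v) * ?g y" for y
  proof -
    have "\<bar>(?g (y + v) - ?g y) * ?g y\<bar> \<le> (2 * p v) * 1"
      unfolding abs_mult by (intro mult_mono bump_diff_lip bump_diff_bound) (use p_nonneg in auto)
    then show ?thesis by (simp add: algebra_simps abs_le_iff)
  qed
  then have "mean (\<lambda>y. ?g y * ?g y - 2 * p v) \<le> mean (\<lambda>y. ?g (y + v) * ?g y)"
    by (intro mean_mono lip_intros lipschitz_shift[OF g] g)
  moreover have "mean (\<lambda>y. ?g y * ?g y - 2 * p v) = mean (\<lambda>y. ?g y * ?g y) - 2 * p v"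
    by (subst mean_diff) (intro lip_intros lipschitz_shift[OF g] g | simp add: mean_const)+
  ultimately show ?thesis by (simp add: autocorr_def)
qed

text \<open>
The function \<open>bump_diff x\<close> is \<open>- 1\<close> at 0 and hence at most \<open>- 1/2\<close> on the ball of radius \<open>1/4\<close>; finitely many
translates of this ball cover the group.
\<close>

lemma autocorr_bump_diff_pos:
  assumes F: "finite F" "\<And>x. \<exists>y\<in>F. p (x - y) < 1/4" and x: "1 \<le> p x"
  shows "1 / (4 * real (card F)) \<le> autocorr (bump_diff x) 0"
proof -
  let ?g = "bump_diff x"
  note g = lipschitz_bump_diff[of x]
  have k: "card F > 0" using F by (auto simp: card_gt_0_iff)
  obtain zs where zs: "set zs = F" "distinct zs" using finite_distinct_list[OF F(1)] by auto
  have "1 / 4 \<le> (\<Sum>z\<leftarrow>zs. (?g (y + z))\<^sup>2)" for y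
  proof -
    obtain z where z: "z \<in> F" "p (- y - z) < 1/4" using F(2) by blast
    have "p (y + z) < 1/4" using z(2) p_minus[of "y + z"] by simp
    then have "\<bar>?g (y + z) - ?g 0\<bar> \<le> 1/2" using bump_diff_lip[of x 0 "y + z"] by simp
    moreover have "?g 0 = -1" using bump_bounds(3) bump_bounds(4)[OF x] by (simp add: bump_diff_def)
    ultimately have "1/2 \<le> - ?g (y + z)" by linarith
    then have "(1/2)\<^sup>2 \<le> (- ?g (y + z))\<^sup>2" by (rule power_mono) simp
    then have "1/4 \<le> (?g (y + z))\<^sup>2" by (simp add: power2_eq_square)
    also have "\<dots> \<le> (\<Sum>z\<in>F. (?g (y + z))\<^sup>2)"
      using F(1) z(1) by (intro member_le_sum) auto
    finally show ?thesis using zs by (simp add: sum_list_distinct_conv_sum_set)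
  qed
  then have "mean (\<lambda>y::'a. 1/4) \<le> mean (\<lambda>y. \<Sum>z\<leftarrow>zs. (?g (y + z))\<^sup>2)"
    by (intro mean_mono lip_intros lipschitz_shift[OF g] g)
  also have "\<dots> = (\<Sum>z\<leftarrow>zs. mean (\<lambda>y. (?g (y + z))\<^sup>2))" by (intro mean_sum_list lip_intros lipschitz_shift[OF g] g)
  also have "\<dots> = (\<Sum>z\<leftarrow>zs. autocorr ?g 0)"
  proof -
    have "mean (\<lambda>y. (?g (y + z))\<^sup>2) = autocorr ?g 0" for z
      using autocorr_diff[OF g, of z z] by (simp add: power2_eq_square)
    then show ?thesis by simp
  qed
  finally show ?thesis using zs k by (simp add: mean_const sum_list_triv distinct_card[symmetric] field_simps)
qed

text \<open>
On the normalised autocorrelation \<open>q / q 0\<close> the functional averages \<open>(q (a - b))\<^sup>2 / q 0\<close> over all pairs, and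
this is at least \<open>q 0 / 4\<close> for pairs at distance less than \<open>\<rho>\<close>.
\<close>

lemma energy_form_lower_bound:
  assumes F: "finite F" "\<And>x. \<exists>y\<in>F. p (x - y) < \<rho> / 2"
    and q: "4 * \<rho> \<le> autocorr (bump_diff x) 0" "0 < autocorr (bump_diff x) 0" and xs: "xs \<noteq> []"
  shows "autocorr (bump_diff x) 0 / (4 * real (card F))
    \<le> eval_sum (energy_pts (bump_diff x) xs)
        (\<lambda>z. complex_of_real (1 / autocorr (bump_diff x) 0) * complex_of_real (autocorr (bump_diff x) z))"
proof -
  let ?q = "autocorr (bump_diff x)" and ?n = "real (length xs)"
  have k: "card F > 0" using F by (auto simp: card_gt_0_iff)
  have n: "?n > 0" using xs by simp
  have "?n\<^sup>2 \<le> real (card F) * (\<Sum>a\<leftarrow>xs. \<Sum>b\<leftarrow>xs. if p (a - b) < \<rho> then 1 else 0)"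
    by (rule many_close_pairs[OF F])
  then have "?q 0 / 4 * ?n\<^sup>2 \<le> ?q 0 / 4 * (real (card F) * (\<Sum>a\<leftarrow>xs. \<Sum>b\<leftarrow>xs. if p (a - b) < \<rho> then 1 else 0))"
    using q(2) by (intro mult_left_mono) auto
  also have "\<dots> = real (card F) * (\<Sum>a\<leftarrow>xs. \<Sum>b\<leftarrow>xs. ?q 0 / 4 * (if p (a - b) < \<rho> then 1 else 0))"
    by (simp only: sum_list_const_mult mult.left_commute)
  also have "\<dots> \<le> real (card F) * (\<Sum>a\<leftarrow>xs. \<Sum>b\<leftarrow>xs. ?q (a - b) * (1 / ?q 0 * ?q (a - b)))"
  proof (intro mult_left_mono sum_list_mono)
    fix a b
    show "?q 0 / 4 * (if p (a - b) < \<rho> then 1 else 0) \<le> ?q (a - b) * (1 / ?q 0 * ?q (a - b))"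
    proof (cases "p (a - b) < \<rho>")
      case True
      have "?q 0 / 2 \<le> ?q (a - b)" using autocorr_bump_diff_lip[of x "a - b"] True q(1) by simp
      then have "(?q 0 / 2) * (?q 0 / 2) \<le> ?q (a - b) * ?q (a - b)" using q(2) by (intro mult_mono) auto
      then show ?thesis using True q(2) by (simp add: field_simps)
    next
      case False
      then show ?thesis using q(2) by (simp add: zero_le_mult_iff)
    qed
  qed simp
  finally have *: "?q 0 / 4 * ?n\<^sup>2 \<le> real (card F) * (\<Sum>a\<leftarrow>xs. \<Sum>b\<leftarrow>xs. ?q (a - b) * (1 / ?q 0 * ?q (a - b)))" .
  have "Re (complex_of_real a * complex_of_real b) = a * b" for a b by simp
  then have "eval_sum (energy_pts (bump_diff x) xs) (\<lambda>z. complex_of_real (1 / ?q 0) * complex_of_real (?q z))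
    = (\<Sum>a\<leftarrow>xs. \<Sum>b\<leftarrow>xs. ?q (a - b) * (1 / ?q 0 * ?q (a - b))) / ?n\<^sup>2"
    unfolding eval_sum_energy_pts by (simp only:)
  moreover have "?q 0 / (4 * real (card F)) \<le> (\<Sum>a\<leftarrow>xs. \<Sum>b\<leftarrow>xs. ?q (a - b) * (1 / ?q 0 * ?q (a - b))) / ?n\<^sup>2"
  proof -
    have "?q 0 / (4 * real (card F)) * ?n\<^sup>2 \<le> (\<Sum>a\<leftarrow>xs. \<Sum>b\<leftarrow>xs. ?q (a - b) * (1 / ?q 0 * ?q (a - b)))"
      using * k by (simp add: field_simps)
    then show ?thesis using n by (simp add: pos_le_divide_eq)
  qed
  ultimately show ?thesis by (simp only:)
qed

text \<open>
The function \<open>bump * \<xi>\<close> has a mean, so along a suitable list its averages \<open>A\<close> are almost constant. Up to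
factors of modulus 1 the twisted average of \<open>bump_diff x\<close> is \<open>A (y + x) - \<xi> x * A y\<close>.
\<close>

lemma energy_bump_diff_upper_bound:
  assumes \<xi>: "character \<xi>" "clipschitz \<xi>" and e: "e > 0"
  shows "\<exists>xs. xs \<noteq> [] \<and> energy (bump_diff x) xs \<xi> \<le> (cmod (\<xi> x - 1) + e)\<^sup>2"
proof -
  define F where "F y = complex_of_real (bump y) * \<xi> y" for y
  have "clipschitz F" unfolding F_def by (intro lip_intros \<xi>)
  then have lF: "lipschitz (\<lambda>y. Re (F y))" "lipschitz (\<lambda>y. Im (F y))" by (auto simp: clipschitz_def)
  have "e / 8 > 0" using e by simp
  from has_mean_common[OF has_mean_mean[OF lF(1)] has_mean_mean[OF lF(2)] this]
  obtain xs r s where xs: "xs \<noteq> []" "\<And>y. \<bar>avg xs (\<lambda>y. Re (F y)) y - r\<bar> \<le> e / 8"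
    "\<And>y. \<bar>avg xs (\<lambda>y. Im (F y)) y - s\<bar> \<le> e / 8" by metis
  have n: "real (length xs) > 0" using xs(1) by simp
  define A where "A y = (\<Sum>z\<leftarrow>xs. F (y + z)) / of_nat (length xs)" for y
  have A: "Re (A y) = avg xs (\<lambda>y. Re (F y)) y" "Im (A y) = avg xs (\<lambda>y. Im (F y)) y" for y
    unfolding A_def avg_def Re_sum_list[symmetric] Im_sum_list[symmetric] by simp_all
  have osc: "cmod (A y - A y') \<le> e / 2" for y y'
  proof -
    have "\<bar>Re (A y - A y')\<bar> \<le> e / 4" "\<bar>Im (A y - A y')\<bar> \<le> e / 4"
      using xs(2)[of y] xs(2)[of y'] xs(3)[of y] xs(3)[of y'] unfolding minus_complex.sel A by linarith+
    then show ?thesis using cmod_le[of "A y - A y'"] by linarith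
  qed
  have bound: "cmod (A y) \<le> 1" for y
  proof -
    have "cmod (\<Sum>z\<leftarrow>xs. F (y + z)) \<le> (\<Sum>z\<leftarrow>xs. cmod (F (y + z)))"
      by (induction xs) (auto intro: norm_triangle_le)
    also have "\<dots> \<le> (\<Sum>z\<leftarrow>xs. 1)"
      using bump_bounds(1,2) by (intro sum_list_mono) (simp add: F_def norm_mult character_norm[OF \<xi>(1)])
    finally show ?thesis using n by (simp add: A_def norm_divide sum_list_triv)
  qed
  have "cmod (twisted_avg (bump_diff x) xs \<xi> y) \<le> cmod (\<xi> x - 1) + e" for y
  proof -
    have "\<xi> x * \<xi> y * twisted_avg (bump_diff x) xs \<xi> y
      = (\<Sum>z\<leftarrow>xs. F (y + x + z) - \<xi> x * F (y + z)) / of_nat (length xs)"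
      unfolding twisted_avg_def times_divide_eq_right sum_list_const_mult[symmetric]
      by (simp add: F_def bump_diff_def character_add[OF \<xi>(1)] algebra_simps)
    also have "\<dots> = A (y + x) - \<xi> x * A y"
      unfolding A_def by (simp add: sum_list_subtractf sum_list_const_mult diff_divide_distrib)
    also have "\<dots> = (A (y + x) - A y) - (\<xi> x - 1) * A y" by (simp add: algebra_simps)
    finally have "cmod (\<xi> x * \<xi> y * twisted_avg (bump_diff x) xs \<xi> y) \<le> cmod (A (y + x) - A y) + cmod ((\<xi> x - 1) * A y)"
      using norm_triangle_ineq4 by metis
    also have "\<dots> \<le> e / 2 + cmod (\<xi> x - 1) * 1"
      unfolding norm_mult by (intro add_mono osc mult_left_mono bound) simp
    finally show ?thesis using e by (simp add: norm_mult character_norm[OF \<xi>(1)])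
  qed
  then have "(cmod (twisted_avg (bump_diff x) xs \<xi> y))\<^sup>2 \<le> (cmod (\<xi> x - 1) + e)\<^sup>2" for y
    by (rule power_mono) simp
  then have "energy (bump_diff x) xs \<xi> \<le> mean (\<lambda>y::'a. (cmod (\<xi> x - 1) + e)\<^sup>2)"
    unfolding energy_def by (intro mean_mono lipschitz_norm_square clipschitz_twisted_avg lipschitz_bump_diff lipschitz_const)
  then show ?thesis using xs(1) by (auto simp: mean_const)
qed

text \<open>
The Peter-Weyl theorem in terms of a seminorm. If \<open>p x \<ge> 1\<close>, some character \<open>\<xi>\<close> has energies at least \<open>\<kappa>\<close>
with respect to \<open>bump_diff x\<close>, where \<open>\<kappa>\<close> only depends on covering numbers of \<open>p\<close>. The bound from below makes
\<open>\<xi>\<close> Lipschitz with a constant independent of \<open>x\<close>, so that \<open>\<xi>\<close> lies in a fixed finite set; comparison with the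
upper bound keeps \<open>\<xi> x\<close> away from 1.
\<close>

theorem unit_ball_contains_bohr_set:
  obtains \<Xi> \<delta> where "finite \<Xi>" "\<delta> > 0"
    "\<And>\<xi>. \<xi> \<in> \<Xi> \<Longrightarrow> character \<xi>" "\<And>\<xi>. \<xi> \<in> \<Xi> \<Longrightarrow> \<exists>C. \<forall>v. cmod (\<xi> v - 1) \<le> C * p v"
    "\<And>x. (\<And>\<xi>. \<xi> \<in> \<Xi> \<Longrightarrow> cmod (\<xi> x - 1) < \<delta>) \<Longrightarrow> p x < 1"
proof -
  obtain F1 where F1: "finite F1" "\<And>x. \<exists>y\<in>F1. p (x - y) < 1/4" using p_totally_bounded[of "1/4"] by auto
  have k1: "card F1 > 0" using F1 by (auto simp: card_gt_0_iff)
  \<comment> \<open>The constant \<open>c\<close> bounds the autocorrelations at 0 from below. They are Lipschitz with constant 2, so at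
    distance less than \<open>c / 4\<close> from 0 they keep half of their value.\<close>
  define c where "c = 1 / (4 * real (card F1))"
  have c: "c > 0" using k1 by (simp add: c_def)
  define \<rho> where "\<rho> = c / 4"
  have \<rho>: "\<rho> / 2 > 0" using c by (simp add: \<rho>_def)
  obtain F2 where F2: "finite F2" "\<And>x. \<exists>y\<in>F2. p (x - y) < \<rho> / 2" using p_totally_bounded[OF \<rho>] by auto
  have k2: "card F2 > 0" using F2 by (auto simp: card_gt_0_iff)
  define \<kappa> where "\<kappa> = c / (4 * real (card F2))"
  have \<kappa>: "\<kappa> > 0" using c k2 by (simp add: \<kappa>_def)
  \<comment> \<open>Any constant with \<open>C\<^sup>2 * \<kappa> \<ge> 8\<close> would do here, by \<open>character_lipschitz_of_energy\<close>.\<close>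
  define C where "C = 3 / sqrt \<kappa>"
  have C: "C > 0" using \<kappa> by (simp add: C_def)
  define \<Xi> where "\<Xi> = {\<xi>. character \<xi> \<and> (\<forall>v. cmod (\<xi> v - 1) \<le> C * p v)}"
  have fin: "finite \<Xi>"
  proof -
    obtain F where F: "finite F" "\<And>x. \<exists>y\<in>F. p (x - y) < 1 / (4 * C)"
      using p_totally_bounded[of "1 / (4 * C)"] C by auto
    have "finite (almost_trivial_on {w. p w < 1 / (4 * C)})"
      by (rule finite_almost_trivial_on[OF F(1)]) (use F(2) in auto)
    moreover have "\<Xi> \<subseteq> almost_trivial_on {w. p w < 1 / (4 * C)}"
    proof
      fix \<xi> assume \<xi>: "\<xi> \<in> \<Xi>"
      have "cmod (\<xi> w - 1) \<le> 1/4" if "p w < 1 / (4 * C)" for w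
      proof -
        have "cmod (\<xi> w - 1) \<le> C * p w" using \<xi> by (auto simp: \<Xi>_def)
        also have "\<dots> \<le> C * (1 / (4 * C))" using that C by (intro mult_left_mono) auto
        finally show ?thesis using C by simp
      qed
      then show "\<xi> \<in> almost_trivial_on {w. p w < 1 / (4 * C)}"
        using \<xi> by (auto simp: \<Xi>_def almost_trivial_on_def)
    qed
    ultimately show ?thesis by (rule rev_finite_subset)
  qed
  have sep: "\<exists>\<xi>\<in>\<Xi>. sqrt \<kappa> \<le> cmod (\<xi> x - 1)" if x: "1 \<le> p x" for x
  proof -
    let ?g = "bump_diff x"
    have q: "c \<le> autocorr ?g 0" using autocorr_bump_diff_pos[OF F1 x] by (simp add: c_def)
    have q0: "0 < autocorr ?g 0" using q c by simp
    have "\<kappa> \<le> eval_sum (energy_pts ?g xs) (\<lambda>z. complex_of_real (1 / autocorr ?g 0) * complex_of_real (autocorr ?g z))"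
      if "xs \<noteq> []" for xs
    proof -
      have "\<kappa> \<le> autocorr ?g 0 / (4 * real (card F2))" unfolding \<kappa>_def using q by (intro divide_right_mono) auto
      also have "\<dots> \<le> eval_sum (energy_pts ?g xs) (\<lambda>z. complex_of_real (1 / autocorr ?g 0) * complex_of_real (autocorr ?g z))"
        by (rule energy_form_lower_bound[OF F2 _ q0 that]) (use q in \<open>simp add: \<rho>_def\<close>)
      finally show ?thesis .
    qed
    from exists_character_with_energy[OF lipschitz_bump_diff state_autocorr[OF lipschitz_bump_diff q0] this]
    obtain \<xi> where \<xi>: "character \<xi>" "\<And>xs. xs \<noteq> [] \<Longrightarrow> \<kappa> \<le> energy ?g xs \<xi>" by blast
    have lip: "cmod (\<xi> v - 1) \<le> C * p v" for v
    proof -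
      have "(cmod (\<xi> v - 1))\<^sup>2 * \<kappa> \<le> 8 * (p v)\<^sup>2"
        by (rule character_lipschitz_of_energy[OF lipschitz_bump_diff bump_diff_lip \<xi>])
      also have "\<dots> \<le> 9 * (p v)\<^sup>2" by simp
      finally have "(cmod (\<xi> v - 1) * sqrt \<kappa>)\<^sup>2 \<le> (3 * p v)\<^sup>2"
        using \<kappa> by (simp add: power_mult_distrib)
      then have "cmod (\<xi> v - 1) * sqrt \<kappa> \<le> 3 * p v" by (rule power2_le_imp_le) (simp add: p_nonneg)
      then show ?thesis using \<kappa> by (simp add: C_def field_simps)
    qed
    have "\<xi> \<in> \<Xi>" using \<xi>(1) lip by (simp add: \<Xi>_def)
    moreover have "sqrt \<kappa> \<le> cmod (\<xi> x - 1)"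
    proof (rule field_le_epsilon)
      fix e :: real assume e: "e > 0"
      obtain xs where xs: "xs \<noteq> []" "energy ?g xs \<xi> \<le> (cmod (\<xi> x - 1) + e)\<^sup>2"
        using energy_bump_diff_upper_bound[OF \<xi>(1) clipschitz_character[OF \<xi>(1) lip less_imp_le[OF C]] e] by blast
      have "\<kappa> \<le> (cmod (\<xi> x - 1) + e)\<^sup>2" using \<xi>(2)[OF xs(1)] xs(2) by simp
      then show "sqrt \<kappa> \<le> cmod (\<xi> x - 1) + e"
        using e by (intro real_le_lsqrt) auto
    qed
    ultimately show ?thesis by blast
  qed
  show ?thesis
  proof (rule that[OF fin, of "sqrt \<kappa>"])
    show "p x < 1" if "\<And>\<xi>. \<xi> \<in> \<Xi> \<Longrightarrow> cmod (\<xi> x - 1) < sqrt \<kappa>" for x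
      using sep[of x] that by (meson not_le)
  qed (use \<kappa> in \<open>auto simp: \<Xi>_def\<close>)
qed

end

section \<open>Seminorms from chains of neighbourhoods\<close>

lemma split_list_by_weight:
  fixes w :: "'b \<Rightarrow> real"
  assumes "zs \<noteq> []" "0 \<le> t" "t \<le> (\<Sum>z\<leftarrow>zs. w z)" "\<And>z. 0 \<le> w z"
  shows "\<exists>as z bs. zs = as @ z # bs \<and> (\<Sum>z\<leftarrow>as. w z) \<le> t \<and> (\<Sum>z\<leftarrow>bs. w z) \<le> (\<Sum>z\<leftarrow>zs. w z) - t"
  using assms(1-3)
proof (induction zs arbitrary: t)
  case (Cons a zs)
  show ?case
  proof (cases "t \<le> w a")
    case True
    then show ?thesis using Cons.prems by (intro exI[of _ "[]"] exI[of _ a] exI[of _ zs]) auto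
  next
    case False
    then have "zs \<noteq> []" using Cons.prems by auto
    then have "\<exists>as z bs. zs = as @ z # bs \<and> (\<Sum>z\<leftarrow>as. w z) \<le> t - w a \<and>
        (\<Sum>z\<leftarrow>bs. w z) \<le> (\<Sum>z\<leftarrow>zs. w z) - (t - w a)"
      using Cons.prems False by (intro Cons.IH) auto
    then obtain as z bs where "zs = as @ z # bs" "(\<Sum>z\<leftarrow>as. w z) \<le> t - w a"
      "(\<Sum>z\<leftarrow>bs. w z) \<le> (\<Sum>z\<leftarrow>zs. w z) - (t - w a)" by blast
    then show ?thesis by (intro exI[of _ "a # as"] exI[of _ z] exI[of _ bs]) auto
  qed
qed auto

text \<open>
The hypotheses of the metrization lemma for uniform spaces in an abelian group. Starting with the whole group
ensures that every element has a decomposition in the sense below.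
\<close>

locale neighbourhood_chain =
  fixes V :: "nat \<Rightarrow> 'a::ab_group_add set"
  assumes V_0: "V 0 = UNIV"
    and zero_in_V: "0 \<in> V n"
    and V_minus: "x \<in> V n \<Longrightarrow> - x \<in> V n"
    and V_add3: "x \<in> V (Suc n) \<Longrightarrow> y \<in> V (Suc n) \<Longrightarrow> z \<in> V (Suc n) \<Longrightarrow> x + y + z \<in> V n"
begin

lemma V_antimono: "m \<le> n \<Longrightarrow> V n \<subseteq> V m"
proof (induction n rule: dec_induct)
  case (step n)
  have "V (Suc n) \<subseteq> V n" using V_add3[of _ n 0 0] zero_in_V by fastforce
  then show ?case using step by blast
qed auto

definition weight :: "(nat \<times> 'a) list \<Rightarrow> real" where
  "weight zs = (\<Sum>z\<leftarrow>zs. 2 * (1 / 2) ^ fst z)"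

definition rep :: "'a \<Rightarrow> (nat \<times> 'a) list set" where
  "rep x = {zs. (\<forall>z\<in>set zs. snd z \<in> V (fst z)) \<and> (\<Sum>z\<leftarrow>zs. snd z) = x}"

lemma weight_nonneg: "0 \<le> weight zs"
  unfolding weight_def by (rule sum_list_nonneg) auto

text \<open>
Cut the list where half of its weight is reached. Both parts lie in \<open>V (Suc m)\<close> by induction, and so does the
element at the cut, because its own weight forces its index to be larger than \<open>m\<close>.
\<close>

lemma rep_small: "zs \<in> rep x \<Longrightarrow> weight zs < 2 * (1 / 2) ^ m \<Longrightarrow> x \<in> V m"
proof (induction "length zs" arbitrary: zs x m rule: less_induct)
  case less
  show ?case
  proof (cases "zs = []")
    case True
    then show ?thesis using less.prems zero_in_V by (auto simp: rep_def)
  next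
    case False
    let ?w = "\<lambda>z :: nat \<times> 'a. 2 * (1 / 2 :: real) ^ fst z"
    have "0 \<le> weight zs / 2" "weight zs / 2 \<le> (\<Sum>z\<leftarrow>zs. ?w z)"
      using weight_nonneg[of zs] by (auto simp: weight_def)
    from split_list_by_weight[OF False this]
    obtain as z bs where zs: "zs = as @ z # bs" and as: "weight as \<le> weight zs / 2"
      and bs: "weight bs \<le> weight zs / 2" unfolding weight_def by auto
    have half: "weight zs / 2 < 2 * (1 / 2) ^ Suc m" using less.prems(2) by simp
    have A: "(\<Sum>z\<leftarrow>as. snd z) \<in> V (Suc m)"
      by (rule less.hyps[of as]) (use zs as half less.prems(1) in \<open>auto simp: rep_def\<close>)
    have B: "(\<Sum>z\<leftarrow>bs. snd z) \<in> V (Suc m)"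
      by (rule less.hyps[of bs]) (use zs bs half less.prems(1) in \<open>auto simp: rep_def\<close>)
    have "?w z \<le> weight zs"
      using weight_nonneg[of as] weight_nonneg[of bs] by (simp add: zs weight_def)
    then have "(1 / 2 :: real) ^ fst z < (1 / 2) ^ m" using less.prems(2) by linarith
    then have "m < fst z" using power_decreasing[of "fst z" m "1 / 2 :: real"] by (cases "m < fst z") auto
    then have Z: "snd z \<in> V (Suc m)"
      using V_antimono[of "Suc m" "fst z"] zs less.prems(1) by (auto simp: rep_def)
    have "x = (\<Sum>z\<leftarrow>as. snd z) + snd z + (\<Sum>z\<leftarrow>bs. snd z)"
      using less.prems(1) zs by (simp add: rep_def add.assoc)
    then show ?thesis using V_add3[OF A Z B] by simp
  qed
qed

definition chain_norm :: "'a \<Rightarrow> real" where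
  "chain_norm x = Inf (weight ` rep x)"

lemma bdd_weight: "bdd_below (weight ` S)"
  using weight_nonneg by (auto intro!: bdd_belowI)

lemma chain_norm_le: "zs \<in> rep x \<Longrightarrow> chain_norm x \<le> weight zs"
  unfolding chain_norm_def by (rule cINF_lower[OF bdd_weight])

lemma single_rep: "x \<in> V n \<Longrightarrow> [(n, x)] \<in> rep x"
  by (simp add: rep_def)

lemma chain_norm_approx:
  assumes "chain_norm x < r" obtains zs where "zs \<in> rep x" "weight zs < r"
proof -
  have "weight ` rep x \<noteq> {}" using single_rep[of x 0] V_0 by auto
  from cInf_lessD[OF this] assms show ?thesis using that by (auto simp: chain_norm_def)
qed

lemma chain_norm_nonneg: "0 \<le> chain_norm x"
  using chain_norm_approx[of x 0] weight_nonneg by (meson not_le)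

lemma chain_norm_on_V: "x \<in> V n \<Longrightarrow> chain_norm x \<le> 2 * (1 / 2) ^ n"
  using chain_norm_le[OF single_rep] by (simp add: weight_def)

lemma chain_norm_0: "chain_norm 0 = 0"
  using chain_norm_le[of "[]" 0] chain_norm_nonneg[of 0] by (simp add: rep_def weight_def)

lemma chain_norm_triangle: "chain_norm (x + y) \<le> chain_norm x + chain_norm y"
proof (rule field_le_epsilon)
  fix e :: real assume e: "e > 0"
  obtain zs where zs: "zs \<in> rep x" "weight zs < chain_norm x + e / 2"
    by (rule chain_norm_approx[of x "chain_norm x + e / 2"]) (use e in auto)
  obtain ys where ys: "ys \<in> rep y" "weight ys < chain_norm y + e / 2"
    by (rule chain_norm_approx[of y "chain_norm y + e / 2"]) (use e in auto)
  have "zs @ ys \<in> rep (x + y)" using zs ys by (auto simp: rep_def)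
  then show "chain_norm (x + y) \<le> chain_norm x + chain_norm y + e"
    using chain_norm_le[of "zs @ ys" "x + y"] zs(2) ys(2) by (simp add: weight_def)
qed

lemma chain_norm_minus_le: "chain_norm (- x) \<le> chain_norm x"
proof (rule field_le_epsilon)
  fix e :: real assume e: "e > 0"
  obtain zs where zs: "zs \<in> rep x" "weight zs < chain_norm x + e"
    by (rule chain_norm_approx[of x "chain_norm x + e"]) (use e in auto)
  have "(\<Sum>z\<leftarrow>zs. - snd z) = - (\<Sum>z\<leftarrow>zs. snd z)" by (induction zs) auto
  then have "map (\<lambda>z. (fst z, - snd z)) zs \<in> rep (- x)"
    using zs(1) V_minus by (auto simp: rep_def o_def)
  from chain_norm_le[OF this] zs(2) show "chain_norm (- x) \<le> chain_norm x + e" by (simp add: weight_def o_def)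
qed

lemma chain_norm_minus: "chain_norm (- x) = chain_norm x"
  using chain_norm_minus_le[of x] chain_norm_minus_le[of "- x"] by simp

lemma chain_norm_less_1: "chain_norm x < 1 \<Longrightarrow> x \<in> V 1"
  by (erule chain_norm_approx) (rule rep_small, auto)

end

section \<open>Neighbourhoods of zero in precompact groups\<close>

lemma group_topology_openin_UNIV: "group_topology \<tau> \<Longrightarrow> openin \<tau> UNIV"
  by (metis group_topology_def openin_topspace)

lemma group_topology_preimage_add:
  assumes "group_topology \<tau>" "openin \<tau> U" "x + y \<in> U"
  obtains A B where "openin \<tau> A" "openin \<tau> B" "x \<in> A" "y \<in> B" "\<And>a b. a \<in> A \<Longrightarrow> b \<in> B \<Longrightarrow> a + b \<in> U"
proof -
  have o: "openin (prod_topology \<tau> \<tau>) {z \<in> topspace (prod_topology \<tau> \<tau>). (case z of (x, y) \<Rightarrow> x + y) \<in> U}"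
    using assms by (intro openin_continuous_map_preimage) (auto simp: group_topology_def)
  have i: "(x, y) \<in> {z \<in> topspace (prod_topology \<tau> \<tau>). (case z of (x, y) \<Rightarrow> x + y) \<in> U}"
    using assms by (auto simp: group_topology_def)
  from o[unfolded openin_prod_topology_alt, rule_format, OF i]
  obtain A B where "openin \<tau> A" "openin \<tau> B" "x \<in> A" "y \<in> B"
    "A \<times> B \<subseteq> {z \<in> topspace (prod_topology \<tau> \<tau>). (case z of (x, y) \<Rightarrow> x + y) \<in> U}" by blast
  moreover from this(5) have "a + b \<in> U" if "a \<in> A" "b \<in> B" for a b using that by auto
  ultimately show ?thesis using that by metis
qed

lemma group_topology_openin_minus:
  assumes "group_topology \<tau>" "openin \<tau> U" shows "openin \<tau> {x. - x \<in> U}"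
proof -
  have "openin \<tau> {x \<in> topspace \<tau>. - x \<in> U}"
    using assms by (intro openin_continuous_map_preimage) (auto simp: group_topology_def)
  then show ?thesis using assms(1) by (simp add: group_topology_def)
qed

lemma group_topology_openin_translate:
  assumes "group_topology \<tau>" "openin \<tau> U" shows "openin \<tau> {x. x + a \<in> U}"
proof (subst openin_subopen, safe)
  fix x assume "x + a \<in> U"
  then obtain A B where "openin \<tau> A" "openin \<tau> B" "x \<in> A" "a \<in> B" "\<And>a b. a \<in> A \<Longrightarrow> b \<in> B \<Longrightarrow> a + b \<in> U"
    using group_topology_preimage_add[OF assms] by metis
  then show "\<exists>T. openin \<tau> T \<and> x \<in> T \<and> T \<subseteq> {x. x + a \<in> U}" by blast
qed

lemma group_topology_openinI:
  assumes "group_topology \<tau>" "\<And>x. x \<in> U \<Longrightarrow> \<exists>V. openin \<tau> V \<and> 0 \<in> V \<and> (\<forall>v\<in>V. v + x \<in> U)"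
  shows "openin \<tau> U"
proof (subst openin_subopen, safe)
  fix x assume "x \<in> U"
  from assms(2)[OF this] obtain V where V: "openin \<tau> V" "0 \<in> V" "\<And>v. v \<in> V \<Longrightarrow> v + x \<in> U" by blast
  have "y \<in> U" if "y + (- x) \<in> V" for y using V(3)[OF that] by simp
  then show "\<exists>T. openin \<tau> T \<and> x \<in> T \<and> T \<subseteq> U"
    using V(2) group_topology_openin_translate[OF assms(1) V(1), of "- x"]
    by (intro exI[of _ "{y. y + (- x) \<in> V}"]) auto
qed

lemma symmetric_neighbourhood:
  assumes \<tau>: "group_topology \<tau>" and U: "openin \<tau> U" "0 \<in> U"
  obtains V where "openin \<tau> V" "0 \<in> V" "\<And>x. x \<in> V \<Longrightarrow> - x \<in> V"
    "\<And>x y z. x \<in> V \<Longrightarrow> y \<in> V \<Longrightarrow> z \<in> V \<Longrightarrow> x + y + z \<in> U"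
proof -
  obtain A B where AB: "openin \<tau> A" "openin \<tau> B" "0 \<in> A" "0 \<in> B" "\<And>a b. a \<in> A \<Longrightarrow> b \<in> B \<Longrightarrow> a + b \<in> U"
    using group_topology_preimage_add[OF \<tau> U(1), of 0 0] U(2) by auto
  obtain C D where CD: "openin \<tau> C" "openin \<tau> D" "0 \<in> C" "0 \<in> D" "\<And>a b. a \<in> C \<Longrightarrow> b \<in> D \<Longrightarrow> a + b \<in> A"
    using group_topology_preimage_add[OF \<tau> AB(1), of 0 0] AB(3) by auto
  define N where "N = B \<inter> C \<inter> D"
  have N: "openin \<tau> N" "0 \<in> N" using AB CD by (auto simp: N_def)
  show ?thesis
  proof (rule that[of "N \<inter> {x. - x \<in> N}"])
    show "openin \<tau> (N \<inter> {x. - x \<in> N})"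
      using N group_topology_openin_minus[OF \<tau>] by blast
  qed (use N AB(5) CD(5) in \<open>auto simp: N_def\<close>)
qed

lemma precompact_finite_cover:
  assumes "precompact_topology \<tau>" "openin \<tau> U" "0 \<in> U"
  obtains F where "finite F" "\<And>x. \<exists>y\<in>F. x - y \<in> U"
proof -
  obtain F where F: "finite F" "F + U = UNIV"
    using assms unfolding precompact_topology_def by blast
  have "\<exists>y\<in>F. x - y \<in> U" for x
  proof -
    have "x \<in> F + U" using F by simp
    then obtain y u where "x = y + u" "y \<in> F" "u \<in> U" by (auto elim: set_plus_elim)
    then show ?thesis by (intro bexI[of _ y]) auto
  qed
  then show ?thesis using that F(1) by blast
qed

lemma chain_below:
  assumes \<tau>: "group_topology \<tau>" and U: "openin \<tau> U" "0 \<in> U"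
  obtains V where "neighbourhood_chain V" "\<And>n. openin \<tau> (V n)" "V 1 \<subseteq> U"
proof -
  define P where "P n V \<longleftrightarrow> openin \<tau> V \<and> 0 \<in> V \<and> (\<forall>x\<in>V. - x \<in> V) \<and> (n = 0 \<longrightarrow> V = UNIV) \<and> (n \<noteq> 0 \<longrightarrow> V \<subseteq> U)"
    for n :: nat and V
  define Q where "Q V V' \<longleftrightarrow> (\<forall>x\<in>V'. \<forall>y\<in>V'. \<forall>z\<in>V'. x + y + z \<in> V)" for V V' :: "'a set"
  have "\<exists>V. \<forall>n. P n (V n) \<and> Q (V n) (V (Suc n))"
  proof (rule dependent_nat_choice)
    show "\<exists>V. P 0 V" using group_topology_openin_UNIV[OF \<tau>] by (auto simp: P_def)
  next
    fix V and n :: nat assume "P n V"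
    then have VU: "openin \<tau> (V \<inter> U)" "0 \<in> V \<inter> U" using U by (auto simp: P_def)
    obtain V' where V': "openin \<tau> V'" "0 \<in> V'" "\<And>x. x \<in> V' \<Longrightarrow> - x \<in> V'"
      "\<And>x y z. x \<in> V' \<Longrightarrow> y \<in> V' \<Longrightarrow> z \<in> V' \<Longrightarrow> x + y + z \<in> V \<inter> U"
      by (rule symmetric_neighbourhood[OF \<tau> VU]) blast
    have "x \<in> U" if "x \<in> V'" for x using V'(4)[OF that V'(2) V'(2)] by simp
    then show "\<exists>V'. P (Suc n) V' \<and> Q V V'" using V' by (intro exI[of _ V']) (auto simp: P_def Q_def)
  qed
  then obtain V where V: "\<And>n. P n (V n)" "\<And>n. Q (V n) (V (Suc n))" by blast
  have "neighbourhood_chain V"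
    by unfold_locales (use V in \<open>auto simp: P_def Q_def\<close>)
  moreover have "V 1 \<subseteq> U" using V(1)[of 1] by (simp add: P_def)
  ultimately show ?thesis using that V(1) by (auto simp: P_def)
qed

text \<open>
Continuity at 0, which for a homomorphism on a topological group is continuity.
\<close>

definition continuous_character :: "'a::ab_group_add topology \<Rightarrow> ('a \<Rightarrow> complex) \<Rightarrow> bool" where
  "continuous_character \<tau> \<xi> \<longleftrightarrow> character \<xi> \<and>
     (\<forall>e>0. \<exists>W. openin \<tau> W \<and> 0 \<in> W \<and> (\<forall>w\<in>W. cmod (\<xi> w - 1) < e))"

text \<open>
A precompact topology is generated by its continuous characters: the seminorm of a chain below \<open>U\<close> is totally
bounded, so the corresponding statement about seminorms applies.
\<close>

theorem precompact_bohr_neighbourhood: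
  assumes \<tau>: "precompact_topology \<tau>" and U: "openin \<tau> U" "0 \<in> U"
  obtains \<Xi> \<delta> where "finite \<Xi>" "\<delta> > 0" "\<And>\<xi>. \<xi> \<in> \<Xi> \<Longrightarrow> continuous_character \<tau> \<xi>"
    "\<And>x. (\<And>\<xi>. \<xi> \<in> \<Xi> \<Longrightarrow> cmod (\<xi> x - 1) < \<delta>) \<Longrightarrow> x \<in> U"
proof -
  have gt: "group_topology \<tau>" using \<tau> by (simp add: precompact_topology_def)
  obtain V where V: "neighbourhood_chain V" "\<And>n. openin \<tau> (V n)" "V 1 \<subseteq> U" by (rule chain_below[OF gt U]) blast
  interpret neighbourhood_chain V by (rule V)
  have small: "\<exists>n. \<forall>x\<in>V n. chain_norm x < e" if e: "e > 0" for e
  proof -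
    obtain n where n: "(1 / 2 :: real) ^ n < e / 2" using real_arch_pow_inv[of "e / 2" "1 / 2"] e by auto
    have "chain_norm x < e" if "x \<in> V n" for x using chain_norm_on_V[OF that] n by linarith
    then show ?thesis by blast
  qed
  interpret totally_bounded_seminorm chain_norm
  proof
    fix e :: real assume "0 < e"
    then obtain n where n: "\<And>x. x \<in> V n \<Longrightarrow> chain_norm x < e" using small by blast
    obtain F where "finite F" "\<And>x. \<exists>y\<in>F. x - y \<in> V n"
      by (rule precompact_finite_cover[OF \<tau> V(2) zero_in_V]) blast
    then show "\<exists>F. finite F \<and> (\<forall>x. \<exists>y\<in>F. chain_norm (x - y) < e)" using n by blast
  qed (rule chain_norm_0 chain_norm_minus chain_norm_triangle)+
  obtain \<Xi> \<delta> where \<Xi>: "finite \<Xi>" "\<delta> > 0" "\<And>\<xi>. \<xi> \<in> \<Xi> \<Longrightarrow> character \<xi>"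
    "\<And>\<xi>. \<xi> \<in> \<Xi> \<Longrightarrow> \<exists>C. \<forall>v. cmod (\<xi> v - 1) \<le> C * chain_norm v"
    "\<And>x. (\<And>\<xi>. \<xi> \<in> \<Xi> \<Longrightarrow> cmod (\<xi> x - 1) < \<delta>) \<Longrightarrow> chain_norm x < 1"
    by (rule unit_ball_contains_bohr_set) blast
  have "continuous_character \<tau> \<xi>" if mem: "\<xi> \<in> \<Xi>" for \<xi>
    unfolding continuous_character_def
  proof (intro conjI allI impI)
    show "character \<xi>" using \<Xi> that by blast
    fix e :: real assume e: "e > 0"
    obtain C where C: "\<And>v. cmod (\<xi> v - 1) \<le> C * chain_norm v" using \<Xi>(4)[OF mem] by blast
    have "e / (\<bar>C\<bar> + 1) > 0" using e by simp
    then obtain n where n: "\<And>x. x \<in> V n \<Longrightarrow> chain_norm x < e / (\<bar>C\<bar> + 1)" using small by blast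
    have "cmod (\<xi> w - 1) < e" if "w \<in> V n" for w
    proof -
      have "cmod (\<xi> w - 1) \<le> C * chain_norm w" by (rule C)
      also have "\<dots> \<le> (\<bar>C\<bar> + 1) * chain_norm w" using chain_norm_nonneg[of w] by (intro mult_right_mono) auto
      also have "\<dots> < e" using n[OF that] by (simp add: field_simps)
      finally show ?thesis .
    qed
    then show "\<exists>W. openin \<tau> W \<and> 0 \<in> W \<and> (\<forall>w\<in>W. cmod (\<xi> w - 1) < e)"
      using V(2) zero_in_V by blast
  qed
  then show ?thesis using that[of \<Xi> \<delta>] \<Xi> chain_norm_less_1 V(3) by blast
qed

text \<open>
If \<open>V + V \<subseteq> W\<close>, then doubling shows that a character is closer to 1 on \<open>V\<close> than on \<open>W\<close> by a factor \<open>2/3\<close>.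
\<close>

lemma continuous_characterI:
  assumes \<tau>: "group_topology \<tau>" and W: "openin \<tau> W" "0 \<in> W" and \<xi>: "\<xi> \<in> almost_trivial_on W"
  shows "continuous_character \<tau> \<xi>"
proof -
  have ch: "character \<xi>" using \<xi> by (simp add: almost_trivial_on_def)
  have "\<exists>W. openin \<tau> W \<and> 0 \<in> W \<and> (\<forall>w\<in>W. cmod (\<xi> w - 1) \<le> (2/3) ^ k)" for k
  proof (induction k)
    case 0
    show ?case using W \<xi> by (intro exI[of _ W]) (auto simp: almost_trivial_on_def intro: order_trans)
  next
    case (Suc k)
    then obtain W' where W': "openin \<tau> W'" "0 \<in> W'" "\<And>w. w \<in> W' \<Longrightarrow> cmod (\<xi> w - 1) \<le> (2/3) ^ k" by blast
    obtain V where V: "openin \<tau> V" "0 \<in> V" "\<And>x y z. x \<in> V \<Longrightarrow> y \<in> V \<Longrightarrow> z \<in> V \<Longrightarrow> x + y + z \<in> W'"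
      by (rule symmetric_neighbourhood[OF \<tau> W'(1,2)]) blast
    have "cmod (\<xi> v - 1) \<le> (2/3) ^ Suc k" if "v \<in> V" for v
    proof -
      have "v \<in> W'" "v + v \<in> W'" using V(3)[OF that V(2) V(2)] V(3)[OF that that V(2)] by auto
      then have "cmod (\<xi> v - 1) \<le> (2/3) ^ k" "cmod (\<xi> (v + v) - 1) \<le> (2/3) ^ k" using W'(3) by auto
      moreover have "(2/3 :: real) ^ k \<le> 1" by (simp add: power_le_one)
      ultimately have "3 / 2 * cmod (\<xi> v - 1) \<le> (2/3) ^ k"
        using norm_double_expands[OF ch, of v] by linarith
      then show ?thesis by simp
    qed
    then show ?case using V by blast
  qed
  moreover have "\<exists>k. (2/3 :: real) ^ k < e" if "e > 0" for e
    using real_arch_pow_inv[OF that, of "2/3"] by auto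
  ultimately show ?thesis unfolding continuous_character_def using ch by (meson le_less_trans)
qed

section \<open>Adjoining a character to a precompact topology\<close>

text \<open>
The join of \<open>\<tau>\<close> with the initial topology of \<open>\<xi>\<close>, written in terms of basic neighbourhoods.
\<close>

definition adjoin_char :: "'a::ab_group_add topology \<Rightarrow> ('a \<Rightarrow> complex) \<Rightarrow> 'a topology" where
  "adjoin_char \<tau> \<xi> = topology (\<lambda>S. \<forall>x\<in>S. \<exists>V e. openin \<tau> V \<and> x \<in> V \<and> 0 < e \<and>
     (\<forall>y\<in>V. cmod (\<xi> y - \<xi> x) < e \<longrightarrow> y \<in> S))"

lemma openin_adjoin_char:
  "openin (adjoin_char \<tau> \<xi>) S \<longleftrightarrow> (\<forall>x\<in>S. \<exists>V e. openin \<tau> V \<and> x \<in> V \<and> 0 < e \<and>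
     (\<forall>y\<in>V. cmod (\<xi> y - \<xi> x) < e \<longrightarrow> y \<in> S))" (is "_ = ?P S")
proof -
  have "istopology ?P"
    unfolding istopology_def
  proof (intro conjI allI impI)
    fix S T assume S: "?P S" and T: "?P T"
    show "?P (S \<inter> T)"
    proof
      fix x assume x: "x \<in> S \<inter> T"
      obtain V e where V: "openin \<tau> V" "x \<in> V" "0 < e" "\<forall>y\<in>V. cmod (\<xi> y - \<xi> x) < e \<longrightarrow> y \<in> S"
        using S x by blast
      obtain W d where W: "openin \<tau> W" "x \<in> W" "0 < d" "\<forall>y\<in>W. cmod (\<xi> y - \<xi> x) < d \<longrightarrow> y \<in> T"
        using T x by blast
      show "\<exists>V e. openin \<tau> V \<and> x \<in> V \<and> 0 < e \<and> (\<forall>y\<in>V. cmod (\<xi> y - \<xi> x) < e \<longrightarrow> y \<in> S \<inter> T)"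
        by (rule exI[of _ "V \<inter> W"], rule exI[of _ "min e d"]) (use V W in auto)
    qed
  next
    fix K assume K: "\<forall>S\<in>K. ?P S"
    show "?P (\<Union>K)"
    proof
      fix x assume "x \<in> \<Union>K"
      then obtain S where S: "S \<in> K" "x \<in> S" by blast
      from K[rule_format, OF S] obtain V e
        where "openin \<tau> V" "x \<in> V" "0 < e" "\<forall>y\<in>V. cmod (\<xi> y - \<xi> x) < e \<longrightarrow> y \<in> S" by blast
      then show "\<exists>V e. openin \<tau> V \<and> x \<in> V \<and> 0 < e \<and> (\<forall>y\<in>V. cmod (\<xi> y - \<xi> x) < e \<longrightarrow> y \<in> \<Union>K)"
        using S(1) by blast
    qed
  qed
  from topology_inverse'[OF this] show ?thesis unfolding adjoin_char_def by (rule fun_cong)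
qed

lemma openin_adjoin_char_mono: "openin \<tau> S \<Longrightarrow> openin (adjoin_char \<tau> \<xi>) S"
  unfolding openin_adjoin_char by (intro ballI exI[of _ S] exI[of _ 1]) auto

lemma openin_adjoin_char_cell:
  assumes "openin \<tau> V" shows "openin (adjoin_char \<tau> \<xi>) {y \<in> V. cmod (\<xi> y - z) < e}"
  unfolding openin_adjoin_char
proof
  fix x assume x: "x \<in> {y \<in> V. cmod (\<xi> y - z) < e}"
  have "y \<in> {y \<in> V. cmod (\<xi> y - z) < e}" if "y \<in> V" "cmod (\<xi> y - \<xi> x) < e - cmod (\<xi> x - z)" for y
    using that norm_triangle_ineq[of "\<xi> y - \<xi> x" "\<xi> x - z"] by auto
  then show "\<exists>W d. openin \<tau> W \<and> x \<in> W \<and> 0 < d \<and> (\<forall>y\<in>W. cmod (\<xi> y - \<xi> x) < d \<longrightarrow> y \<in> {y \<in> V. cmod (\<xi> y - z) < e})"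
    using x assms by (intro exI[of _ V] exI[of _ "e - cmod (\<xi> x - z)"]) auto
qed

lemma group_topology_adjoin_char:
  assumes \<tau>: "group_topology \<tau>" and \<xi>: "character \<xi>"
  shows "group_topology (adjoin_char \<tau> \<xi>)"
proof -
  let ?\<sigma> = "adjoin_char \<tau> \<xi>"
  have top: "topspace ?\<sigma> = UNIV"
    using openin_adjoin_char_mono[OF group_topology_openin_UNIV[OF \<tau>], of \<xi>] openin_subset by blast
  have add: "continuous_map (prod_topology ?\<sigma> ?\<sigma>) ?\<sigma> (\<lambda>(x, y). x + y)"
    unfolding continuous_map
  proof (intro conjI allI impI)
    fix S assume S: "openin ?\<sigma> S"
    show "openin (prod_topology ?\<sigma> ?\<sigma>) {z \<in> topspace (prod_topology ?\<sigma> ?\<sigma>). (case z of (x, y) \<Rightarrow> x + y) \<in> S}"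
      unfolding openin_prod_topology_alt
    proof (intro allI impI)
      fix x y assume "(x, y) \<in> {z \<in> topspace (prod_topology ?\<sigma> ?\<sigma>). (case z of (x, y) \<Rightarrow> x + y) \<in> S}"
      then have "x + y \<in> S" by simp
      from S[unfolded openin_adjoin_char, rule_format, OF this]
      obtain V e where V: "openin \<tau> V" "x + y \<in> V" "0 < e"
        "\<And>z. z \<in> V \<Longrightarrow> cmod (\<xi> z - \<xi> (x + y)) < e \<Longrightarrow> z \<in> S" by blast
      obtain A B where AB: "openin \<tau> A" "openin \<tau> B" "x \<in> A" "y \<in> B" "\<And>a b. a \<in> A \<Longrightarrow> b \<in> B \<Longrightarrow> a + b \<in> V"
        by (rule group_topology_preimage_add[OF \<tau> V(1,2)]) blast
      let ?A = "{a \<in> A. cmod (\<xi> a - \<xi> x) < e / 2}" and ?B = "{b \<in> B. cmod (\<xi> b - \<xi> y) < e / 2}"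
      have "a + b \<in> S" if a: "a \<in> ?A" and b: "b \<in> ?B" for a b
      proof (rule V(4))
        show "a + b \<in> V" using AB(5) a b by simp
        have "\<xi> (a + b) - \<xi> (x + y) = (\<xi> a - \<xi> x) * \<xi> b + \<xi> x * (\<xi> b - \<xi> y)"
          by (simp add: character_add[OF \<xi>] algebra_simps)
        then have "cmod (\<xi> (a + b) - \<xi> (x + y)) \<le> cmod (\<xi> a - \<xi> x) + cmod (\<xi> b - \<xi> y)"
          using norm_triangle_ineq[of "(\<xi> a - \<xi> x) * \<xi> b" "\<xi> x * (\<xi> b - \<xi> y)"]
          by (simp add: norm_mult character_norm[OF \<xi>])
        then show "cmod (\<xi> (a + b) - \<xi> (x + y)) < e" using a b by simp
      qed
      then have "?A \<times> ?B \<subseteq> {z \<in> topspace (prod_topology ?\<sigma> ?\<sigma>). (case z of (x, y) \<Rightarrow> x + y) \<in> S}"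
        by (auto simp: top)
      then show "\<exists>U V. openin ?\<sigma> U \<and> openin ?\<sigma> V \<and> x \<in> U \<and> y \<in> V \<and>
          U \<times> V \<subseteq> {z \<in> topspace (prod_topology ?\<sigma> ?\<sigma>). (case z of (x, y) \<Rightarrow> x + y) \<in> S}"
        using V(3) AB by (intro exI[of _ ?A] exI[of _ ?B] conjI openin_adjoin_char_cell) auto
    qed
  qed (auto simp: top)
  have minus: "continuous_map ?\<sigma> ?\<sigma> uminus"
    unfolding continuous_map
  proof (intro conjI allI impI)
    fix S assume S: "openin ?\<sigma> S"
    show "openin ?\<sigma> {x \<in> topspace ?\<sigma>. - x \<in> S}"
      unfolding openin_adjoin_char
    proof
      fix x assume "x \<in> {x \<in> topspace ?\<sigma>. - x \<in> S}"
      then have "- x \<in> S" by simp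
      from S[unfolded openin_adjoin_char, rule_format, OF this]
      obtain V e where V: "openin \<tau> V" "- x \<in> V" "0 < e"
        "\<And>z. z \<in> V \<Longrightarrow> cmod (\<xi> z - \<xi> (- x)) < e \<Longrightarrow> z \<in> S" by blast
      have "- y \<in> S" if "- y \<in> V" "cmod (\<xi> y - \<xi> x) < e" for y
      proof (rule V(4)[OF that(1)])
        have "cmod (\<xi> (- y) - \<xi> (- x)) = cmod (cnj (\<xi> y - \<xi> x))" by (simp add: character_minus[OF \<xi>])
        then show "cmod (\<xi> (- y) - \<xi> (- x)) < e" using that(2) by (simp only: complex_mod_cnj)
      qed
      then show "\<exists>W d. openin \<tau> W \<and> x \<in> W \<and> 0 < d \<and>
          (\<forall>y\<in>W. cmod (\<xi> y - \<xi> x) < d \<longrightarrow> y \<in> {x \<in> topspace ?\<sigma>. - x \<in> S})"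
        using V group_topology_openin_minus[OF \<tau> V(1)]
        by (intro exI[of _ "{y. - y \<in> V}"] exI[of _ e]) (auto simp: top)
    qed
  qed (auto simp: top)
  have "Hausdorff_space \<tau>" "topspace \<tau> = UNIV" using \<tau> by (auto simp: group_topology_def)
  then have "Hausdorff_space ?\<sigma>"
    unfolding Hausdorff_space_def top using openin_adjoin_char_mono[of \<tau> _ \<xi>] by metis
  then show ?thesis using top add minus by (simp add: group_topology_def)
qed

text \<open>
Sort the points into finitely many cells, according to a nearby point of a \<open>\<tau>\<close>-net of the group and a nearby
point of a net of the disc. Two points of one cell differ by an element of the given neighbourhood, so one
representative of every non-empty cell suffices.
\<close>

lemma precompact_adjoin_char:
  assumes \<tau>: "precompact_topology \<tau>" and \<xi>: "character \<xi>"
  shows "precompact_topology (adjoin_char \<tau> \<xi>)"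
  unfolding precompact_topology_def
proof (intro conjI allI impI)
  let ?\<sigma> = "adjoin_char \<tau> \<xi>"
  have gt: "group_topology \<tau>" using \<tau> by (simp add: precompact_topology_def)
  show "group_topology ?\<sigma>" by (rule group_topology_adjoin_char[OF gt \<xi>])
  fix U assume "\<exists>V. openin ?\<sigma> V \<and> 0 \<in> V \<and> V \<subseteq> U"
  then obtain S where S: "openin ?\<sigma> S" "0 \<in> S" "S \<subseteq> U" by blast
  from S(1)[unfolded openin_adjoin_char, rule_format, OF S(2)]
  obtain V e where V: "openin \<tau> V" "0 \<in> V" "0 < e" "\<And>z. z \<in> V \<Longrightarrow> cmod (\<xi> z - \<xi> 0) < e \<Longrightarrow> z \<in> S" by blast
  obtain N where N: "openin \<tau> N" "0 \<in> N" "\<And>x. x \<in> N \<Longrightarrow> - x \<in> N"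
    "\<And>x y z. x \<in> N \<Longrightarrow> y \<in> N \<Longrightarrow> z \<in> N \<Longrightarrow> x + y + z \<in> V"
    by (rule symmetric_neighbourhood[OF gt V(1,2)]) blast
  obtain F where F: "finite F" "\<And>x. \<exists>y\<in>F. x - y \<in> N"
    by (rule precompact_finite_cover[OF \<tau> N(1,2)]) blast
  have "e / 2 > 0" using V(3) by simp
  then have "\<exists>T. finite T \<and> cball (0::complex) 1 \<subseteq> (\<Union>x\<in>T. ball x (e / 2))"
    using compact_cball[of "0::complex" 1] unfolding compact_eq_totally_bounded by blast
  then obtain T where T: "finite T" "cball (0::complex) 1 \<subseteq> (\<Union>x\<in>T. ball x (e / 2))" by blast
  define cell where "cell y t = {x. x - y \<in> N \<and> cmod (\<xi> x - t) < e / 2}" for y t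
  define r where "r y t = (SOME x. x \<in> cell y t)" for y t
  define E where "E = (\<lambda>(y, t). r y t) ` (F \<times> T)"
  have "x \<in> E + U" for x
  proof -
    obtain y where y: "y \<in> F" "x - y \<in> N" using F(2) by blast
    have "\<xi> x \<in> cball 0 1" by (simp add: character_norm[OF \<xi>])
    then obtain t where t: "t \<in> T" "\<xi> x \<in> ball t (e / 2)" using T(2) by blast
    have "x \<in> cell y t" using y t by (simp add: cell_def dist_norm norm_minus_commute)
    then have rc: "r y t \<in> cell y t" unfolding r_def by (rule someI)
    let ?d = "x - r y t"
    have "(x - y) + (- (r y t - y)) + 0 \<in> V"
      by (intro N y) (use rc N in \<open>auto simp: cell_def\<close>)
    then have dV: "?d \<in> V" by simp
    have "cmod (\<xi> ?d - \<xi> 0) = cmod (\<xi> x - \<xi> (r y t))"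
      using character_norm_diff[OF \<xi>, of "r y t" ?d] by (simp add: character_0[OF \<xi>])
    also have "\<dots> \<le> cmod (\<xi> x - t) + cmod (t - \<xi> (r y t))" using norm_triangle_ineq[of "\<xi> x - t" "t - \<xi> (r y t)"] by simp
    also have "\<dots> < e / 2 + e / 2"
      using \<open>x \<in> cell y t\<close> rc by (intro add_strict_mono) (auto simp: cell_def norm_minus_commute)
    finally have "?d \<in> U" using V(4)[OF dV] S(3) by auto
    moreover have "r y t \<in> E" using y t by (auto simp: E_def)
    ultimately have "r y t + ?d \<in> E + U" by (intro set_plus_intro)
    then show ?thesis by simp
  qed
  moreover have "finite E" using F T by (auto simp: E_def)
  ultimately show "\<exists>F. finite F \<and> F + U = UNIV" by blast
qed

text \<open>
The sequence still tends to 0 after \<open>\<xi>\<close> has been adjoined, because \<open>\<xi>\<close> is 1 along it. As \<open>\<tau>\<close> is the finest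
topology with this property, adjoining \<open>\<xi>\<close> adds nothing.
\<close>

lemma annihilating_characters_continuous:
  assumes "finest_precompact u \<tau>" and \<xi>: "character \<xi>" "\<And>n. \<xi> (u n) = 1"
  shows "openin \<tau> {x. cmod (\<xi> x - 1) < 1 / 4}"
proof -
  have \<tau>: "precompact_topology \<tau>" and lim: "limitin \<tau> u 0 sequentially"
    and fin: "\<And>\<sigma> U. precompact_topology \<sigma> \<Longrightarrow> limitin \<sigma> u 0 sequentially \<Longrightarrow> openin \<sigma> U \<Longrightarrow> openin \<tau> U"
    using assms(1) unfolding finest_precompact_def by blast+
  let ?\<sigma> = "adjoin_char \<tau> \<xi>"
  have \<sigma>: "precompact_topology ?\<sigma>" by (rule precompact_adjoin_char[OF \<tau> \<xi>(1)])
  have "limitin ?\<sigma> u 0 sequentially"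
    unfolding limitin_def
  proof (intro conjI allI impI)
    show "0 \<in> topspace ?\<sigma>" using \<sigma> by (simp add: precompact_topology_def group_topology_def)
    fix S assume S: "openin ?\<sigma> S \<and> 0 \<in> S"
    then obtain V e where V: "openin \<tau> V" "0 \<in> V" "0 < e" "\<And>z. z \<in> V \<Longrightarrow> cmod (\<xi> z - \<xi> 0) < e \<Longrightarrow> z \<in> S"
      unfolding openin_adjoin_char by blast
    have "\<forall>\<^sub>F n in sequentially. u n \<in> V" using lim V(1,2) by (auto simp: limitin_def)
    then show "\<forall>\<^sub>F n in sequentially. u n \<in> S"
      by eventually_elim (use V(3,4) \<xi>(2) character_0[OF \<xi>(1)] in auto)
  qed
  moreover have "openin ?\<sigma> {x \<in> UNIV. cmod (\<xi> x - 1) < 1 / 4}"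
    using \<tau> by (intro openin_adjoin_char_cell group_topology_openin_UNIV) (simp add: precompact_topology_def)
  ultimately show ?thesis using fin[OF \<sigma>] by simp
qed

section \<open>The annihilator of a subgroup of infinite index\<close>

text \<open>
Collecting the points of each class turns the form into a sum of squares.
\<close>

lemma herm_form_partition:
  assumes "finite CS" "\<And>p. p \<in> set ps \<Longrightarrow> c (snd p) \<in> CS"
    and "\<And>x y. \<phi> (x - y) = (if c x = c y then 1 else 0)"
  shows "herm_form \<phi> ps ps \<in> \<real>\<^sub>\<ge>\<^sub>0"
proof -
  define s where "s C = (\<Sum>p\<leftarrow>ps. if c (snd p) = C then fst p else 0)" for C
  have cs: "cnj (s C) = (\<Sum>p\<leftarrow>ps. if c (snd p) = C then cnj (fst p) else 0)" for C
    unfolding s_def cnj_sum_list by (intro arg_cong[of _ _ sum_list] map_cong) auto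
  have "herm_form \<phi> ps ps = (\<Sum>p\<leftarrow>ps. \<Sum>q\<leftarrow>ps. \<Sum>C\<in>CS.
     (if c (snd p) = C then fst p else 0) * (if c (snd q) = C then cnj (fst q) else 0))"
    unfolding herm_form_def
  proof (intro arg_cong[of _ _ sum_list] map_cong refl)
    fix p q assume p: "p \<in> set ps"
    have "(\<Sum>C\<in>CS. (if c (snd p) = C then fst p else 0) * (if c (snd q) = C then cnj (fst q) else 0))
       = (\<Sum>C\<in>CS. if c (snd p) = C then (if c (snd q) = c (snd p) then fst p * cnj (fst q) else 0) else 0)"
      by (intro sum.cong) auto
    also have "\<dots> = fst p * cnj (fst q) * \<phi> (snd p - snd q)"
      using assms(1) assms(2)[OF p] by (simp add: assms(3))
    finally show "fst p * cnj (fst q) * \<phi> (snd p - snd q) = (\<Sum>C\<in>CS. (if c (snd p) = C then fst p else 0) * (if c (snd q) = C then cnj (fst q) else 0))"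
      by simp
  qed
  also have "\<dots> = (\<Sum>C\<in>CS. s C * cnj (s C))"
    unfolding cs unfolding s_def sum_list_product by (simp only: sum_sum_list)
  also have "\<dots> = complex_of_real (\<Sum>C\<in>CS. (cmod (s C))\<^sup>2)"
    by (simp add: complex_norm_square[symmetric])
  finally have eq: "herm_form \<phi> ps ps = complex_of_real (\<Sum>C\<in>CS. (cmod (s C))\<^sup>2)" .
  show ?thesis unfolding eq nonneg_Reals_of_real_iff by (intro sum_nonneg) simp
qed

lemma coset_eq_iff:
  assumes "H = group_closure S"
  shows "x +o H = y +o H \<longleftrightarrow> x - y \<in> (H :: 'a::ab_group_add set)"
proof
  assume "x +o H = y +o H"
  moreover have "x \<in> x +o H" using assms by (simp add: elt_set_plus_def image_def)
  ultimately obtain h where "h \<in> H" "x = y + h" by (auto simp: elt_set_plus_def)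
  then show "x - y \<in> H" by simp
next
  assume d: "x - y \<in> H"
  have "x +o H \<subseteq> y +o H" if d: "x - y \<in> H" for x y
  proof
    fix z assume "z \<in> x +o H"
    then obtain h where h: "h \<in> H" "z = x + h" by (auto simp: elt_set_plus_def)
    then have "z = y + ((x - y) + h)" by simp
    moreover have "(x - y) + h \<in> H" using d h(1) group_closure_add unfolding assms by blast
    ultimately show "z \<in> y +o H" unfolding elt_set_plus_def by blast
  qed
  moreover have "y - x \<in> H" using d group_closure_minus_iff[of "x - y" S] assms by simp
  ultimately show "x +o H = y +o H" using d by blast
qed

definition subgroup_indicator :: "'a set \<Rightarrow> 'a \<Rightarrow> complex" where
  "subgroup_indicator H x = (if x \<in> H then 1 else 0)"

lemma state_indicator:
  fixes S :: "'a::ab_group_add set"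
  shows "state (subgroup_indicator (group_closure S))"
proof -
  let ?H = "group_closure S"
  have "herm_form (subgroup_indicator ?H) ps ps \<in> \<real>\<^sub>\<ge>\<^sub>0" for ps
    by (rule herm_form_partition[of "(\<lambda>p. snd p +o ?H) ` set ps" _ "\<lambda>x. x +o ?H"])
       (auto simp: subgroup_indicator_def coset_eq_iff[OF refl])
  then show ?thesis by (simp add: state_def pos_def_def subgroup_indicator_def)
qed

text \<open>
The functional that averages \<open>\<phi> * cnj \<eta>\<close> over all differences of points of the list. For a character \<open>\<phi>\<close> it is
the square of a correlation with \<open>\<eta>\<close>, equal to 1 for \<open>\<phi> = \<eta>\<close>.
\<close>

definition correlation_pts :: "('a::ab_group_add \<Rightarrow> complex) \<Rightarrow> 'a list \<Rightarrow> (complex \<times> 'a) list" where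
  "correlation_pts \<eta> xs = concat (map (\<lambda>x. map (\<lambda>y.
     (cnj (\<eta> (x - y)) / (of_nat (length xs))\<^sup>2, x - y)) xs) xs)"

lemma eval_sum_append: "eval_sum (ps @ qs) \<phi> = eval_sum ps \<phi> + eval_sum qs \<phi>"
  by (simp add: eval_sum_def)

lemma eval_sum_correlation_pts:
  "eval_sum (correlation_pts \<eta> xs) \<phi>
    = Re ((\<Sum>x\<leftarrow>xs. \<Sum>y\<leftarrow>xs. \<phi> (x - y) * cnj (\<eta> (x - y))) / (of_nat (length xs))\<^sup>2)"
proof -
  show ?thesis unfolding eval_sum_def correlation_pts_def sum_list_concat_map by (simp add: sum_list_divide mult.commute)
qed

lemma eval_sum_correlation_pts_character:
  assumes "character \<xi>" "character \<eta>"
  shows "eval_sum (correlation_pts \<eta> xs) \<xi> = (cmod ((\<Sum>x\<leftarrow>xs. \<xi> x * cnj (\<eta> x)) / of_nat (length xs)))\<^sup>2"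
proof -
  let ?s = "\<Sum>x\<leftarrow>xs. \<xi> x * cnj (\<eta> x)"
  have "(\<Sum>x\<leftarrow>xs. \<Sum>y\<leftarrow>xs. \<xi> (x - y) * cnj (\<eta> (x - y))) = ?s * cnj ?s"
    unfolding cnj_sum_list sum_list_product
    by (intro arg_cong[of _ _ sum_list] map_cong refl) (simp add: character_diff assms mult_ac)
  also have "\<dots> = complex_of_real ((cmod ?s)\<^sup>2)" by (simp add: complex_norm_square[symmetric])
  finally have "eval_sum (correlation_pts \<eta> xs) \<xi> = Re (complex_of_real ((cmod ?s)\<^sup>2) / (of_nat (length xs))\<^sup>2)"
    unfolding eval_sum_correlation_pts by simp
  also have "\<dots> = Re (complex_of_real ((cmod ?s)\<^sup>2 / (real (length xs))\<^sup>2))" by simp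
  finally show ?thesis by (simp add: norm_divide power_divide)
qed

lemma eval_sum_correlation_pts_indicator:
  assumes \<eta>: "character \<eta>" and H: "H = group_closure S" and xs: "xs \<noteq> []" "distinct (map (\<lambda>x. x +o H) xs)"
  shows "eval_sum (correlation_pts \<eta> xs) (subgroup_indicator H) = 1 / real (length xs)"
proof -
  have d: "distinct xs" using xs(2) by (simp add: distinct_map)
  have inj: "x = y" if "x \<in> set xs" "y \<in> set xs" "x - y \<in> H" for x y
    using xs(2) that coset_eq_iff[OF H, of x y] by (auto simp: distinct_map inj_on_def)
  have z: "0 \<in> H" using H by simp
  have "(\<Sum>x\<leftarrow>xs. \<Sum>y\<leftarrow>xs. subgroup_indicator H (x - y) * cnj (\<eta> (x - y))) = (\<Sum>x\<leftarrow>xs. 1)"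
  proof (intro arg_cong[of _ _ sum_list] map_cong refl)
    fix x assume x: "x \<in> set xs"
    have "(\<Sum>y\<leftarrow>xs. subgroup_indicator H (x - y) * cnj (\<eta> (x - y))) = (\<Sum>y\<in>set xs. if x = y then 1 else 0)"
      unfolding sum_list_distinct_conv_sum_set[OF d]
      using inj[OF x] z by (intro sum.cong) (auto simp: subgroup_indicator_def character_0[OF \<eta>])
    then show "(\<Sum>y\<leftarrow>xs. subgroup_indicator H (x - y) * cnj (\<eta> (x - y))) = 1" using x by simp
  qed
  also have "\<dots> = of_nat (length xs)" by (simp add: sum_list_triv)
  finally have "eval_sum (correlation_pts \<eta> xs) (subgroup_indicator H) = Re (of_nat (length xs) / (of_nat (length xs))\<^sup>2)"
    unfolding eval_sum_correlation_pts by simp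
  also have "\<dots> = Re (complex_of_real (real (length xs) / (real (length xs))\<^sup>2))" by simp
  finally show ?thesis using xs(1) by (simp add: power2_eq_square)
qed

text \<open>
The indicator function of \<open>H\<close>, the Fourier transform of Haar measure on the annihilator of \<open>H\<close>, has correlation
\<open>1 / m\<close> with every character along \<open>m\<close> points that are distinct modulo \<open>H\<close>. Given an enumeration \<open>\<eta>\<close> of the
annihilator, choose \<open>2 ^ (k + 2)\<close> such points for \<open>\<eta> k\<close>, so that the correlations of the indicator function
sum to at most \<open>1/2\<close>. A character dominating it is trivial on \<open>H\<close> and by compactness can be chosen to have
correlation at most \<open>1/2\<close> with every \<open>\<eta> k\<close>; but \<open>\<eta> k\<close> has correlation 1 with itself.
\<close>

theorem annihilator_uncountable:
  fixes H :: "'a::ab_group_add set"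
  assumes H: "H = group_closure S" and inf: "\<not> finite_index H"
  shows "\<not> countable {\<xi>. character \<xi> \<and> (\<forall>h\<in>H. \<xi> h = 1)}"
proof
  let ?A = "{\<xi> :: 'a \<Rightarrow> complex. character \<xi> \<and> (\<forall>h\<in>H. \<xi> h = 1)}"
  assume c: "countable ?A"
  have "(\<lambda>_. 1) \<in> ?A" by (simp add: character_def)
  then have ne: "?A \<noteq> {}" by blast
  define \<eta> where "\<eta> = from_nat_into ?A"
  have \<eta>: "character (\<eta> k)" for k using from_nat_into[OF ne, of k] by (simp add: \<eta>_def)
  have "\<exists>xs. length xs = 2 ^ (k + 2) \<and> distinct (map (\<lambda>x. x +o H) xs)" for k :: nat
  proof -
    have "infinite (range (\<lambda>x. x +o H))" using inf by (simp add: finite_index_def)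
    then obtain T where T: "finite T" "card T = 2 ^ (k + 2)" "T \<subseteq> range (\<lambda>x. x +o H)"
      using infinite_arbitrarily_large by metis
    obtain cs where cs: "set cs = T" "distinct cs" using finite_distinct_list[OF T(1)] by blast
    define xs where "xs = map (\<lambda>C. SOME x. x +o H = C) cs"
    have "(SOME x. x +o H = C) +o H = C" if "C \<in> T" for C
      using T(3) that by (intro someI_ex[of "\<lambda>x. x +o H = C"]) blast
    then have "map (\<lambda>x. x +o H) xs = cs" using cs(1) by (auto simp: xs_def intro!: map_idI)
    moreover have "length xs = 2 ^ (k + 2)" using cs T(2) by (simp add: xs_def distinct_card[symmetric])
    ultimately show ?thesis using cs(2) by metis
  qed
  then obtain xs :: "nat \<Rightarrow> 'a list" where xs: "\<And>k. length (xs k) = 2 ^ (k + 2)" "\<And>k. distinct (map (\<lambda>x. x +o H) (xs k))"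
    by metis
  have xs_ne: "xs k \<noteq> []" for k using xs(1)[of k] by auto
  define L where "L k \<phi> = eval_sum (correlation_pts (\<eta> k) (xs k)) \<phi>" for k \<phi>
  have L_ind: "L k (subgroup_indicator H) = (1/4) * (1/2) ^ k" for k
    unfolding L_def eval_sum_correlation_pts_indicator[OF \<eta> H xs_ne xs(2)] xs(1) by (simp add: power_one_over)
  have L_nonneg: "0 \<le> L k \<xi>" if "character \<xi>" for k \<xi>
    unfolding L_def eval_sum_correlation_pts_character[OF that \<eta>] by simp
  have L_self: "L k (\<eta> k) = 1" for k
  proof -
    have "\<eta> k x * cnj (\<eta> k x) = 1" for x
      using character_norm[OF \<eta>, of k x] complex_norm_square[of "\<eta> k x"] by simp
    then show ?thesis unfolding L_def eval_sum_correlation_pts_character[OF \<eta> \<eta>] using xs_ne[of k] by (simp add: sum_list_triv)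
  qed
  \<comment> \<open>Domination bounds functionals from below; the sign turns this into an upper bound for the correlations.\<close>
  have total: "\<exists>zs. \<forall>\<phi>. eval_sum zs \<phi> = - (\<Sum>k<r. L k \<phi>)" for r
  proof (induction r)
    case 0
    show ?case by (intro exI[of _ "[]"]) (simp add: eval_sum_def)
  next
    case (Suc r)
    then obtain zs where zs: "\<And>\<phi>. eval_sum zs \<phi> = - (\<Sum>k<r. L k \<phi>)" by blast
    have "eval_sum (map (\<lambda>p. (- fst p, snd p)) ps) \<phi> = - eval_sum ps \<phi>" for ps and \<phi> :: "'a \<Rightarrow> complex"
      by (induction ps) (simp_all add: eval_sum_def)
    then show ?case
      by (intro exI[of _ "zs @ map (\<lambda>p. (- fst p, snd p)) (correlation_pts (\<eta> r) (xs r))"])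
         (simp add: eval_sum_append zs L_def)
  qed
  define K where "K k = {\<xi>. L k \<xi> \<le> 1 / 2} \<inter> (\<Inter>h\<in>H. {\<xi>. \<xi> h = 1})" for k
  have "{\<xi>. character \<xi>} \<inter> (\<Inter>k\<in>UNIV. K k) \<noteq> {}"
  proof (rule compact_imp_fip_image[OF compact_characters])
    show "closed (K k)" for k
      unfolding K_def L_def
      by (intro closed_Int closed_INT ballI closed_Collect_le closed_Collect_eq continuous_intros)
    fix J :: "nat set" assume J: "finite J"
    define r where "r = Suc (Max (insert 0 J))"
    have Jr: "k < r" if "k \<in> J" for k using J that by (simp add: r_def less_Suc_eq_le)
    obtain zs where zs: "\<And>\<phi>. eval_sum zs \<phi> = - (\<Sum>k<r. L k \<phi>)" using total by blast
    obtain \<xi> where \<xi>: "character \<xi>" "\<And>x. cmod (subgroup_indicator H x) = 1 \<Longrightarrow> \<xi> x = subgroup_indicator H x"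
      "eval_sum zs (subgroup_indicator H) \<le> eval_sum zs \<xi>"
      by (rule state_dominated_by_character[of "subgroup_indicator H" zs]) (use state_indicator[of S] H in auto)
    have "(\<Sum>k<r. L k \<xi>) \<le> (\<Sum>k<r. (1/4) * (1/2) ^ k)" using \<xi>(3) unfolding zs L_ind by simp
    also have "\<dots> \<le> 1 / 2"
      unfolding sum_distrib_left[symmetric] by (subst geometric_sum) (auto simp: field_simps)
    finally have s: "(\<Sum>k<r. L k \<xi>) \<le> 1 / 2" .
    have "\<xi> \<in> K k" if "k \<in> J" for k
    proof -
      have "L k \<xi> \<le> (\<Sum>k<r. L k \<xi>)"
        using Jr[OF that] L_nonneg[OF \<xi>(1)] by (intro member_le_sum) auto
      then show ?thesis using s \<xi>(2) by (auto simp: K_def subgroup_indicator_def)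
    qed
    then show "{\<xi>. character \<xi>} \<inter> (\<Inter>k\<in>J. K k) \<noteq> {}" using \<xi>(1) by blast
  qed
  then obtain \<xi> where \<xi>: "character \<xi>" "\<And>k. \<xi> \<in> K k" by blast
  have "\<xi> \<in> ?A" using \<xi> by (auto simp: K_def)
  then obtain k where "\<eta> k = \<xi>" unfolding \<eta>_def using from_nat_into_surj[OF c] by blast
  then have "L k \<xi> = 1" using L_self by blast
  moreover have "L k \<xi> \<le> 1 / 2" using \<xi>(2)[of k] by (simp add: K_def)
  ultimately show False by simp
qed

section \<open>Finite index of the generated subgroup\<close>

lemma metrizable_neighbourhood_base:
  assumes "metrizable_space \<tau>" "topspace \<tau> = UNIV"
  obtains W :: "nat \<Rightarrow> 'a::ab_group_add set" where "\<And>n. openin \<tau> (W n)" "\<And>n. 0 \<in> W n"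
    "decseq W" "\<And>U. openin \<tau> U \<Longrightarrow> 0 \<in> U \<Longrightarrow> \<exists>n. W n \<subseteq> U"
proof -
  obtain M d where M: "Metric_space M d" "\<tau> = Metric_space.mtopology M d"
    using assms(1) unfolding metrizable_space_def by blast
  interpret Metric_space M d by (rule M(1))
  have MU: "M = UNIV" using M(2) assms(2) topspace_mtopology by simp
  show ?thesis
  proof (rule that[of "\<lambda>n. mball 0 (1 / real (Suc n))"])
    show "openin \<tau> (mball 0 (1 / real (Suc n)))" for n unfolding M(2) by (rule openin_mball)
    show "0 \<in> mball 0 (1 / real (Suc n))" for n unfolding centre_in_mball_iff by (simp add: MU)
    show "decseq (\<lambda>n. mball 0 (1 / real (Suc n)))"
      unfolding decseq_def by (intro allI impI mball_subset_concentric) (simp add: frac_le)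
    fix U assume "openin \<tau> U" "0 \<in> U"
    then obtain r where r: "r > 0" "mball 0 r \<subseteq> U" unfolding M(2) openin_mtopology by blast
    obtain n where "1 / real (Suc n) < r" using r(1) nat_approx_posE by metis
    then have "mball 0 (1 / real (Suc n)) \<subseteq> mball 0 r" by (intro mball_subset_concentric) simp
    then show "\<exists>n. mball 0 (1 / real (Suc n)) \<subseteq> U" using r(2) by blast
  qed
qed

text \<open>
All characters that are trivial on the generated subgroup are continuous and therefore lie in the polar of some
member of a countable base, and these polars are finite.
\<close>

theorem characterizing_sequence_finite_index:
  fixes \<tau> :: "'a::ab_group_add topology"
  assumes \<tau>: "precompact_topology \<tau>" and m: "metrizable_space \<tau>" and u: "finest_precompact u \<tau>"
  shows "finite_index (group_closure (range u))"
proof (rule ccontr)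
  let ?H = "group_closure (range u)"
  assume inf: "\<not> finite_index ?H"
  have "topspace \<tau> = UNIV" using \<tau> by (simp add: precompact_topology_def group_topology_def)
  then obtain W :: "nat \<Rightarrow> 'a set" where W: "\<And>n. openin \<tau> (W n)" "\<And>n. 0 \<in> W n"
    "\<And>U. openin \<tau> U \<Longrightarrow> 0 \<in> U \<Longrightarrow> \<exists>n. W n \<subseteq> U"
    by (rule metrizable_neighbourhood_base[OF m]) blast
  have fin: "finite (almost_trivial_on (W n))" for n
  proof -
    obtain F where "finite F" "\<And>x. \<exists>y\<in>F. x - y \<in> W n"
      by (rule precompact_finite_cover[OF \<tau> W(1,2)]) blast
    then show ?thesis by (rule finite_almost_trivial_on)
  qed
  have "{\<xi>. character \<xi> \<and> (\<forall>h\<in>?H. \<xi> h = 1)} \<subseteq> (\<Union>n. almost_trivial_on (W n))"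
  proof
    fix \<xi> assume "\<xi> \<in> {\<xi>. character \<xi> \<and> (\<forall>h\<in>?H. \<xi> h = 1)}"
    then have \<xi>: "character \<xi>" "\<And>n. \<xi> (u n) = 1" by (auto intro: group_closure.base)
    have "0 \<in> {x. cmod (\<xi> x - 1) < 1 / 4}" by (simp add: character_0[OF \<xi>(1)])
    then obtain n where "W n \<subseteq> {x. cmod (\<xi> x - 1) < 1 / 4}"
      using W(3)[OF annihilating_characters_continuous[OF u \<xi>]] by blast
    then have "\<xi> \<in> almost_trivial_on (W n)" using \<xi>(1) by (auto simp: almost_trivial_on_def)
    then show "\<xi> \<in> (\<Union>n. almost_trivial_on (W n))" by blast
  qed
  moreover have "countable (\<Union>n. almost_trivial_on (W n))"
    using fin by (intro countable_UN) (auto intro: countable_finite)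
  ultimately show False using annihilator_uncountable[OF refl inf] countable_subset by blast
qed

lemma countable_group_closure:
  assumes "countable S" shows "countable (group_closure S)"
proof -
  define step where "step T = T \<union> (\<lambda>(x, y). x - y) ` (T \<times> T)" for T :: "'a set"
  define T where "T n = (step ^^ n) (insert 0 S)" for n
  have c: "countable (T n)" for n
  proof (induction n)
    case 0 then show ?case using assms by (simp add: T_def)
  next
    case (Suc n)
    have "T (Suc n) = step (T n)" by (simp add: T_def)
    then show ?case using Suc by (auto simp: step_def intro!: countable_Un countable_image countable_SIGMA)
  qed
  have mono: "T m \<subseteq> T n" if "m \<le> n" for m n
    using that by (induction n rule: dec_induct) (auto simp: T_def step_def)
  have "group_closure S \<subseteq> (\<Union>n. T n)"
  proof
    fix x assume "x \<in> group_closure S"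
    then show "x \<in> (\<Union>n. T n)"
    proof (induction rule: group_closure.induct)
      case (base s)
      then have "s \<in> T 0" by (simp add: T_def)
      then show ?case by blast
    next
      case (diff s t)
      then obtain m n where "s \<in> T m" "t \<in> T n" by blast
      then have "s \<in> T (max m n)" "t \<in> T (max m n)" using mono[of m "max m n"] mono[of n "max m n"] by auto
      then have "s - t \<in> T (Suc (max m n))" by (force simp: T_def step_def)
      then show ?case by blast
    qed
  qed
  then show ?thesis using c countable_subset by (metis countable_UN countableI_type)
qed

lemma countable_of_finite_index:
  fixes H :: "'a::ab_group_add set"
  assumes "finite_index H" "countable H" "0 \<in> H" shows "countable (UNIV :: 'a set)"
proof -
  have "x \<in> \<Union>(range (\<lambda>x. x +o H))" for x
    using assms(3) by (auto simp: elt_set_plus_def intro!: exI[of _ x] bexI[of _ 0])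
  then have "(UNIV :: 'a set) = \<Union>(range (\<lambda>x. x +o H))" by blast
  moreover have "countable (x +o H)" for x
  proof -
    have "x +o H = (\<lambda>h. x + h) ` H" by (auto simp: elt_set_plus_def)
    then show ?thesis using assms(2) by simp
  qed
  then have "countable (\<Union>(range (\<lambda>x. x +o H)))"
    using assms(1) countable_UN[of "range (\<lambda>x. x +o H)" "\<lambda>C. C"]
    by (auto simp: finite_index_def intro: countable_finite)
  ultimately show ?thesis by simp
qed

section \<open>Characterizing sequences of countable groups\<close>

lemma closed_norm_diff:
  "closed {\<xi> :: 'a \<Rightarrow> complex. r \<le> cmod (\<xi> x - c)}" "closed {\<xi> :: 'a \<Rightarrow> complex. cmod (\<xi> x - c) \<le> r}"
  by (intro closed_Collect_le continuous_intros)+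

text \<open>
By compactness: a character that is almost trivial on all of \<open>W\<close> belongs to the polar itself, so a finite part of \<open>W\<close>
already forces a character to be close on \<open>B\<close> to a member of the polar.
\<close>

lemma finite_set_detects_triviality:
  fixes W B :: "'a::ab_group_add set"
  assumes E: "finite (almost_trivial_on W)" and B: "finite B"
  obtains A where "finite A" "A \<subseteq> W"
    "\<And>\<xi>. \<xi> \<in> almost_trivial_on A \<Longrightarrow> \<exists>\<eta>\<in>almost_trivial_on W. \<forall>b\<in>B. cmod (\<xi> b - \<eta> b) \<le> 1 / 8"
proof -
  \<comment> \<open>The closed set of functions that are not close on \<open>B\<close> to any member of the polar of \<open>W\<close>.\<close>
  define far where "far = (\<Inter>\<eta>\<in>almost_trivial_on W. \<Union>b\<in>B. {\<xi>. 1 / 8 \<le> cmod (\<xi> b - \<eta> b)})"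
  have cf: "closed far"
    unfolding far_def using B by (intro closed_INT ballI closed_UN closed_norm_diff)
  have "\<exists>A. finite A \<and> A \<subseteq> W \<and> almost_trivial_on A \<inter> far = {}"
  proof (rule ccontr)
    assume no: "\<nexists>A. finite A \<and> A \<subseteq> W \<and> almost_trivial_on A \<inter> far = {}"
    have "({\<xi>. character \<xi>} \<inter> far) \<inter> (\<Inter>w\<in>W. {\<xi>. cmod (\<xi> w - 1) \<le> 1 / 4}) \<noteq> {}"
    proof (rule compact_imp_fip_image)
      show "compact ({\<xi>. character \<xi>} \<inter> far)" by (intro compact_Int_closed compact_characters cf)
      show "closed {\<xi> :: 'a \<Rightarrow> complex. cmod (\<xi> w - 1) \<le> 1 / 4}" for w by (rule closed_norm_diff)
      fix A assume "finite A" "A \<subseteq> W"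
      then have "almost_trivial_on A \<inter> far \<noteq> {}" using no by blast
      then show "({\<xi>. character \<xi>} \<inter> far) \<inter> (\<Inter>w\<in>A. {\<xi>. cmod (\<xi> w - 1) \<le> 1 / 4}) \<noteq> {}"
        by (auto simp: almost_trivial_on_def)
    qed
    then obtain \<xi> where \<xi>: "character \<xi>" "\<xi> \<in> far" "\<And>w. w \<in> W \<Longrightarrow> cmod (\<xi> w - 1) \<le> 1 / 4" by auto
    then have "\<xi> \<in> almost_trivial_on W" by (simp add: almost_trivial_on_def)
    then show False using \<xi>(2) by (auto simp: far_def)
  qed
  then obtain A where A: "finite A" "A \<subseteq> W" "almost_trivial_on A \<inter> far = {}" by blast
  have "\<exists>\<eta>\<in>almost_trivial_on W. \<forall>b\<in>B. cmod (\<xi> b - \<eta> b) \<le> 1 / 8" if "\<xi> \<in> almost_trivial_on A" for \<xi>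
  proof -
    have "\<xi> \<notin> far" using A(3) that by blast
    then obtain \<eta> where "\<eta> \<in> almost_trivial_on W" "\<And>b. b \<in> B \<Longrightarrow> \<not> 1 / 8 \<le> cmod (\<xi> b - \<eta> b)"
      by (auto simp: far_def)
    then show ?thesis by (meson linear)
  qed
  then show ?thesis using that[OF A(1,2)] by blast
qed

lemma finite_set_separates:
  assumes "finite E" "\<And>\<xi>. \<xi> \<in> E \<Longrightarrow> character \<xi>"
  obtains B where "finite B" "\<And>\<xi> \<eta>. \<xi> \<in> E \<Longrightarrow> \<eta> \<in> E \<Longrightarrow> (\<And>b. b \<in> B \<Longrightarrow> cmod (\<xi> b - \<eta> b) < 1) \<Longrightarrow> \<xi> = \<eta>"
proof -
  have "\<exists>x. \<xi> \<noteq> \<eta> \<longrightarrow> \<not> cmod (\<xi> x - \<eta> x) < 1" if "\<xi> \<in> E" "\<eta> \<in> E" for \<xi> \<eta>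
    using characters_eqI[OF assms(2)[OF that(1)] assms(2)[OF that(2)]] by blast
  then have "\<forall>z. \<exists>x. z \<in> E \<times> E \<longrightarrow> fst z \<noteq> snd z \<longrightarrow> \<not> cmod (fst z x - snd z x) < 1"
    by (metis mem_Times_iff)
  then obtain f where f: "\<And>z. z \<in> E \<times> E \<Longrightarrow> fst z \<noteq> snd z \<Longrightarrow> \<not> cmod (fst z (f z) - snd z (f z)) < 1" by metis
  show ?thesis
  proof (rule that[of "f ` (E \<times> E)"])
    show "finite (f ` (E \<times> E))" using assms(1) by simp
    fix \<xi> \<eta> assume m: "\<xi> \<in> E" "\<eta> \<in> E" and c: "\<And>b. b \<in> f ` (E \<times> E) \<Longrightarrow> cmod (\<xi> b - \<eta> b) < 1"
    have z: "(\<xi>, \<eta>) \<in> E \<times> E" using m by simp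
    then have "cmod (\<xi> (f (\<xi>, \<eta>)) - \<eta> (f (\<xi>, \<eta>))) < 1" by (intro c) simp
    then show "\<xi> = \<eta>" using f[OF z] by auto
  qed
qed

lemma finite_set_detects_smaller:
  fixes E :: "('a::ab_group_add \<Rightarrow> complex) set"
  assumes "finite E" "\<And>\<xi>. \<xi> \<in> E \<Longrightarrow> character \<xi>"
  obtains A where "finite A" "A \<subseteq> W" "\<And>\<xi>. \<xi> \<in> E \<Longrightarrow> \<xi> \<in> almost_trivial_on A \<Longrightarrow> \<xi> \<in> almost_trivial_on W"
proof -
  have "\<forall>\<xi>. \<exists>w. \<xi> \<in> E - almost_trivial_on W \<longrightarrow> w \<in> W \<and> \<not> cmod (\<xi> w - 1) \<le> 1 / 4"
    using assms(2) by (auto simp: almost_trivial_on_def)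
  then obtain f where f: "\<And>\<xi>. \<xi> \<in> E - almost_trivial_on W \<Longrightarrow> f \<xi> \<in> W \<and> \<not> cmod (\<xi> (f \<xi>) - 1) \<le> 1 / 4" by metis
  show ?thesis
  proof (rule that[of "f ` (E - almost_trivial_on W)"])
    show "finite (f ` (E - almost_trivial_on W))" using assms(1) by simp
    show "f ` (E - almost_trivial_on W) \<subseteq> W" using f by blast
    fix \<xi> assume m: "\<xi> \<in> E" "\<xi> \<in> almost_trivial_on (f ` (E - almost_trivial_on W))"
    show "\<xi> \<in> almost_trivial_on W"
    proof (rule ccontr)
      assume "\<xi> \<notin> almost_trivial_on W"
      then have "\<xi> \<in> E - almost_trivial_on W" using m(1) by blast
      then show False using f[of \<xi>] m(2) by (auto simp: almost_trivial_on_def)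
    qed
  qed
qed

lemma almost_trivial_on_antimono: "A \<subseteq> B \<Longrightarrow> almost_trivial_on B \<subseteq> almost_trivial_on A"
  by (auto simp: almost_trivial_on_def)

text \<open>
The sets are \<open>A n = W n \<inter> B (Suc n)\<close> for a fast growing exhaustion \<open>B\<close> of the group. A character that passes the
test \<open>A n\<close> is close on \<open>B n\<close> to some \<open>\<eta> n\<close> in the finite polar of \<open>W n\<close>. If it passes the tests \<open>A n\<close> and
\<open>A (Suc n)\<close>, then \<open>\<eta> (Suc n)\<close> is close to it on \<open>A n\<close> and therefore almost trivial on \<open>A n\<close>, which by the choice
of \<open>B (Suc n)\<close> puts \<open>\<eta> (Suc n)\<close> into the polar of \<open>W n\<close>. Both approximants now lie in one finite set whose members
are told apart on \<open>B n\<close>, so they are equal. Hence \<open>\<eta>\<close> is eventually constant, and its final value is the given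
character.
\<close>

theorem testing_sets_exist:
  fixes W :: "nat \<Rightarrow> 'a::ab_group_add set"
  assumes count: "countable (UNIV :: 'a set)" and W: "decseq W" "\<And>n. 0 \<in> W n"
    and E: "\<And>n. finite (almost_trivial_on (W n))"
  obtains A where "\<And>n. finite (A n)" "\<And>n. A n \<subseteq> W n" "\<And>n. A n \<noteq> {}"
    "\<And>\<xi>. character \<xi> \<Longrightarrow> (\<forall>\<^sub>F n in sequentially. \<forall>a\<in>A n. cmod (\<xi> a - 1) \<le> 1 / 8) \<Longrightarrow>
       \<exists>n. \<xi> \<in> almost_trivial_on (W n)"
proof -
  define g where "g = from_nat_into (UNIV :: 'a set)"
  have g: "\<exists>n. g n = x" for x :: 'a
    using from_nat_into_surj[OF count, of x] by (auto simp: g_def)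
  define P where "P n B \<longleftrightarrow> finite B \<and> 0 \<in> B \<and> g n \<in> B \<and>
     (\<forall>\<xi>\<in>almost_trivial_on (W n). \<forall>\<eta>\<in>almost_trivial_on (W n). (\<forall>b\<in>B. cmod (\<xi> b - \<eta> b) < 1) \<longrightarrow> \<xi> = \<eta>)" for n B
  \<comment> \<open>All three requirements on \<open>B'\<close> persist when \<open>B'\<close> grows, so they can be met one after the other.\<close>
  define Q where "Q n B B' \<longleftrightarrow> B \<subseteq> B' \<and>
     (\<forall>\<xi>\<in>almost_trivial_on (W n \<inter> B'). \<exists>\<eta>\<in>almost_trivial_on (W n). \<forall>b\<in>B. cmod (\<xi> b - \<eta> b) \<le> 1 / 8) \<and>
     (\<forall>\<xi>\<in>almost_trivial_on (W (Suc n)). \<xi> \<in> almost_trivial_on (W n \<inter> B') \<longrightarrow> \<xi> \<in> almost_trivial_on (W n))" for n B B'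
  have ch: "character \<xi>" if "\<xi> \<in> almost_trivial_on (W n)" for \<xi> n
    using that by (simp add: almost_trivial_on_def)
  have "\<exists>B. \<forall>n. P n (B n) \<and> Q n (B n) (B (Suc n))"
  proof (rule dependent_nat_choice)
    obtain S where S: "finite S" "\<And>\<xi> \<eta>. \<xi> \<in> almost_trivial_on (W 0) \<Longrightarrow> \<eta> \<in> almost_trivial_on (W 0) \<Longrightarrow>
        (\<And>b. b \<in> S \<Longrightarrow> cmod (\<xi> b - \<eta> b) < 1) \<Longrightarrow> \<xi> = \<eta>"
      by (rule finite_set_separates[OF E ch]) blast+
    show "\<exists>B. P 0 B" using S by (intro exI[of _ "S \<union> {0, g 0}"]) (auto simp: P_def)
  next
    fix B n assume B: "P n B"
    then have fB: "finite B" by (simp add: P_def)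
    obtain S where S: "finite S" "\<And>\<xi> \<eta>. \<xi> \<in> almost_trivial_on (W (Suc n)) \<Longrightarrow> \<eta> \<in> almost_trivial_on (W (Suc n)) \<Longrightarrow>
        (\<And>b. b \<in> S \<Longrightarrow> cmod (\<xi> b - \<eta> b) < 1) \<Longrightarrow> \<xi> = \<eta>"
      by (rule finite_set_separates[OF E ch]) blast+
    obtain A1 where A1: "finite A1" "A1 \<subseteq> W n"
      "\<And>\<xi>. \<xi> \<in> almost_trivial_on A1 \<Longrightarrow> \<exists>\<eta>\<in>almost_trivial_on (W n). \<forall>b\<in>B. cmod (\<xi> b - \<eta> b) \<le> 1 / 8"
      by (rule finite_set_detects_triviality[OF E fB]) blast
    obtain A2 where A2: "finite A2" "A2 \<subseteq> W n"
      "\<And>\<xi>. \<xi> \<in> almost_trivial_on (W (Suc n)) \<Longrightarrow> \<xi> \<in> almost_trivial_on A2 \<Longrightarrow> \<xi> \<in> almost_trivial_on (W n)"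
      by (rule finite_set_detects_smaller[OF E ch]) blast+
    let ?B = "B \<union> S \<union> A1 \<union> A2 \<union> {g (Suc n)}"
    have sub: "almost_trivial_on (W n \<inter> ?B) \<subseteq> almost_trivial_on A1" "almost_trivial_on (W n \<inter> ?B) \<subseteq> almost_trivial_on A2"
      using A1(2) A2(2) by (intro almost_trivial_on_antimono; blast)+
    have "P (Suc n) ?B" using B S A1(1) A2(1) by (auto simp: P_def)
    moreover have "Q n B ?B" unfolding Q_def using A1(3) A2(3) sub by blast
    ultimately show "\<exists>B'. P (Suc n) B' \<and> Q n B B'" by blast
  qed
  then obtain B where B: "\<And>n. P n (B n)" "\<And>n. Q n (B n) (B (Suc n))" by blast
  have Bmono: "B m \<subseteq> B n" if "m \<le> n" for m n
    using lift_Suc_mono_le[of B, OF _ that] B(2) by (simp add: Q_def)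
  define A where "A n = W n \<inter> B (Suc n)" for n
  show ?thesis
  proof (rule that[of A])
    show "finite (A n)" for n using B(1)[of "Suc n"] by (simp add: A_def P_def)
    show "A n \<subseteq> W n" for n by (simp add: A_def)
    show "A n \<noteq> {}" for n using B(1)[of "Suc n"] W(2) by (auto simp: A_def P_def)
    fix \<xi> :: "'a \<Rightarrow> complex"
    assume \<xi>: "character \<xi>" and ev: "\<forall>\<^sub>F n in sequentially. \<forall>a\<in>A n. cmod (\<xi> a - 1) \<le> 1 / 8"
    then obtain N where N: "\<And>n a. n \<ge> N \<Longrightarrow> a \<in> A n \<Longrightarrow> cmod (\<xi> a - 1) \<le> 1 / 8"
      unfolding eventually_sequentially by blast
    have "\<exists>\<eta>\<in>almost_trivial_on (W n). \<forall>b\<in>B n. cmod (\<xi> b - \<eta> b) \<le> 1 / 8" if "n \<ge> N" for n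
    proof -
      have "\<xi> \<in> almost_trivial_on (W n \<inter> B (Suc n))"
        using \<xi> N[OF that] by (force simp: almost_trivial_on_def A_def)
      then show ?thesis using B(2)[of n] by (simp add: Q_def)
    qed
    then obtain \<eta> where \<eta>: "\<And>n. n \<ge> N \<Longrightarrow> \<eta> n \<in> almost_trivial_on (W n)"
      "\<And>n b. n \<ge> N \<Longrightarrow> b \<in> B n \<Longrightarrow> cmod (\<xi> b - \<eta> n b) \<le> 1 / 8" by metis
    have step: "\<eta> (Suc n) = \<eta> n" if n: "n \<ge> N" for n
    proof -
      have n': "Suc n \<ge> N" using n by simp
      have "cmod (\<eta> (Suc n) a - 1) \<le> 1 / 4" if a: "a \<in> W n \<inter> B (Suc n)" for a
      proof -
        have "cmod (\<xi> a - 1) \<le> 1 / 8" using N[OF n] a by (simp add: A_def)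
        moreover have "cmod (\<xi> a - \<eta> (Suc n) a) \<le> 1 / 8" using \<eta>(2)[OF n'] a by simp
        ultimately show ?thesis
          using norm_triangle_ineq4[of "\<xi> a - 1" "\<xi> a - \<eta> (Suc n) a"] by simp
      qed
      then have "\<eta> (Suc n) \<in> almost_trivial_on (W n \<inter> B (Suc n))"
        using ch[OF \<eta>(1)[OF n']] by (simp add: almost_trivial_on_def)
      then have m: "\<eta> (Suc n) \<in> almost_trivial_on (W n)" using B(2)[of n] \<eta>(1)[OF n'] by (simp add: Q_def)
      have "cmod (\<eta> (Suc n) b - \<eta> n b) < 1" if b: "b \<in> B n" for b
      proof -
        have "cmod (\<xi> b - \<eta> n b) \<le> 1 / 8" "cmod (\<xi> b - \<eta> (Suc n) b) \<le> 1 / 8"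
          using \<eta>(2)[OF n b] \<eta>(2)[OF n', of b] b Bmono[of n "Suc n"] by auto
        then show ?thesis using norm_triangle_ineq4[of "\<xi> b - \<eta> n b" "\<xi> b - \<eta> (Suc n) b"] by simp
      qed
      then show ?thesis using B(1)[of n] m \<eta>(1)[OF n] unfolding P_def by blast
    qed
    have const: "\<eta> n = \<eta> N" if "n \<ge> N" for n
      using that by (induction n rule: dec_induct) (auto simp: step)
    have "\<xi> = \<eta> N"
    proof (rule characters_eqI[OF \<xi> ch[OF \<eta>(1)[OF order_refl]]])
      fix x
      obtain n where n: "g n = x" using g by blast
      have "x \<in> B n" using B(1)[of n] n by (simp add: P_def)
      then have "x \<in> B (max n N)" using Bmono[of n "max n N"] by auto
      then have "cmod (\<xi> x - \<eta> (max n N) x) \<le> 1 / 8" by (intro \<eta>(2)) auto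
      then show "cmod (\<xi> x - \<eta> N x) < 1" using const[of "max n N"] by simp
    qed
    then show "\<exists>n. \<xi> \<in> almost_trivial_on (W n)" using \<eta>(1)[OF order_refl] by blast
  qed
qed

text \<open>
The sequence runs through all pairs of an index \<open>n\<close> and an element of \<open>A n\<close>. Each \<open>A n\<close> is finite and contained
in \<open>W n\<close>, so the sequence tends to 0; and a property that holds eventually along the sequence holds on all but
finitely many of the sets \<open>A n\<close>.
\<close>

theorem countable_ss_characterized:
  fixes \<tau> :: "'a::ab_group_add topology"
  assumes \<tau>: "precompact_topology \<tau>" and m: "metrizable_space \<tau>" and count: "countable (UNIV :: 'a set)"
  shows "\<exists>u. finest_precompact u \<tau>"
proof -
  have gt: "group_topology \<tau>" using \<tau> by (simp add: precompact_topology_def)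
  then have top: "topspace \<tau> = UNIV" by (simp add: group_topology_def)
  obtain W :: "nat \<Rightarrow> 'a set" where W: "\<And>n. openin \<tau> (W n)" "\<And>n. 0 \<in> W n"
    "decseq W" "\<And>U. openin \<tau> U \<Longrightarrow> 0 \<in> U \<Longrightarrow> \<exists>n. W n \<subseteq> U"
    by (rule metrizable_neighbourhood_base[OF m top]) blast
  have E: "finite (almost_trivial_on (W n))" for n
  proof -
    obtain F where "finite F" "\<And>x. \<exists>y\<in>F. x - y \<in> W n"
      by (rule precompact_finite_cover[OF \<tau> W(1,2)]) blast
    then show ?thesis by (rule finite_almost_trivial_on)
  qed
  obtain A where A: "\<And>n. finite (A n)" "\<And>n. A n \<subseteq> W n" "\<And>n. A n \<noteq> {}"
    "\<And>\<xi>. character \<xi> \<Longrightarrow> (\<forall>\<^sub>F n in sequentially. \<forall>a\<in>A n. cmod (\<xi> a - 1) \<le> 1 / 8) \<Longrightarrow>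
       \<exists>n. \<xi> \<in> almost_trivial_on (W n)"
    by (rule testing_sets_exist[OF count W(3,2) E]) blast
  define I where "I = Sigma UNIV A"
  have "infinite I"
  proof
    assume "finite I"
    then have "finite (fst ` I)" by simp
    moreover have "fst ` I = UNIV"
    proof -
      have "n \<in> fst ` I" for n
      proof -
        obtain a where "a \<in> A n" using A(3) by blast
        then have "(n, a) \<in> I" by (simp add: I_def)
        then show ?thesis by force
      qed
      then show ?thesis by blast
    qed
    ultimately show False by simp
  qed
  moreover have "countable I"
    unfolding I_def using A(1) by (intro countable_SIGMA) (auto intro: countable_finite)
  ultimately obtain e where e: "bij_betw e (UNIV :: nat set) I"
    using bij_betw_from_nat_into by blast
  define u where "u k = snd (e k)" for k
  have low: "finite {k. fst (e k) < n}" for n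
  proof -
    have "e k \<in> I" for k using e by (auto simp: bij_betw_def)
    then have "snd (e k) \<in> A (fst (e k))" for k unfolding I_def by (metis SigmaD2 prod.collapse)
    then have "e ` {k. fst (e k) < n} \<subseteq> Sigma {..<n} A" by (metis (mono_tags, lifting) SigmaI image_subsetI lessThan_iff mem_Collect_eq prod.collapse)
    moreover have "finite (Sigma {..<n} A)" using A(1) by simp
    ultimately have "finite (e ` {k. fst (e k) < n})" by (rule finite_subset)
    moreover have "inj_on e {k. fst (e k) < n}" using e by (auto simp: bij_betw_def inj_on_def)
    ultimately show ?thesis by (rule finite_imageD)
  qed
  have uA: "u k \<in> A (fst (e k))" for k
  proof -
    have "e k \<in> I" using e by (auto simp: bij_betw_def)
    then show ?thesis by (auto simp: I_def u_def)
  qed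
  have hit: "\<exists>k. fst (e k) = n \<and> u k = a" if "a \<in> A n" for n a
  proof -
    have "(n, a) \<in> e ` UNIV" using e that by (simp add: bij_betw_def I_def)
    then obtain k where "e k = (n, a)" by auto
    then show ?thesis by (intro exI[of _ k]) (simp add: u_def)
  qed
  have lim: "limitin \<tau> u 0 sequentially"
    unfolding limitin_def
  proof (intro conjI allI impI)
    fix U assume "openin \<tau> U \<and> 0 \<in> U"
    then obtain n where n: "W n \<subseteq> U" using W(4) by blast
    have "u k \<in> U" if "k \<notin> {k. fst (e k) < n}" for k
      using uA[of k] A(2)[of "fst (e k)"] decseqD[OF W(3), of n "fst (e k)"] that n by auto
    then have "{k. u k \<notin> U} \<subseteq> {k. fst (e k) < n}" by blast
    then have "finite {k. u k \<notin> U}" using low finite_subset by blast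
    then show "\<forall>\<^sub>F k in sequentially. u k \<in> U" by (simp add: cofinite_eq_sequentially[symmetric] eventually_cofinite)
  qed (simp add: top)
  have cont: "continuous_character \<tau> \<xi>" if ch: "character \<xi>" and ev: "\<forall>\<^sub>F k in sequentially. cmod (\<xi> (u k) - 1) < 1 / 8" for \<xi>
  proof -
    have fin: "finite {k. \<not> cmod (\<xi> (u k) - 1) < 1 / 8}"
      using ev by (simp add: cofinite_eq_sequentially[symmetric] eventually_cofinite)
    define N where "N = Suc (Max (insert 0 ((\<lambda>k. fst (e k)) ` {k. \<not> cmod (\<xi> (u k) - 1) < 1 / 8})))"
    have "cmod (\<xi> a - 1) \<le> 1 / 8" if n: "n \<ge> N" and a: "a \<in> A n" for n a
    proof -
      obtain k where k: "fst (e k) = n" "u k = a" using hit[OF a] by blast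
      have "cmod (\<xi> (u k) - 1) < 1 / 8"
      proof (rule ccontr)
        assume "\<not> cmod (\<xi> (u k) - 1) < 1 / 8"
        then have "fst (e k) \<le> Max (insert 0 ((\<lambda>k. fst (e k)) ` {k. \<not> cmod (\<xi> (u k) - 1) < 1 / 8}))"
          using fin by (intro Max_ge) auto
        then show False using n k(1) by (simp add: N_def)
      qed
      then show ?thesis using k by simp
    qed
    then have "\<forall>\<^sub>F n in sequentially. \<forall>a\<in>A n. cmod (\<xi> a - 1) \<le> 1 / 8"
      unfolding eventually_sequentially by blast
    then obtain n where "\<xi> \<in> almost_trivial_on (W n)" using A(4)[OF ch] by blast
    then show ?thesis by (rule continuous_characterI[OF gt W(1,2)])
  qed
  have "openin \<tau> U" if \<sigma>: "precompact_topology \<sigma>" "limitin \<sigma> u 0 sequentially" and U: "openin \<sigma> U" for \<sigma> U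
  proof (rule group_topology_openinI[OF gt])
    fix x assume x: "x \<in> U"
    have gts: "group_topology \<sigma>" using \<sigma> by (simp add: precompact_topology_def)
    have "openin \<sigma> {y. y + x \<in> U}" "0 \<in> {y. y + x \<in> U}"
      using group_topology_openin_translate[OF gts U] x by auto
    then obtain \<Xi> \<delta> where \<Xi>: "finite \<Xi>" "\<delta> > 0" "\<And>\<xi>. \<xi> \<in> \<Xi> \<Longrightarrow> continuous_character \<sigma> \<xi>"
      "\<And>y. (\<And>\<xi>. \<xi> \<in> \<Xi> \<Longrightarrow> cmod (\<xi> y - 1) < \<delta>) \<Longrightarrow> y \<in> {y. y + x \<in> U}"
      by (rule precompact_bohr_neighbourhood[OF \<sigma>(1)]) blast
    have "\<exists>V. openin \<tau> V \<and> 0 \<in> V \<and> (\<forall>v\<in>V. cmod (\<xi> v - 1) < \<delta>)" if m: "\<xi> \<in> \<Xi>" for \<xi>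
    proof -
      have c: "character \<xi>" "\<exists>V. openin \<sigma> V \<and> 0 \<in> V \<and> (\<forall>v\<in>V. cmod (\<xi> v - 1) < 1 / 8)"
        using \<Xi>(3)[OF m] unfolding continuous_character_def by (auto dest!: spec[of _ "1 / 8"])
      then obtain V where V: "openin \<sigma> V" "0 \<in> V" "\<And>v. v \<in> V \<Longrightarrow> cmod (\<xi> v - 1) < 1 / 8" by blast
      have "\<forall>\<^sub>F k in sequentially. u k \<in> V" using \<sigma>(2) V(1,2) by (simp add: limitin_def)
      then have "\<forall>\<^sub>F k in sequentially. cmod (\<xi> (u k) - 1) < 1 / 8" by (rule eventually_mono) (rule V(3))
      then show ?thesis using cont[OF c(1)] \<Xi>(2) unfolding continuous_character_def by blast
    qed
    then obtain V where V: "\<And>\<xi>. \<xi> \<in> \<Xi> \<Longrightarrow> openin \<tau> (V \<xi>)" "\<And>\<xi>. \<xi> \<in> \<Xi> \<Longrightarrow> 0 \<in> V \<xi>"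
      "\<And>\<xi> v. \<xi> \<in> \<Xi> \<Longrightarrow> v \<in> V \<xi> \<Longrightarrow> cmod (\<xi> v - 1) < \<delta>" by metis
    have "openin \<tau> (\<Inter> (insert UNIV (V ` \<Xi>)))"
      using \<Xi>(1) V(1) group_topology_openin_UNIV[OF gt] by (intro openin_Inter) auto
    moreover have "v + x \<in> U" if "v \<in> \<Inter> (insert UNIV (V ` \<Xi>))" for v
      using \<Xi>(4)[of v] V(3)[of _ v] that by auto
    ultimately show "\<exists>V. openin \<tau> V \<and> 0 \<in> V \<and> (\<forall>v\<in>V. v + x \<in> U)"
      using V(2) by (intro exI[of _ "\<Inter> (insert UNIV (V ` \<Xi>))"]) auto
  qed
  then have "finest_precompact u \<tau>" unfolding finest_precompact_def using \<tau> lim by blast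
  then show ?thesis by blast
qed

section \<open>Metrizable precompact groups\<close>

theorem theoremA:
  fixes \<tau> :: "'a::ab_group_add topology"
  assumes "precompact_topology \<tau>" and "metrizable_space \<tau>"
  shows "(ss_characterized \<tau> \<longleftrightarrow> countable (UNIV :: 'a set)) \<and>
         (\<forall>u. characterizes u \<tau> \<longrightarrow> finite_index (group_closure (range u)))"
proof -
  have index: "finite_index (group_closure (range u))" if "characterizes u \<tau>" for u
    using that characterizing_sequence_finite_index[OF assms] by (simp add: characterizes_def)
  have "countable (UNIV :: 'a set)" if ss: "ss_characterized \<tau>"
  proof -
    obtain u where "characterizes u \<tau>" using ss by (auto simp: ss_characterized_def)
    then show ?thesis
      by (intro countable_of_finite_index[OF index] countable_group_closure) auto
  qed
  moreover have "ss_characterized \<tau>" if count: "countable (UNIV :: 'a set)"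
  proof -
    obtain u where "finest_precompact u \<tau>" using countable_ss_characterized[OF assms count] by blast
    then have "characterizes u \<tau>"
      unfolding characterizes_def TB_sequence_def finest_precompact_def by blast
    then show ?thesis using assms(1) by (auto simp: ss_characterized_def)
  qed
  ultimately show ?thesis using index by blast
qed

end
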